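(* In a mmWave network, consider a randomly selected AP in tier $i+1$, and let $k_i$ be the spatial multiplexing gain of its transmission hop. Assume that the channel follows the Rayleigh fading model. Then for every SINR threshold $\tau>0$ its coverage probability $\mathcal{C}(\tau,k_i)=\mathbb{P}(\mathrm{SINR}(k_i)>\tau)$ is $$\mathcal{C}(\tau,k_i)=\int_0^\infty\frac{f_{\mathrm L}(r)\,f_{\mathrm N}(r^{\alpha_{\mathrm L}/\alpha_{\mathrm N}})}{2\pi r^{\alpha_{\mathrm L}/\alpha_{\mathrm N}}\Lambda_0P_{\mathrm N}(r^{\alpha_{\mathrm L}/\alpha_{\mathrm N}})}\,\mathcal{C}_{\mathrm L}(\tau,r,k_i)\,dr+\int_0^\infty\frac{f_{\mathrm L}(r^{\alpha_{\mathrm N}/\alpha_{\mathrm L}})\,f_{\mathrm N}(r)}{2\pi r^{\alpha_{\mathrm N}/\alpha_{\mathrm L}}\Lambda_0P_{\mathrm L}(r^{\alpha_{\mathrm N}/\alpha_{\mathrm L}})}\,\mathcal{C}_{\mathrm N}(\tau,r,k_i)\,dr,$$ where $$f_{\mathrm L}(r)=2\pi r\Lambda_0P_{\mathrm L}(r)e^{-2\pi\Lambda_0\int_0^rP_{\mathrm L}(u)u\,du},\qquad f_{\mathrm N}(r)=2\pi r\Lambda_0P_{\mathrm N}(r)e^{-2\pi\Lambda_0\int_0^rP_{\mathrm N}(u)u\,du},$$ $$\mathcal{C}_{\mathrm L}(\tau,r,k_i)=\exp\Big(-\frac{r^{\alpha_{\mathrm L}}\tau\sigma^2}{G_{\mathrm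 A}^2\beta}\Big)\mathcal{L}_{\mathrm L}\Big(\frac{r^{\alpha_{\mathrm L}}\tau}{G_{\mathrm A}^2\beta},r,k_i\Big),\qquad \mathcal{C}_{\mathrm N}(\tau,r,k_i)=\exp\Big(-\frac{r^{\alpha_{\mathrm N}}\tau\sigma^2}{G_{\mathrm A}^2\beta}\Big)\mathcal{L}_{\mathrm N}\Big(\frac{r^{\alpha_{\mathrm N}}\tau}{G_{\mathrm A}^2\beta},r,k_i\Big),$$ and $$\mathcal{L}_{\mathrm L}(s,r,k)=\exp\Big(-2\pi\Lambda_0\int_r^\infty[1-\mathcal{G}_{\mathrm L}(s,u,k)]P_{\mathrm L}(u)u\,du\Big)\exp\Big(-2\pi\Lambda_0\int_{r^{\alpha_{\mathrm L}/\alpha_{\mathrm N}}}^\infty[1-\mathcal{G}_{\mathrm N}(s,u,k)]P_{\mathrm N}(u)u\,du\Big),$$ $$\mathcal{L}_{\mathrm N}(s,r,k)=\exp\Big(-2\pi\Lambda_0\int_r^\infty[1-\mathcal{G}_{\mathrm N}(s,u,k)]P_{\mathrm N}(u)u\,du\Big)\exp\Big(-2\pi\Lambda_0\int_{r^{\alpha_{\mathrm N}/\alpha_{\mathrm L}}}^\infty[1-\mathcal{G}_{\mathrm L}(s,u,k)]P_{\mathrm L}(u)u\,du\Big),$$ with $\mathcal{G}_{\mathrm L}(s,u,k)=\mathbb{E}\big[e^{-s\beta h\,\mathbb{G}(k)u^{-\alpha_{\mathrm L}}}\big]$ and $\mathcal{G}_{\mathrm N}(s,u,k)=\mathbb{E}\big[e^{-s\beta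 h\,\mathbb{G}(k)u^{-\alpha_{\mathrm N}}}\big]$, the expectation being over the independent fading $h$ and beamforming gain $\mathbb{G}(k)$.
   Context: Network model: $\phi_i\subset\mathbb{R}^2$ is the set of APs transmitting at hop $i+1$; it is a homogeneous Poisson point process of intensity $\Lambda_0>0$. Tier $i+1$ is the set of receivers of hop $i+1$. A randomly selected receiver of tier $i+1$ is placed at the origin, a location independent of $\phi_i$, and is served by the AP $x_0\in\phi_i$ from which it receives the maximum average power, i.e. the point of $\phi_i$ with largest path gain $\ell$ (all APs transmit at the same power). The positive integer $k_i$ is the spatial multiplexing gain: the number of data streams (equivalently of served receivers) of each AP in $\phi_i$. Path loss: a link of length $r$ is line-of-sight (LOS) with probability $P_{\mathrm L}(r)$ and non-line-of-sight (NLOS) with probability $P_{\mathrm N}(r)=1-P_{\mathrm L}(r)$, independently over links; its path gain is $\ell(r)=\beta r^{-\alpha_{\mathrm L}}$ if LOS and $\ell(r)=\beta r^{-\alpha_{\mathrm N}}$ if NLOS, with constants $\beta,\alpha_{\mathrm L},\alpha_{\mathrm N}>0$. Beamforming: $G_{\mathrm A}$ and $g_{\mathrm A}$ are the beamforming gains inside and outside the main lobe of an analog beam of main-lobe width $\theta_{\mathrm A}$. The random transceiver beamforming gain $\mathbb{G}(k)$ between two APs that are not a transmitter–receiver pair takes the values $G_{\mathrm A}^2$, $G_{\mathrm A}g_{\mathrm A}$, $g_{\mathrm A}^2$ with probabilities $\big(\tfrac{\theta_{\mathrm A}k}{2\pi}\big)^2$, $\tfrac{\theta_{\mathrm A}k}{\pi}\big(1-\tfrac{\theta_{\mathrm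 A}k}{2\pi}\big)$, $\big(1-\tfrac{\theta_{\mathrm A}k}{2\pi}\big)^2$ respectively (so $\theta_{\mathrm A}k\le2\pi$). The gain from $x_0$ to the origin is $G_{\mathrm A}^2$. Interference between the streams of the same transmitter is cancelled. SINR: with noise power $\sigma^2\ge 0$, $$\mathrm{SINR}(k_i)=\frac{h_0G_{\mathrm A}^2\,\ell(|x_0|)}{\sigma^2+\sum_{x_b\in\phi_i\setminus\{x_0\}}h_b\,\mathbb{G}_b(k_i)\,\ell(|x_b|)},$$ where $h_b$ is the channel fading (power) from $x_b$ to the origin and $\mathbb{G}_b(k_i)$ are independent copies of $\mathbb{G}(k_i)$. Rayleigh fading means that $h_0$ and all $h_b$ are i.i.d. exponential random variables with mean $1$. The fadings, beamforming gains, LOS states and $\phi_i$ are independent, and $h$ in $\mathcal{G}_{\mathrm L},\mathcal{G}_{\mathrm N}$ is a copy of these fadings. Convention: since $f_{\mathrm N}(u)$ contains the factor $2\pi u\Lambda_0P_{\mathrm N}(u)$ and $f_{\mathrm L}(u)$ the factor $2\pi u\Lambda_0P_{\mathrm L}(u)$, the quotients in the formula are read after cancelling these factors (relevant only where $P_{\mathrm N}$ or $P_{\mathrm L}$ vanishes). *)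

theory Defs
  imports "HOL-Probability.Probability"
begin

definition homogeneous_ppp ::
    "'w measure \<Rightarrow> real \<Rightarrow> ('w \<Rightarrow> 'a::euclidean_space set) \<Rightarrow> bool" where
  "homogeneous_ppp M \<Lambda> \<Phi> \<longleftrightarrow>
     (\<forall>w\<in>space M. \<forall>B. bounded B \<longrightarrow> finite (\<Phi> w \<inter> B)) \<and>
     (\<forall>B\<in>sets borel. bounded B \<longrightarrow>
        (\<lambda>w. card (\<Phi> w \<inter> B)) \<in> M \<rightarrow>\<^sub>M count_space UNIV \<and>
        (\<forall>n. measure M {w \<in> space M. card (\<Phi> w \<inter> B) = n} =
             (\<Lambda> * measure lborel B) ^ n / fact n * exp (- (\<Lambda> * measure lborel B)))) \<and>
     (\<forall>(I :: nat set) B. finite I \<longrightarrow> disjoint_family_on B I \<longrightarrow>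
        (\<forall>i\<in>I. B i \<in> sets borel \<and> bounded (B i)) \<longrightarrow>
        prob_space.indep_vars M (\<lambda>_. count_space UNIV) (\<lambda>i w. card (\<Phi> w \<inter> B i)) I)"

text \<open>
  Given the locations \<open>X\<close> of the transmitters, the links to the origin are line-of-sight
  independently of each other, the \<open>n\<close>-th one with probability \<open>PL (norm (X n))\<close>. The events
  \<open>\<forall>n\<in>I. L n\<close> form a generating pi-system, so they determine the conditional law of \<open>L\<close>.
\<close>

definition los_states ::
    "'w measure \<Rightarrow> (real \<Rightarrow> real) \<Rightarrow> (nat \<Rightarrow> 'w \<Rightarrow> 'a::euclidean_space) \<Rightarrow> (nat \<Rightarrow> 'w \<Rightarrow> bool) \<Rightarrow> bool"
  where
  "los_states M PL X L \<longleftrightarrow>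
     (\<forall>n. L n \<in> M \<rightarrow>\<^sub>M count_space UNIV) \<and>
     (\<forall>I. finite I \<longrightarrow>
        (AE w in M.
           real_cond_exp M (vimage_algebra (space M) (\<lambda>w n. X n w) (\<Pi>\<^sub>M n\<in>UNIV. borel))
             (indicator {w \<in> space M. \<forall>n\<in>I. L n w}) w
           = (\<Prod>n\<in>I. PL (norm (X n w)))))"

definition path_gain :: "real \<Rightarrow> real \<Rightarrow> real \<Rightarrow> bool \<Rightarrow> real \<Rightarrow> real" where
  "path_gain \<beta> \<alpha>L \<alpha>N los r = \<beta> * r powr (- (if los then \<alpha>L else \<alpha>N))"

text \<open>\<open>pmf_of_list\<close> adds up the weights of equal values, so \<open>GA = gA\<close> is covered as well.\<close>

definition bf_gain_pmf :: "real \<Rightarrow> real \<Rightarrow> real \<Rightarrow> nat \<Rightarrow> real pmf" where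
  "bf_gain_pmf GA gA \<theta>A k = pmf_of_list
     [(GA\<^sup>2, (\<theta>A * real k / (2 * pi))\<^sup>2),
      (GA * gA, \<theta>A * real k / pi * (1 - \<theta>A * real k / (2 * pi))),
      (gA\<^sup>2, (1 - \<theta>A * real k / (2 * pi))\<^sup>2)]"

text \<open>
  \<open>serving\<close>, \<open>interference\<close> and \<open>SINR\<close> are evaluated at one outcome: \<open>x n\<close>, \<open>los n\<close>, \<open>h n\<close>, \<open>G n\<close> are the
  location, LOS state, fading and beamforming gain of the \<open>n\<close>-th point of the process.
  The maximiser is almost surely unique; the least index only makes the choice measurable on
  the exceptional null set.
\<close>

definition serving ::
    "real \<Rightarrow> real \<Rightarrow> real \<Rightarrow> (nat \<Rightarrow> 'a::euclidean_space) \<Rightarrow> (nat \<Rightarrow> bool) \<Rightarrow> nat" where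
  "serving \<beta> \<alpha>L \<alpha>N x los =
     (LEAST n. \<forall>m. path_gain \<beta> \<alpha>L \<alpha>N (los m) (norm (x m)) \<le> path_gain \<beta> \<alpha>L \<alpha>N (los n) (norm (x n)))"

text \<open>
  Interference is a sum in \<^typ>\<open>ennreal\<close>: for path-loss exponents at most 2 it can be infinite,
  and then the SINR is 0.
\<close>

definition interference ::
    "real \<Rightarrow> real \<Rightarrow> real \<Rightarrow> (nat \<Rightarrow> 'a::euclidean_space) \<Rightarrow> (nat \<Rightarrow> bool) \<Rightarrow>
     (nat \<Rightarrow> real) \<Rightarrow> (nat \<Rightarrow> real) \<Rightarrow> ennreal" where
  "interference \<beta> \<alpha>L \<alpha>N x los h G =
     (\<Sum>n. if n = serving \<beta> \<alpha>L \<alpha>N x los then 0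
          else ennreal (h n * G n * path_gain \<beta> \<alpha>L \<alpha>N (los n) (norm (x n))))"

definition SINR ::
    "real \<Rightarrow> real \<Rightarrow> real \<Rightarrow> real \<Rightarrow> real \<Rightarrow> (nat \<Rightarrow> 'a::euclidean_space) \<Rightarrow> (nat \<Rightarrow> bool) \<Rightarrow>
     (nat \<Rightarrow> real) \<Rightarrow> (nat \<Rightarrow> real) \<Rightarrow> ennreal" where
  "SINR \<beta> \<alpha>L \<alpha>N GA \<sigma> x los h G =
     (let n0 = serving \<beta> \<alpha>L \<alpha>N x los in
      ennreal (h n0 * GA\<^sup>2 * path_gain \<beta> \<alpha>L \<alpha>N (los n0) (norm (x n0)))
      / (ennreal (\<sigma>\<^sup>2) + interference \<beta> \<alpha>L \<alpha>N x los h G))"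

definition void_prob :: "real \<Rightarrow> (real \<Rightarrow> real) \<Rightarrow> real \<Rightarrow> real" where
  "void_prob \<Lambda> P r = exp (- 2 * pi * \<Lambda> * (LBINT u:{0..r}. P u * u))"

text \<open>
  \<open>contact_density \<Lambda> PL\<close> is the function \<open>f\<^sub>L\<close>, \<open>contact_density \<Lambda> PN\<close> is \<open>f\<^sub>N\<close>.
  The quotient \<open>f\<^sub>N(x) / (2 \<pi> x \<Lambda> PN(x))\<close> is read after cancellation, that is, as
  \<open>void_prob \<Lambda> PN x\<close>, which is meaningful also where \<open>PN\<close> vanishes; likewise for \<open>f\<^sub>L\<close>.
\<close>

definition contact_density :: "real \<Rightarrow> (real \<Rightarrow> real) \<Rightarrow> real \<Rightarrow> real" where
  "contact_density \<Lambda> P r = 2 * pi * r * \<Lambda> * P r * void_prob \<Lambda> P r"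

definition gain_laplace ::
    "real \<Rightarrow> real \<Rightarrow> real \<Rightarrow> real \<Rightarrow> real \<Rightarrow> real \<Rightarrow> real \<Rightarrow> nat \<Rightarrow> real" where
  "gain_laplace \<beta> GA gA \<theta>A \<alpha> s u k =
     (LINT p | (density lborel (exponential_density 1) \<Otimes>\<^sub>M measure_pmf (bf_gain_pmf GA gA \<theta>A k)).
        exp (- (s * \<beta> * fst p * snd p * u powr (- \<alpha>))))"

definition exp_minus :: "ennreal \<Rightarrow> real" where
  "exp_minus x = (if x = \<top> then 0 else exp (- enn2real x))"

text \<open>
  Laplace transform of the interference when the serving link has length \<open>r\<close>, path-loss exponent
  \<open>\<alpha>\<close> and type probability \<open>P\<close>, while \<open>\<alpha>'\<close>, \<open>P'\<close> belong to the other link type. With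
  (\<open>\<alpha>\<close>, \<open>P\<close>, \<open>\<alpha>'\<close>, \<open>P'\<close>) = (\<open>\<alpha>L\<close>, \<open>PL\<close>, \<open>\<alpha>N\<close>, \<open>PN\<close>) this is the function for a LOS serving link, with the two
  types exchanged the one for a NLOS serving link. The integrals may diverge (exponents at most 2);
  then the exponential factor is 0.
\<close>

definition interference_laplace ::
    "real \<Rightarrow> real \<Rightarrow> real \<Rightarrow> real \<Rightarrow> real \<Rightarrow> real \<Rightarrow> (real \<Rightarrow> real) \<Rightarrow> real \<Rightarrow> (real \<Rightarrow> real) \<Rightarrow>
     real \<Rightarrow> real \<Rightarrow> nat \<Rightarrow> real" where
  "interference_laplace \<Lambda> \<beta> GA gA \<theta>A \<alpha> P \<alpha>' P' s r k =
     exp_minus (ennreal (2 * pi * \<Lambda>) *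
       (\<integral>\<^sup>+u\<in>{r..}. ennreal ((1 - gain_laplace \<beta> GA gA \<theta>A \<alpha> s u k) * P u * u) \<partial>lborel)) *
     exp_minus (ennreal (2 * pi * \<Lambda>) *
       (\<integral>\<^sup>+u\<in>{r powr (\<alpha> / \<alpha>')..}. ennreal ((1 - gain_laplace \<beta> GA gA \<theta>A \<alpha>' s u k) * P' u * u) \<partial>lborel))"

definition cond_coverage ::
    "real \<Rightarrow> real \<Rightarrow> real \<Rightarrow> real \<Rightarrow> real \<Rightarrow> real \<Rightarrow> real \<Rightarrow> (real \<Rightarrow> real) \<Rightarrow> real \<Rightarrow> (real \<Rightarrow> real) \<Rightarrow>
     real \<Rightarrow> real \<Rightarrow> nat \<Rightarrow> real" where
  "cond_coverage \<Lambda> \<beta> GA gA \<theta>A \<sigma> \<alpha> P \<alpha>' P' \<tau> r k =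
     exp (- (r powr \<alpha> * \<tau> * \<sigma>\<^sup>2 / (GA\<^sup>2 * \<beta>))) *
     interference_laplace \<Lambda> \<beta> GA gA \<theta>A \<alpha> P \<alpha>' P' (r powr \<alpha> * \<tau> / (GA\<^sup>2 * \<beta>)) r k"

end

theory Submission
  imports Defs
begin

text \<open>
  Describe the point \<open>n\<close> by its equivalent distance \<open>Y\<^sub>n = |X\<^sub>n|\<^sup>\<alpha>\<close>, with the exponent of its
  link type, so that the path gain is \<open>\<beta> / Y\<^sub>n\<close> and the serving point realises \<open>T = min\<^sub>n Y\<^sub>n\<close>.
  Let \<open>\<phi>\<close> be the Laplace transform of fading times beamforming gain and \<open>\<kappa> = \<tau> / GA\<^sup>2\<close>.
  Given the links, Rayleigh fading makes the coverage probability
  \<open>exp (- \<kappa> T \<sigma>\<^sup>2 / \<beta>) \<Prod>\<^sub>n \<phi> (\<kappa> T / Y\<^sub>n)\<close>, the product being over the interferers. The serving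
  point would contribute the constant factor \<open>\<phi> \<kappa>\<close>, so one may multiply over all points
  and divide by \<open>\<phi> \<kappa>\<close>; this avoids Palm calculus and the uniqueness of the serving point.

  If \<open>T\<close> in the factors is replaced by a fixed \<open>s\<close>, the expectation over the event \<open>t \<le> T\<close> is a
  value \<open>Q s t\<close> of the probability generating functional of a marked Poisson process. A Stieltjes
  argument writes \<open>Q s t - Q s t'\<close> as an integral over the links with \<open>t \<le> Y < t'\<close>, and the
  original expectation, where \<open>s = T\<close>, is recovered by rounding \<open>T\<close> down to dyadic numbers.
\<close>

section \<open>Infinite products and the extended exponential\<close>

text \<open>With \<psi> s y = \<phi> (\<kappa> s / y), the weight
  \<open>\<Prod>\<^sub>n \<psi> T Y\<^sub>n\<close> is not a product functional of the process,
  since every factor contains T. Freezing the first argument at s leaves only the event t \<le> T,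
  which is a product of indicators of \<open>t \<le> Y\<^sub>n\<close>; hence \<open>Q s t\<close>
  needs nothing but the generating functional. Differentiation in t alone then gives - d Q s t = Q s
  t * \<psi> s t * \<nu> (dt), with \<nu> the intensity of the equivalent distances. On the diagonal
  the additional factor is \<psi> t t = \<phi> \<kappa>, exactly the constant by which the product
  over all points differs from that over the interferers, so it cancels. Rounding has to go
  downwards: an infinite product of factors in [0,1] is stable under limits from above only, and
  \<psi> decreases in s. Path-loss exponents of at most 2 may make the interference infinite; the
  infinite product and \<open>exp_minus\<close> then take the value 0, so both are set up to cover
  divergence.\<close>

definition inf_prod :: "(nat \<Rightarrow> real) \<Rightarrow> real" where
  "inf_prod f = (INF N. \<Prod>n<N. f n)"

lemma inf_prod_bdd_below:
  assumes "\<And>n. 0 \<le> (f n :: real)"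
  shows "bdd_below (range (\<lambda>N. \<Prod>n<N. f n :: real))"
  by (rule bdd_belowI[of _ 0]) (auto intro!: prod_nonneg assms)

text \<open>Factors in [0,1] make the partial products decrease, so their infimum is a limit. It
  always exists; the value 0 includes products that diverge to 0.\<close>

lemma inf_prod_LIMSEQ:
  assumes "\<And>n. 0 \<le> f n" "\<And>n. f n \<le> 1"
  shows "(\<lambda>N. \<Prod>n<N. f n) \<longlonglongrightarrow> inf_prod f"
  unfolding inf_prod_def
proof (rule LIMSEQ_decseq_INF)
  show "bdd_below (range (\<lambda>N. \<Prod>n<N. f n))"
    by (rule inf_prod_bdd_below) (rule assms)
  show "decseq (\<lambda>N. \<Prod>n<N. f n)"
    by (rule decseq_SucI) (use assms in \<open>auto intro!: mult_left_le prod_nonneg\<close>)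
qed

lemma inf_prod_le_prod:
  assumes "\<And>n. 0 \<le> (f n :: real)"
  shows "inf_prod f \<le> (\<Prod>n<N. f n)"
  unfolding inf_prod_def by (rule cINF_lower[OF inf_prod_bdd_below]) (auto intro: assms)

lemma inf_prod_nonneg:
  assumes "\<And>n. 0 \<le> (f n :: real)"
  shows "0 \<le> inf_prod f"
  unfolding inf_prod_def by (rule cINF_greatest) (auto intro!: prod_nonneg assms)

lemma inf_prod_le_1:
  assumes "\<And>n. 0 \<le> (f n :: real)"
  shows "inf_prod f \<le> 1"
  using inf_prod_le_prod[of f 0] assms by simp

lemma inf_prod_mono:
  fixes f g :: "nat \<Rightarrow> real"
  assumes "\<And>n. 0 \<le> f n" "\<And>n. f n \<le> g n"
  shows "inf_prod f \<le> inf_prod g"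
  unfolding inf_prod_def
  by (rule cINF_mono[OF _ inf_prod_bdd_below]) (auto intro!: assms prod_mono exI)

text \<open>The lower bound is monotonicity; the upper bound comes from a single finite partial
  product, where limits are harmless. From below the claim fails: let all factors be 1 except for a
  0 at position k.\<close>

lemma inf_prod_tendsto:
  fixes f :: "nat \<Rightarrow> real"
  assumes 0: "\<And>n. 0 \<le> f n" and le: "\<And>k n. f n \<le> g k n" and g: "\<And>n. (\<lambda>k. g k n) \<longlonglongrightarrow> f n"
  shows "(\<lambda>k. inf_prod (g k)) \<longlonglongrightarrow> inf_prod f"
proof (rule order_tendstoI)
  fix a assume "a < inf_prod f"
  then show "\<forall>\<^sub>F k in sequentially. a < inf_prod (g k)"
    using inf_prod_mono[of f, OF 0 le] by (intro always_eventually allI) (rule less_le_trans)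
next
  fix a assume "inf_prod f < a"
  then obtain N where N: "(\<Prod>n<N. f n) < a"
    unfolding inf_prod_def by (subst (asm) cINF_less_iff) (use 0 in \<open>auto intro: inf_prod_bdd_below\<close>)
  have "(\<lambda>k. \<Prod>n<N. g k n) \<longlonglongrightarrow> (\<Prod>n<N. f n)"
    by (intro tendsto_prod g)
  from order_tendstoD(2)[OF this N] show "\<forall>\<^sub>F k in sequentially. inf_prod (g k) < a"
  proof eventually_elim
    case (elim k)
    then show ?case
      using inf_prod_le_prod[of "g k" N] order_trans[OF 0 le] by fastforce
  qed
qed

text \<open>Absorbs the event that all points lie in \<open>A\<close> into the factors, so that
  weight times event is again a product over the points.\<close>

lemma inf_prod_indicator_mult:
  assumes "\<And>n. 0 \<le> (f n :: real)"
  shows "inf_prod (\<lambda>n. indicator A (x n) * f n) = indicator {x. \<forall>n. x n \<in> A} x * inf_prod f"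
proof (cases "\<forall>n. x n \<in> A")
  case False
  then obtain n where n: "x n \<notin> A" by blast
  let ?f = "\<lambda>n. indicator A (x n) * f n"
  have "inf_prod ?f \<le> (\<Prod>i<Suc n. ?f i :: real)"
    by (rule inf_prod_le_prod) (auto simp: assms)
  also have "\<dots> = 0" using n by simp
  finally have "inf_prod ?f \<le> 0" .
  moreover have "0 \<le> inf_prod ?f" by (rule inf_prod_nonneg) (auto simp: assms)
  ultimately show ?thesis using False by simp
qed simp

text \<open>Setting the n-th factor to 1 removes the serving point from the product. The
  multiplicative form stays correct if \<open>f n\<close> is 0, where a quotient would make no
  sense.\<close>

lemma inf_prod_factor:
  assumes "\<And>m. 0 \<le> f m" "\<And>m. f m \<le> 1"
  shows "f n * inf_prod (f(n := 1)) = inf_prod f"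
proof (rule LIMSEQ_unique)
  show "(\<lambda>N. f n * (\<Prod>m<N. (f(n := 1)) m)) \<longlonglongrightarrow> f n * inf_prod (f(n := 1))"
    by (intro tendsto_mult tendsto_const inf_prod_LIMSEQ) (auto simp: assms)
  have "\<forall>\<^sub>F N in sequentially. (\<Prod>m<N. f m) = f n * (\<Prod>m<N. (f(n := 1)) m)"
    using eventually_gt_at_top[of n]
  proof eventually_elim
    case (elim N)
    have "(\<Prod>m<N. f m) = f n * (\<Prod>m\<in>{..<N} - {n}. f m)"
      by (rule prod.remove) (use elim in auto)
    also have "(\<Prod>m\<in>{..<N} - {n}. f m) = (\<Prod>m\<in>{..<N} - {n}. (f(n := 1)) m)"
      by (rule prod.cong) auto
    also have "\<dots> = (\<Prod>m<N. (f(n := 1)) m)"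
      using prod.remove[of "{..<N}" n "f(n := 1)"] elim by simp
    finally show ?case .
  qed
  from Lim_transform_eventually[OF inf_prod_LIMSEQ[OF assms] this]
  show "(\<lambda>N. f n * (\<Prod>m<N. (f(n := 1)) m)) \<longlonglongrightarrow> inf_prod f" .
qed

lemma borel_measurable_inf_prod [measurable]:
  assumes [measurable]: "\<And>n. f n \<in> borel_measurable M" and "\<And>n x. 0 \<le> f n x"
  shows "(\<lambda>x. inf_prod (\<lambda>n. f n x)) \<in> borel_measurable M"
  unfolding inf_prod_def
  by (intro borel_measurable_cINF) (auto intro: inf_prod_bdd_below assms)

section \<open>The exponential on the extended nonnegative reals\<close>

lemma exp_minus_ennreal [simp]: "0 \<le> x \<Longrightarrow> exp_minus (ennreal x) = exp (- x)"
  by (simp add: exp_minus_def)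

lemma exp_minus_top [simp]: "exp_minus \<top> = 0"
  by (simp add: exp_minus_def)

lemma exp_minus_0 [simp]: "exp_minus 0 = 1"
  by (simp add: exp_minus_def)

lemma exp_minus_nonneg [simp]: "0 \<le> exp_minus x"
  by (simp add: exp_minus_def)

lemma exp_minus_le_1 [simp]: "exp_minus x \<le> 1"
  by (simp add: exp_minus_def)

lemma exp_minus_add: "exp_minus (x + y) = exp_minus x * exp_minus y"
  by (cases x; cases y) (auto simp: exp_add[symmetric] simp flip: ennreal_plus)

text \<open>Continuity extends to \<open>\<top>\<close>, because \<open>exp_minus\<close> falls
  below e once its argument exceeds - ln e. Limits of integrals can thus be taken inside it without
  knowing whether the integrals are finite.\<close>

lemma tendsto_exp_minus:
  assumes "(f \<longlongrightarrow> a) F"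
  shows "((\<lambda>x. exp_minus (f x)) \<longlongrightarrow> exp_minus a) F"
proof (cases a)
  case (real r)
  have "\<forall>\<^sub>F x in F. f x < \<top>"
    by (rule order_tendstoD[OF assms]) (simp add: real)
  then have "\<forall>\<^sub>F x in F. exp (- enn2real (f x)) = exp_minus (f x)"
    by eventually_elim (simp add: exp_minus_def)
  moreover have "((\<lambda>x. exp (- enn2real (f x))) \<longlongrightarrow> exp (- enn2real a)) F"
    using real assms by (intro tendsto_exp tendsto_minus tendsto_enn2real) auto
  ultimately show ?thesis
    using real by (auto elim: Lim_transform_eventually)
next
  case top
  have "((\<lambda>x. exp_minus (f x)) \<longlongrightarrow> 0) F"
  proof (rule order_tendstoI)
    fix e :: real assume "0 < e"
    have "\<forall>\<^sub>F x in F. ennreal (max 0 (- ln e)) < f x"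
      by (rule order_tendstoD[OF assms]) (simp add: top)
    then show "\<forall>\<^sub>F x in F. exp_minus (f x) < e"
    proof eventually_elim
      case (elim x)
      show ?case
      proof (cases "f x")
        case (real r)
        then have "max 0 (- ln e) < r" using elim ennreal_less_iff[of "max 0 (- ln e)" r] by simp
        then have "- r < ln e" by simp
        then have "exp (-r) < e" using \<open>0 < e\<close> by (metis exp_less_mono exp_ln)
        then show ?thesis using real by simp
      qed (use \<open>0 < e\<close> in simp)
    qed
  qed (auto intro!: always_eventually simp: less_le_trans)
  then show ?thesis using top by simp
qed

lemma borel_measurable_exp_minus [measurable]: "exp_minus \<in> borel_measurable borel"
  unfolding exp_minus_def by measurable

text \<open>A zero-derivative argument relative to \<open>K\<close> instead of the variable: over n
  steps with equal \<open>K\<close>-increment \<Delta>/n the function moves by at most n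
  (\<Delta>/n)^2 = \<Delta>^2/n. Continuity of \<open>K\<close> provides such steps.\<close>

lemma const_if_dist_le_square:
  fixes h K :: "real \<Rightarrow> real"
  assumes "a \<le> b" and K: "continuous_on {a..b} K" "K a \<le> K b"
    and h: "\<And>x y. x \<in> {a..b} \<Longrightarrow> y \<in> {a..b} \<Longrightarrow> \<bar>h x - h y\<bar> \<le> (K x - K y)\<^sup>2"
  shows "h a = h b"
proof -
  define \<Delta> where "\<Delta> = K b - K a"
  have \<Delta>: "0 \<le> \<Delta>" using K by (simp add: \<Delta>_def)
  have bound: "\<bar>h b - h a\<bar> \<le> \<Delta>\<^sup>2 / real n" if n: "0 < n" for n :: nat
  proof -
    \<comment> \<open>Intermediate values of \<open>K\<close> on an equidistant grid. The points
      found need not be ordered, which is harmless because the assumed bound holds for any two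
      points.\<close>
    have "\<exists>x\<in>{a..b}. K x = K a + real j / real n * \<Delta>" if "j \<le> n" for j
    proof -
      have "real j / real n * \<Delta> \<le> 1 * \<Delta>"
        by (rule mult_right_mono) (use that n \<Delta> in auto)
      then have "K a + real j / real n * \<Delta> \<le> K b"
        using \<Delta> by (simp add: \<Delta>_def)
      moreover have "K a \<le> K a + real j / real n * \<Delta>" using \<Delta> by simp
      ultimately have "\<exists>x. a \<le> x \<and> x \<le> b \<and> K x = K a + real j / real n * \<Delta>"
        using \<open>a \<le> b\<close> K(1) by (intro IVT') auto
      then show ?thesis by auto
    qed
    then obtain x where x: "\<And>j. j \<le> n \<Longrightarrow> x j \<in> {a..b} \<and> K (x j) = K a + real j / real n * \<Delta>"
      by metis
    \<comment> \<open>\<open>x 0\<close> and \<open>x n\<close> may differ from \<open>a\<close> and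
      \<open>b\<close>, but \<open>K\<close> agrees there, so the quadratic bound forces
      \<open>h\<close> to agree too.\<close>
    have *: "h (x 0) = h a" "h (x n) = h b"
      using h[of "x 0" a] h[of "x n" b] x[of 0] x[of n] n \<open>a \<le> b\<close> by (auto simp: \<Delta>_def)
    have "\<bar>h (x n) - h (x 0)\<bar> = \<bar>\<Sum>j<n. h (x (Suc j)) - h (x j)\<bar>"
      using sum_lessThan_telescope[of "\<lambda>j. h (x j)" n] by simp
    also have "\<dots> \<le> (\<Sum>j<n. \<bar>h (x (Suc j)) - h (x j)\<bar>)"
      by (rule sum_abs)
    also have "\<dots> \<le> (\<Sum>j<n. (\<Delta> / real n)\<^sup>2)"
    proof (rule sum_mono)
      fix j assume j: "j \<in> {..<n}"
      have "\<bar>h (x (Suc j)) - h (x j)\<bar> \<le> (K (x (Suc j)) - K (x j))\<^sup>2"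
        by (rule h) (use x[of j] x[of "Suc j"] j in auto)
      also have "K (x (Suc j)) - K (x j) = \<Delta> / real n"
        using x[of j] x[of "Suc j"] j by (simp add: add_divide_distrib algebra_simps)
      finally show "\<bar>h (x (Suc j)) - h (x j)\<bar> \<le> (\<Delta> / real n)\<^sup>2" .
    qed
    also have "\<dots> = \<Delta>\<^sup>2 / real n"
      using n by (simp add: power2_eq_square)
    finally show ?thesis using * by simp
  qed
  have "(\<lambda>n. \<Delta>\<^sup>2 / real n) \<longlonglongrightarrow> 0"
    by (rule lim_const_over_n)
  then have "\<bar>h b - h a\<bar> \<le> 0"
    by (rule LIMSEQ_le_const) (use bound in \<open>auto intro!: exI[of _ 1]\<close>)
  then show ?thesis by simp
qed

section \<open>Stieltjes integrals and evaluation on the diagonal\<close>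

text \<open>Both quantities lie between a d exp (- d) and a d, an interval of length a d (1 - exp (-
  d)) \<le> d^2. In the application a = exp (- F x), d is an increment of F, and \<open>H\<close> is
  the Stieltjes integral of exp (- F) over it.\<close>

lemma exp_diff_bound:
  fixes a d H :: real
  assumes a: "0 \<le> a" "a \<le> 1" and d: "0 \<le> d" and H: "a * exp (- d) * d \<le> H" "H \<le> a * d"
  shows "\<bar>a * (1 - exp (- d)) - H\<bar> \<le> d\<^sup>2"
proof -
  define e where "e = exp (- d)"
  have e: "0 \<le> e" "1 - e \<le> d" using exp_ge_add_one_self[of "- d"] by (auto simp: e_def)
  have "(1 + d) * e \<le> exp d * e"
    by (intro mult_right_mono exp_ge_add_one_self e)
  also have "\<dots> = 1" by (simp add: e_def exp_minus_inverse)
  finally have e2: "d * e \<le> 1 - e" by (simp add: distrib_right)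
  have 1: "a * (1 - e) \<le> a * d" "a * (d * e) \<le> a * (1 - e)"
    using e e2 a by (auto intro: mult_left_mono)
  have "d * (1 - e) \<le> d * d" using e d by (intro mult_left_mono)
  moreover have "a * (d * (1 - e)) \<le> 1 * (d * (1 - e))"
  proof (rule mult_right_mono)
    have "0 \<le> 1 - e" using d by (simp add: e_def)
    then show "0 \<le> d * (1 - e)" using d by simp
  qed (rule a)
  ultimately have 2: "a * (d * (1 - e)) \<le> d * d" by simp
  have "\<bar>a * (1 - e) - H\<bar> \<le> a * d - a * (d * e)"
    using 1 H unfolding e_def[symmetric] by (simp add: abs_le_iff mult.commute mult.left_commute)
  also have "\<dots> = a * (d * (1 - e))" by (simp add: algebra_simps)
  finally show ?thesis using 2 by (simp add: e_def power2_eq_square)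
qed

text \<open>This is d exp (- F) = - exp (- F) dF for the distribution function F of \<open>D\<close>
  under the \<psi>-weighted measure. A jump of F would falsify it; the continuous \<open>K\<close>
  dominates the increments of F and excludes jumps, without providing a derivative.\<close>

lemma nn_integral_exp_stieltjes:
  fixes \<nu> :: "'p measure" and D \<psi> :: "'p \<Rightarrow> real" and K :: "real \<Rightarrow> real"
  assumes [measurable]: "D \<in> borel_measurable \<nu>" "\<psi> \<in> borel_measurable \<nu>"
    and \<psi>: "\<And>p. 0 \<le> \<psi> p" "\<And>p. \<psi> p \<le> 1"
    and K: "continuous_on {0..} K"
    and K0: "emeasure \<nu> {p \<in> space \<nu>. D p < 0} = 0"
    and DK: "\<And>x y. 0 \<le> x \<Longrightarrow> x \<le> y \<Longrightarrow> K x \<le> K y \<and> emeasure \<nu> {p \<in> space \<nu>. x \<le> D p \<and> D p < y} \<le> ennreal (K y - K x)"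
    and ts: "0 \<le> t" "t \<le> t'"
  defines "F \<equiv> \<lambda>t. LINT p|\<nu>. indicator {..<t} (D p) * \<psi> p"
  shows "(\<integral>\<^sup>+p. ennreal (indicator {t..<t'} (D p) * (exp (- F (D p)) * \<psi> p)) \<partial>\<nu>) = ennreal (exp (- F t) - exp (- F t'))"
proof -
  have fin: "emeasure \<nu> {p \<in> space \<nu>. x \<le> D p \<and> D p < y} < \<infinity>" if "0 \<le> x" for x y
  proof (cases "x \<le> y")
    case True
    then show ?thesis using DK[OF that True] by (metis ennreal_less_top infinity_ennreal_def order_le_less_trans)
  next
    case False
    then have "{p \<in> space \<nu>. x \<le> D p \<and> D p < y} = {}" by auto
    then show ?thesis by (simp only: emeasure_empty) simp
  qed
  have int: "integrable \<nu> (\<lambda>p. indicator {x..<y} (D p) * f p)"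
    if [measurable]: "f \<in> borel_measurable \<nu>" and "\<And>p. \<bar>f p\<bar> \<le> 1" "0 \<le> x" for f :: "'p \<Rightarrow> real" and x y
  proof (rule Bochner_Integration.integrable_bound)
    have "emeasure \<nu> {p \<in> space \<nu>. x \<le> D p \<and> D p < y} = emeasure \<nu> (D -` {x..<y} \<inter> space \<nu>)"
      by (intro arg_cong[where f="emeasure \<nu>"]) auto
    then show "integrable \<nu> (indicator (D -` {x..<y} \<inter> space \<nu>) :: _ \<Rightarrow> real)"
      using fin[OF \<open>0 \<le> x\<close>, of y] by (intro integrable_real_indicator) auto
    show "AE p in \<nu>. norm (indicator {x..<y} (D p) * f p) \<le> norm (indicator (D -` {x..<y} \<inter> space \<nu>) p :: real)"
      using that by (intro AE_I2) (auto simp: indicator_def)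
  qed measurable
  have pos: "AE p in \<nu>. 0 \<le> D p"
    using K0 by (intro AE_I[where N="{p \<in> space \<nu>. D p < 0}"]) auto
  have abs_\<psi>: "\<bar>\<psi> p\<bar> \<le> 1" for p using \<psi>[of p] by simp
  have F_eq: "F x = (LINT p|\<nu>. indicator {0..<x} (D p) * \<psi> p)" for x
    unfolding F_def by (rule integral_cong_AE) (use pos in \<open>auto elim!: eventually_mono simp: indicator_def\<close>)
  have F_diff: "F y - F x = (LINT p|\<nu>. indicator {x..<y} (D p) * \<psi> p)" if "0 \<le> x" "x \<le> y" for x y
  proof -
    have "F y - F x = (LINT p|\<nu>. indicator {0..<y} (D p) * \<psi> p - indicator {0..<x} (D p) * \<psi> p)"
      unfolding F_eq by (rule Bochner_Integration.integral_diff[symmetric]; rule int) (auto simp: abs_\<psi>)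
    also have "\<dots> = (LINT p|\<nu>. indicator {x..<y} (D p) * \<psi> p)"
      by (rule Bochner_Integration.integral_cong) (use that in \<open>auto simp: indicator_def\<close>)
    finally show ?thesis .
  qed
  have F_mono: "F x \<le> F y" if "0 \<le> x" "x \<le> y" for x y
  proof -
    have "0 \<le> F y - F x" unfolding F_diff[OF that] by (intro integral_nonneg_AE) (auto simp: \<psi>)
    then show ?thesis by simp
  qed
  have F_K: "F y - F x \<le> K y - K x" if "0 \<le> x" "x \<le> y" for x y
  proof -
    have "ennreal (F y - F x) = (\<integral>\<^sup>+p. ennreal (indicator {x..<y} (D p) * \<psi> p) \<partial>\<nu>)"
      unfolding F_diff[OF that] by (rule nn_integral_eq_integral[symmetric]) (auto intro!: int simp: \<psi> that abs_\<psi>)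
    also have "\<dots> \<le> (\<integral>\<^sup>+p. indicator {p \<in> space \<nu>. x \<le> D p \<and> D p < y} p \<partial>\<nu>)"
      by (rule nn_integral_mono) (auto simp: indicator_def \<psi>)
    also have "\<dots> = emeasure \<nu> {p \<in> space \<nu>. x \<le> D p \<and> D p < y}"
      by (rule nn_integral_indicator) measurable
    also have "\<dots> \<le> ennreal (K y - K x)" using DK[OF that] by simp
    finally show ?thesis using DK[OF that] by (subst (asm) ennreal_le_iff) auto
  qed
  have F0: "F x = 0" if "x \<le> 0" for x
  proof -
    have "F x = (LINT p|\<nu>. 0)"
      unfolding F_def
      by (rule integral_cong_AE) (use that pos in \<open>auto elim!: eventually_mono simp: indicator_def\<close>)
    then show ?thesis by simp
  qed
  have F_mono': "F x \<le> F y" if "x \<le> y" for x y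
  proof (cases "0 \<le> x")
    case True then show ?thesis using that by (rule F_mono)
  next
    case False
    then have "F x = 0" by (intro F0) simp
    moreover have "0 \<le> F y" unfolding F_def by (intro integral_nonneg_AE) (auto simp: \<psi>)
    ultimately show ?thesis by simp
  qed
  have [measurable]: "F \<in> borel_measurable borel"
    by (rule borel_measurable_mono) (intro monoI F_mono')
  have F_nn: "0 \<le> F x" for x
    unfolding F_def by (intro integral_nonneg_AE) (auto simp: \<psi>)
  define H where "H x y = (LINT p|\<nu>. indicator {x..<y} (D p) * (exp (- F (D p)) * \<psi> p))" for x y
  have H_int: "integrable \<nu> (\<lambda>p. indicator {x..<y} (D p) * (exp (- F (D p)) * \<psi> p))" if "0 \<le> x" for x y
  proof (rule int)
    fix p
    have "exp (- F (D p)) * \<psi> p \<le> 1 * 1" by (intro mult_mono) (auto simp: \<psi> F_nn)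
    then show "\<bar>exp (- F (D p)) * \<psi> p\<bar> \<le> 1" by (simp add: abs_mult abs_of_nonneg[OF \<psi>(1)])
  qed (use that in measurable)
  have H_le: "H x y \<le> exp (- F x) * (F y - F x)" if "0 \<le> x" "x \<le> y" for x y
    unfolding F_diff[OF that] integral_mult_right_zero[symmetric] H_def
  proof (rule integral_mono)
    show "integrable \<nu> (\<lambda>p. exp (- F x) * (indicator {x..<y} (D p) * \<psi> p))"
      by (intro integrable_mult_right int) (use that abs_\<psi> in auto)
    fix p
    have "exp (- F (D p)) * \<psi> p \<le> exp (- F x) * \<psi> p" if "x \<le> D p"
      using F_mono'[OF that] by (intro mult_right_mono) (auto simp: \<psi>)
    then show "indicator {x..<y} (D p) * (exp (- F (D p)) * \<psi> p) \<le> exp (- F x) * (indicator {x..<y} (D p) * \<psi> p)"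
      by (simp add: indicator_def)
  qed (rule H_int, fact)
  have H_ge: "exp (- F y) * (F y - F x) \<le> H x y" if "0 \<le> x" "x \<le> y" for x y
    unfolding F_diff[OF that] integral_mult_right_zero[symmetric] H_def
  proof (rule integral_mono)
    show "integrable \<nu> (\<lambda>p. exp (- F y) * (indicator {x..<y} (D p) * \<psi> p))"
      by (intro integrable_mult_right int) (use that abs_\<psi> in auto)
    fix p
    have "exp (- F y) * \<psi> p \<le> exp (- F (D p)) * \<psi> p" if "D p < y"
      using F_mono'[of "D p" y] that by (intro mult_right_mono) (auto simp: \<psi>)
    then show "exp (- F y) * (indicator {x..<y} (D p) * \<psi> p) \<le> indicator {x..<y} (D p) * (exp (- F (D p)) * \<psi> p)"
      by (simp add: indicator_def)
  qed (rule H_int, fact)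
  have H_add: "H x z = H x y + H y z" if "0 \<le> x" "x \<le> y" "y \<le> z" for x y z
  proof -
    let ?f = "\<lambda>p. exp (- F (D p)) * \<psi> p"
    have "H x z = (LINT p|\<nu>. indicator {x..<y} (D p) * ?f p + indicator {y..<z} (D p) * ?f p)"
      unfolding H_def using that by (intro Bochner_Integration.integral_cong) (auto simp: indicator_def)
    also have "\<dots> = H x y + H y z"
      unfolding H_def by (intro Bochner_Integration.integral_add H_int) (use that in auto)
    finally show ?thesis .
  qed
  \<comment> \<open>The claim says that this sum is constant. By \<open>exp_diff_bound\<close> its
    increments are quadratic in those of F, hence in those of \<open>K\<close>.\<close>
  define hh where "hh x = exp (- F x) + H 0 x" for x
  have hh_le: "\<bar>hh x - hh y\<bar> \<le> (K x - K y)\<^sup>2" if "0 \<le> x" "x \<le> y" for x y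
  proof -
    have "exp (- F y) = exp (- F x) * exp (- (F y - F x))"
      unfolding exp_add[symmetric] by simp
    moreover have "hh x - hh y = exp (- F x) - exp (- F y) - H x y"
      using H_add[of 0 x y] that unfolding hh_def by simp
    ultimately have "\<bar>hh x - hh y\<bar> \<le> (F y - F x)\<^sup>2"
      using exp_diff_bound[of "exp (- F x)" "F y - F x" "H x y"] H_le[OF that] H_ge[OF that] F_mono[OF that] F_nn[of x]
      by (simp add: right_diff_distrib)
    also have "\<dots> \<le> (K y - K x)\<^sup>2"
      using F_mono[OF that] F_K[OF that] by (intro power_mono) auto
    finally show ?thesis using power2_commute[of "K x" "K y"] by simp
  qed
  have "hh t = hh t'"
  proof (rule const_if_dist_le_square[of t t' K])
    show "continuous_on {t..t'} K" by (rule continuous_on_subset[OF K]) (use ts in auto)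
    show "K t \<le> K t'" using DK[of t t'] ts by simp
    fix x y assume "x \<in> {t..t'}" "y \<in> {t..t'}"
    then show "\<bar>hh x - hh y\<bar> \<le> (K x - K y)\<^sup>2"
      using hh_le[of x y] hh_le[of y x] ts power2_commute[of "K x" "K y"] abs_minus_commute[of "hh x" "hh y"]
      by (cases "x \<le> y") simp_all
  qed (use ts in auto)
  then have "H t t' = exp (- F t) - exp (- F t')"
    using H_add[of 0 t t'] ts by (simp add: hh_def)
  moreover have "(\<integral>\<^sup>+p. ennreal (indicator {t..<t'} (D p) * (exp (- F (D p)) * \<psi> p)) \<partial>\<nu>) = ennreal (H t t')"
    unfolding H_def by (rule nn_integral_eq_integral) (auto intro!: H_int ts simp: \<psi>)
  ultimately show ?thesis by simp
qed

section \<open>Rounding down to dyadic numbers\<close>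

definition dyadic_floor :: "nat \<Rightarrow> real \<Rightarrow> real" where
  "dyadic_floor k y = of_int \<lfloor>2 ^ k * y\<rfloor> / 2 ^ k"

lemma dyadic_floor_nonneg: "0 \<le> y \<Longrightarrow> 0 \<le> dyadic_floor k y"
  by (simp add: dyadic_floor_def)

lemma dyadic_floor_le: "dyadic_floor k y \<le> y"
  by (simp add: dyadic_floor_def divide_le_eq mult.commute)

lemma dyadic_floor_incseq: "incseq (\<lambda>k. dyadic_floor k y)"
proof (rule incseq_SucI)
  fix k
  have "2 * \<lfloor>2 ^ k * y\<rfloor> \<le> \<lfloor>2 ^ Suc k * y\<rfloor>"
    by (simp add: le_floor_iff mult.assoc)
  then have "real_of_int (2 * \<lfloor>2 ^ k * y\<rfloor>) \<le> of_int \<lfloor>2 ^ Suc k * y\<rfloor>"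
    by (simp only: of_int_le_iff)
  then show "dyadic_floor k y \<le> dyadic_floor (Suc k) y"
    by (simp add: dyadic_floor_def field_simps)
qed

lemma dyadic_floor_LIMSEQ: "(\<lambda>k. dyadic_floor k y) \<longlonglongrightarrow> y"
proof (rule tendsto_sandwich)
  show "\<forall>\<^sub>F k in sequentially. y - (1/2) ^ k \<le> dyadic_floor k y"
  proof (intro always_eventually allI)
    fix k :: nat
    have "2 ^ k * y - 1 \<le> of_int \<lfloor>2 ^ k * y\<rfloor>" by linarith
    then have "(2 ^ k * y - 1) / 2 ^ k \<le> dyadic_floor k y"
      unfolding dyadic_floor_def by (rule divide_right_mono) simp
    then show "y - (1/2) ^ k \<le> dyadic_floor k y"
      by (simp add: diff_divide_distrib power_one_over)
  qed
  show "\<forall>\<^sub>F k in sequentially. dyadic_floor k y \<le> y"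
    by (simp add: dyadic_floor_le)
  have "(\<lambda>k. y - (1/2) ^ k) \<longlonglongrightarrow> y - 0"
    by (intro tendsto_intros LIMSEQ_power_zero) auto
  then show "(\<lambda>k. y - (1/2) ^ k) \<longlonglongrightarrow> y" by simp
qed simp

text \<open>The interval from 0 to R has R * 2^k cells, and y below R hits exactly the one with
  index floor (2^k y); from R on both sides vanish. An integral with rounded argument thus becomes a
  finite sum over cells.\<close>

lemma dyadic_floor_sum:
  assumes "0 \<le> y"
  shows "f (dyadic_floor k y) * indicator {..<real R} y =
    (\<Sum>j<R * 2 ^ k. f (real j / 2 ^ k) * indicator {real j / 2 ^ k ..< real (Suc j) / 2 ^ k} y :: real)"
proof -
  define j where "j = nat \<lfloor>2 ^ k * y\<rfloor>"
  have j: "of_int \<lfloor>2 ^ k * y\<rfloor> = real j" using assms by (simp add: j_def)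
  have "real i / 2 ^ k \<le> y \<and> y < real (Suc i) / 2 ^ k \<longleftrightarrow> \<lfloor>2 ^ k * y\<rfloor> = int i" for i
    by (auto simp: floor_eq_iff field_simps)
  then have *: "indicator {real i / 2 ^ k ..< real (Suc i) / 2 ^ k} y = (if i = j then 1 else 0 :: real)" for i
    using assms by (auto simp: indicator_def j_def)
  have "\<lfloor>2 ^ k * y\<rfloor> < int (R * 2 ^ k) \<longleftrightarrow> y < real R"
    by (simp add: floor_less_iff mult.commute)
  then have "y < real R \<longleftrightarrow> j < R * 2 ^ k"
    using assms unfolding j_def by (subst nat_less_iff) auto
  moreover have "(\<Sum>i<R * 2 ^ k. f (real i / 2 ^ k) * indicator {real i / 2 ^ k ..< real (Suc i) / 2 ^ k} y)
      = (\<Sum>i<R * 2 ^ k. if i = j then f (real j / 2 ^ k) else 0)"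
    by (rule sum.cong) (auto simp only: * mult_1_right mult_zero_right split: if_splits)
  ultimately show ?thesis
    by (simp add: dyadic_floor_def j)
qed

text \<open>Each summand freezes the first argument of \<open>g\<close> at the left end of a cell,
  so the sum integrates \<open>g\<close> at the rounded \<open>T\<close> and converges by dominated
  convergence; the cutoff at \<open>R\<close> supplies the dominating function. Joint measurability
  of \<open>g\<close> is not assumed: the diagonal is measurable as a limit of compositions with
  countably many rounded values.\<close>

lemma nn_integral_diagonal:
  fixes g :: "real \<Rightarrow> 'w \<Rightarrow> real" and T :: "'w \<Rightarrow> real"
  assumes [measurable]: "T \<in> borel_measurable M" "\<And>s. g s \<in> borel_measurable M"
    and T: "\<And>w. w \<in> space M \<Longrightarrow> 0 \<le> T w"
    and fin: "\<And>R. emeasure M {w \<in> space M. T w < R} < \<infinity>"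
    and g: "\<And>s w. 0 \<le> s \<Longrightarrow> 0 \<le> g s w" "\<And>s w. 0 \<le> s \<Longrightarrow> g s w \<le> 1"
    and lim: "\<And>s S w. incseq S \<Longrightarrow> S \<longlonglongrightarrow> s \<Longrightarrow> 0 \<le> S 0 \<Longrightarrow> w \<in> space M \<Longrightarrow> (\<lambda>k. g (S k) w) \<longlonglongrightarrow> g s w"
  shows "(\<lambda>w. ennreal (g (T w) w)) \<in> borel_measurable M" (is ?meas)
    and "(\<lambda>k. \<Sum>j<R * 2 ^ k. \<integral>\<^sup>+w. ennreal (indicator {real j / 2 ^ k ..< real (Suc j) / 2 ^ k} (T w) * g (real j / 2 ^ k) w) \<partial>M)
           \<longlonglongrightarrow> (\<integral>\<^sup>+w. ennreal (g (T w) w) * indicator {..<real R} (T w) \<partial>M)" (is ?lim)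
proof -
  have g_lim: "(\<lambda>k. g (dyadic_floor k (T w)) w) \<longlonglongrightarrow> g (T w) w" if "w \<in> space M" for w
    by (rule lim) (use that T in \<open>auto intro: dyadic_floor_incseq dyadic_floor_LIMSEQ dyadic_floor_nonneg\<close>)
  have [measurable]: "(\<lambda>w. g (dyadic_floor k (T w)) w) \<in> borel_measurable M" for k
  proof -
    have "(\<lambda>w. g (of_int \<lfloor>2 ^ k * T w\<rfloor> / 2 ^ k) w) \<in> borel_measurable M"
      by (rule measurable_compose_countable[where f="\<lambda>i w. g (of_int i / 2 ^ k) w" and g="\<lambda>w. \<lfloor>2 ^ k * T w\<rfloor>"]) measurable
    then show ?thesis by (simp add: dyadic_floor_def)
  qed
  have "(\<lambda>w. g (T w) w) \<in> borel_measurable M"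
    by (rule borel_measurable_LIMSEQ_metric[OF _ g_lim]) measurable
  then show ?meas by simp
  note [measurable] = \<open>(\<lambda>w. g (T w) w) \<in> borel_measurable M\<close>
  have eq: "(\<Sum>j<R * 2 ^ k. \<integral>\<^sup>+w. ennreal (indicator {real j / 2 ^ k ..< real (Suc j) / 2 ^ k} (T w) * g (real j / 2 ^ k) w) \<partial>M) =
    (\<integral>\<^sup>+w. ennreal (g (dyadic_floor k (T w)) w * indicator {..<real R} (T w)) \<partial>M)" (is "?l = ?r") for k
  proof -
    have "?l = (\<integral>\<^sup>+w. (\<Sum>j<R * 2 ^ k. ennreal (indicator {real j / 2 ^ k ..< real (Suc j) / 2 ^ k} (T w) * g (real j / 2 ^ k) w)) \<partial>M)"
      by (rule nn_integral_sum[symmetric]) measurable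
    also have "\<dots> = ?r"
    proof (rule nn_integral_cong)
      fix w assume "w \<in> space M"
      from dyadic_floor_sum[OF T[OF this], of "\<lambda>s. g s w"]
      show "(\<Sum>j<R * 2 ^ k. ennreal (indicator {real j / 2 ^ k ..< real (Suc j) / 2 ^ k} (T w) * g (real j / 2 ^ k) w)) =
         ennreal (g (dyadic_floor k (T w)) w * indicator {..<real R} (T w))"
        by (simp add: g sum_ennreal mult.commute del: of_nat_Suc)
    qed
    finally show ?thesis .
  qed
  have "(\<lambda>k. \<integral>\<^sup>+w. ennreal (g (dyadic_floor k (T w)) w * indicator {..<real R} (T w)) \<partial>M)
     \<longlonglongrightarrow> (\<integral>\<^sup>+w. ennreal (g (T w) w * indicator {..<real R} (T w)) \<partial>M)"
  proof (rule nn_integral_dominated_convergence[where w="\<lambda>w. indicator {w \<in> space M. T w < real R} w"])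
    show "(\<integral>\<^sup>+w. indicator {w \<in> space M. T w < real R} w \<partial>M) < \<infinity>"
      using fin[of "real R"] by simp
    show "AE w in M. ennreal (g (dyadic_floor k (T w)) w * indicator {..<real R} (T w)) \<le> indicator {w \<in> space M. T w < real R} w" for k
      by (rule AE_I2) (auto simp: indicator_def T dyadic_floor_nonneg intro!: g)
    show "AE w in M. (\<lambda>k. ennreal (g (dyadic_floor k (T w)) w * indicator {..<real R} (T w))) \<longlonglongrightarrow> ennreal (g (T w) w * indicator {..<real R} (T w))"
      by (rule AE_I2) (intro tendsto_ennrealI tendsto_mult tendsto_const g_lim)
  qed measurable
  also have "(\<integral>\<^sup>+w. ennreal (g (T w) w * indicator {..<real R} (T w)) \<partial>M) = (\<integral>\<^sup>+w. ennreal (g (T w) w) * indicator {..<real R} (T w) \<partial>M)"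
    by (rule nn_integral_cong) (auto simp: indicator_def)
  finally show ?lim unfolding eq .
qed

text \<open>The cell sums of \<open>nn_integral_diagonal\<close> only see strips with s frozen,
  where the two sides agree, so both diagonals are limits of the same sums. Measurability of the
  right-hand integrand is included because it comes out of the same approximation.\<close>

lemma nn_integral_diagonal_eq:
  fixes g :: "real \<Rightarrow> 'w \<Rightarrow> real" and q :: "real \<Rightarrow> 'p \<Rightarrow> real"
  assumes T [measurable]: "T \<in> borel_measurable M" "\<And>w. w \<in> space M \<Longrightarrow> 0 \<le> T w"
    "\<And>R. emeasure M {w \<in> space M. T w < R} < \<infinity>"
    and g: "\<And>s. g s \<in> borel_measurable M"
     "\<And>s w. 0 \<le> s \<Longrightarrow> 0 \<le> g s w" "\<And>s w. 0 \<le> s \<Longrightarrow> g s w \<le> 1"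
     "\<And>s S w. incseq S \<Longrightarrow> S \<longlonglongrightarrow> s \<Longrightarrow> 0 \<le> S 0 \<Longrightarrow> w \<in> space M \<Longrightarrow> (\<lambda>k. g (S k) w) \<longlonglongrightarrow> g s w"
    and D [measurable]: "D \<in> borel_measurable \<nu>" "\<And>p. p \<in> space \<nu> \<Longrightarrow> 0 \<le> D p"
    "\<And>R. emeasure \<nu> {p \<in> space \<nu>. D p < R} < \<infinity>"
    and q: "\<And>s. q s \<in> borel_measurable \<nu>"
     "\<And>s p. 0 \<le> s \<Longrightarrow> 0 \<le> q s p" "\<And>s p. 0 \<le> s \<Longrightarrow> q s p \<le> 1"
     "\<And>s S p. incseq S \<Longrightarrow> S \<longlonglongrightarrow> s \<Longrightarrow> 0 \<le> S 0 \<Longrightarrow> p \<in> space \<nu> \<Longrightarrow> (\<lambda>k. q (S k) p) \<longlonglongrightarrow> q s p"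
    and eq: "\<And>s t t'. 0 \<le> s \<Longrightarrow> 0 \<le> t \<Longrightarrow> t \<le> t' \<Longrightarrow>
      (\<integral>\<^sup>+w. ennreal (indicator {t..<t'} (T w) * g s w) \<partial>M) = (\<integral>\<^sup>+p. ennreal (indicator {t..<t'} (D p) * q s p) \<partial>\<nu>)"
  shows "(\<integral>\<^sup>+w. ennreal (g (T w) w) \<partial>M) = (\<integral>\<^sup>+p. ennreal (q (D p) p) \<partial>\<nu>) \<and>
    (\<lambda>p. ennreal (q (D p) p)) \<in> borel_measurable \<nu>"
proof -
  note G = nn_integral_diagonal[where g=g and M=M, OF T(1) g(1) T(2,3) g(2-4)]
  note Q = nn_integral_diagonal[where g=q and M=\<nu>, OF D(1) q(1) D(2,3) q(2-4)]
  have E: "(\<integral>\<^sup>+w. ennreal (indicator {real j / 2 ^ k ..< real (Suc j) / 2 ^ k} (T w) * g (real j / 2 ^ k) w) \<partial>M) =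
     (\<integral>\<^sup>+p. ennreal (indicator {real j / 2 ^ k ..< real (Suc j) / 2 ^ k} (D p) * q (real j / 2 ^ k) p) \<partial>\<nu>)" for j k
    by (rule eq) (auto intro!: divide_right_mono)
  have R: "(\<integral>\<^sup>+w. ennreal (g (T w) w) * indicator {..<real R} (T w) \<partial>M) = (\<integral>\<^sup>+p. ennreal (q (D p) p) * indicator {..<real R} (D p) \<partial>\<nu>)" for R
    by (rule LIMSEQ_unique[OF G(2)[of R, unfolded E] Q(2)[of R]])
  \<comment> \<open>The cutoff at R is removed by monotone convergence.\<close>
  have lim: "(\<lambda>R. \<integral>\<^sup>+w. f w * indicator {..<real R} (V w) \<partial>N) \<longlonglongrightarrow> (\<integral>\<^sup>+w. f w \<partial>N)"
    if [measurable]: "f \<in> borel_measurable N" "V \<in> borel_measurable N" for f :: "'x \<Rightarrow> ennreal" and V and N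
  proof (rule nn_integral_LIMSEQ)
    show "incseq (\<lambda>R w. f w * indicator {..<real R} (V w))"
      by (auto simp: incseq_def le_fun_def indicator_def)
    fix w
    obtain n :: nat where n: "V w < real n" using reals_Archimedean2 by blast
    have "\<forall>\<^sub>F R in sequentially. f w = f w * indicator {..<real R} (V w)"
      using eventually_ge_at_top[of n] by eventually_elim (use n in auto)
    then show "(\<lambda>R. f w * indicator {..<real R} (V w)) \<longlonglongrightarrow> f w"
      by (rule Lim_transform_eventually[OF tendsto_const])
  qed measurable
  show ?thesis
    using LIMSEQ_unique[OF lim[OF G(1) T(1), unfolded R] lim[OF Q(1) D(1)]] Q(1) by blast
qed

section \<open>The probability generating functional of a Poisson process\<close>

lemma poisson_pgf:
  fixes \<rho> a :: real
  assumes "prob_space M" and N [measurable]: "N \<in> M \<rightarrow>\<^sub>M count_space UNIV"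
    and law: "\<And>n. measure M {w \<in> space M. N w = n} = \<rho> ^ n / fact n * exp (- \<rho>)"
    and "0 \<le> \<rho>" "0 \<le> a"
  shows "(\<integral>\<^sup>+w. ennreal (a ^ N w) \<partial>M) = ennreal (exp (- (\<rho> * (1 - a))))"
proof -
  interpret prob_space M by fact
  have "(\<integral>\<^sup>+w. ennreal (a ^ N w) \<partial>M) = (\<integral>\<^sup>+w. (\<Sum>n. ennreal (a ^ n) * indicator {w \<in> space M. N w = n} w) \<partial>M)"
  proof (rule nn_integral_cong)
    fix w assume "w \<in> space M"
    then have "(\<Sum>n. ennreal (a ^ n) * indicator {w \<in> space M. N w = n} w) = (\<Sum>n. if n = N w then ennreal (a ^ n) else 0)"
      by (intro suminf_cong) auto
    also have "\<dots> = ennreal (a ^ N w)"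
      using sums_single[of "N w" "\<lambda>n. ennreal (a ^ n)"] by (simp add: sums_iff)
    finally show "ennreal (a ^ N w) = (\<Sum>n. ennreal (a ^ n) * indicator {w \<in> space M. N w = n} w)" by simp
  qed
  also have "\<dots> = (\<Sum>n. ennreal (a ^ n) * emeasure M {w \<in> space M. N w = n})"
    by (subst nn_integral_suminf) (auto simp: nn_integral_cmult_indicator)
  also have "\<dots> = (\<Sum>n. ennreal ((a * \<rho>) ^ n /\<^sub>R fact n * exp (- \<rho>)))"
  proof (rule suminf_cong)
    fix n
    have "a ^ n * (\<rho> ^ n / fact n * exp (- \<rho>)) = (a * \<rho>) ^ n /\<^sub>R fact n * exp (- \<rho>)"
      by (simp add: power_mult_distrib divide_inverse)
    then show "ennreal (a ^ n) * emeasure M {w \<in> space M. N w = n} = ennreal ((a * \<rho>) ^ n /\<^sub>R fact n * exp (- \<rho>))"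
      unfolding emeasure_eq_measure law using \<open>0 \<le> a\<close> \<open>0 \<le> \<rho>\<close> by (subst ennreal_mult[symmetric]) simp_all
  qed
  also have "\<dots> = ennreal (exp (a * \<rho>) * exp (- \<rho>))"
    by (intro suminf_ennreal_eq sums_mult2 exp_converges) (use assms in auto)
  also have "exp (a * \<rho>) * exp (- \<rho>) = exp (- (\<rho> * (1 - a)))"
    unfolding exp_add[symmetric] by (simp add: algebra_simps)
  finally show ?thesis .
qed

lemma homogeneous_pppD:
  assumes "homogeneous_ppp M \<Lambda> \<Phi>"
  shows "w \<in> space M \<Longrightarrow> bounded B \<Longrightarrow> finite (\<Phi> w \<inter> B)"
    and "B \<in> sets borel \<Longrightarrow> bounded B \<Longrightarrow> (\<lambda>w. card (\<Phi> w \<inter> B)) \<in> M \<rightarrow>\<^sub>M count_space UNIV"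
    and "B \<in> sets borel \<Longrightarrow> bounded B \<Longrightarrow> measure M {w \<in> space M. card (\<Phi> w \<inter> B) = n} =
      (\<Lambda> * measure lborel B) ^ n / fact n * exp (- (\<Lambda> * measure lborel B))"
    and "finite (I :: nat set) \<Longrightarrow> disjoint_family_on C I \<Longrightarrow> (\<And>i. i \<in> I \<Longrightarrow> C i \<in> sets borel) \<Longrightarrow> (\<And>i. i \<in> I \<Longrightarrow> bounded (C i)) \<Longrightarrow>
      prob_space.indep_vars M (\<lambda>_. count_space UNIV) (\<lambda>i w. card (\<Phi> w \<inter> C i)) I"
  using assms unfolding homogeneous_ppp_def by simp_all

lemma ppp_counts_pgf:
  fixes a :: "nat \<Rightarrow> real"
  assumes M: "prob_space M" and ppp: "homogeneous_ppp M \<Lambda> \<Phi>" and "0 \<le> \<Lambda>" "finite I"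
    and B: "disjoint_family_on B I" "\<And>i. i \<in> I \<Longrightarrow> B i \<in> sets borel" "\<And>i. i \<in> I \<Longrightarrow> bounded (B i)"
    and a: "\<And>i. i \<in> I \<Longrightarrow> 0 \<le> a i"
  shows "(\<integral>\<^sup>+w. ennreal (\<Prod>i\<in>I. a i ^ card (\<Phi> w \<inter> B i)) \<partial>M) =
    ennreal (exp (- (\<Sum>i\<in>I. \<Lambda> * measure lborel (B i) * (1 - a i))))"
proof -
  interpret prob_space M by fact
  have "indep_vars (\<lambda>_. count_space UNIV) (\<lambda>i w. card (\<Phi> w \<inter> B i)) I"
    by (rule homogeneous_pppD(4)[OF ppp \<open>finite I\<close> B])
  then have ind: "indep_vars (\<lambda>_. borel) (\<lambda>i w. ennreal (a i ^ card (\<Phi> w \<inter> B i))) I"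
    by (rule indep_vars_compose2) auto
  have "(\<integral>\<^sup>+w. ennreal (\<Prod>i\<in>I. a i ^ card (\<Phi> w \<inter> B i)) \<partial>M) = (\<integral>\<^sup>+w. (\<Prod>i\<in>I. ennreal (a i ^ card (\<Phi> w \<inter> B i))) \<partial>M)"
    by (intro nn_integral_cong prod_ennreal[symmetric]) (auto simp: a)
  also have "\<dots> = (\<Prod>i\<in>I. \<integral>\<^sup>+w. ennreal (a i ^ card (\<Phi> w \<inter> B i)) \<partial>M)"
    by (rule indep_vars_nn_integral) (use \<open>finite I\<close> ind in auto)
  also have "\<dots> = (\<Prod>i\<in>I. ennreal (exp (- (\<Lambda> * measure lborel (B i) * (1 - a i)))))"
    by (intro prod.cong refl poisson_pgf M homogeneous_pppD(2,3)[OF ppp] B a mult_nonneg_nonneg \<open>0 \<le> \<Lambda>\<close>) auto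
  also have "\<dots> = ennreal (\<Prod>i\<in>I. exp (- (\<Lambda> * measure lborel (B i) * (1 - a i))))"
    by (rule prod_ennreal) simp
  also have "(\<Prod>i\<in>I. exp (- (\<Lambda> * measure lborel (B i) * (1 - a i)))) = exp (\<Sum>i\<in>I. - (\<Lambda> * measure lborel (B i) * (1 - a i)))"
    by (rule exp_sum[symmetric]) fact
  finally show ?thesis by (simp add: sum_negf)
qed

lemma inf_prod_eq_prod:
  fixes f :: "nat \<Rightarrow> real"
  assumes "\<And>n. 0 \<le> f n" "\<And>n. f n \<le> 1" "finite F" "\<And>n. n \<notin> F \<Longrightarrow> f n = 1"
  shows "inf_prod f = prod f F"
proof (rule LIMSEQ_unique[OF inf_prod_LIMSEQ])
  obtain m where m: "F \<subseteq> {..<m}" using \<open>finite F\<close> by (meson finite_nat_iff_bounded)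
  have "\<forall>\<^sub>F N in sequentially. prod f F = (\<Prod>n<N. f n)"
    using eventually_ge_at_top[of m]
    by eventually_elim (rule prod.mono_neutral_left, use m assms in auto)
  then show "(\<lambda>N. \<Prod>n<N. f n) \<longlonglongrightarrow> prod f F"
    by (rule Lim_transform_eventually[OF tendsto_const])
qed (use assms in auto)

text \<open>Grouping the points by the value of \<open>v\<close> gives a product of powers of
  counts, which are independent Poisson variables on the disjoint level sets. Points outside
  \<open>S\<close> contribute the factor 1, so only finitely many points and only bounded sets
  matter.\<close>

lemma ppp_pgfl_simple:
  fixes v :: "'a::euclidean_space \<Rightarrow> real" and X :: "nat \<Rightarrow> 'w \<Rightarrow> 'a"
  assumes M: "prob_space M" and ppp: "homogeneous_ppp M \<Lambda> \<Phi>" and "0 \<le> \<Lambda>"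
    and X: "AE w in M. bij_betw (\<lambda>n. X n w) UNIV (\<Phi> w)"
    and v [measurable]: "v \<in> borel_measurable borel" and v01: "\<And>x. 0 \<le> v x" "\<And>x. v x \<le> 1"
    and fin: "finite (range v)" and S: "bounded S" "S \<in> sets borel" "\<And>x. x \<notin> S \<Longrightarrow> v x = 1"
  shows "(\<integral>\<^sup>+w. ennreal (inf_prod (\<lambda>n. v (X n w))) \<partial>M) =
    ennreal (exp_minus (ennreal \<Lambda> * (\<integral>\<^sup>+x. ennreal (1 - v x) \<partial>lborel)))"
proof -
  obtain e :: "nat \<Rightarrow> real" and m where e: "bij_betw e {..<m} (range v)"
    using ex_bij_betw_nat_finite[OF fin] by (auto simp: atLeast0LessThan)
  define B where "B i = {x \<in> S. v x = e i}" for i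
  have e_rng: "e i \<in> range v" if "i < m" for i using e that by (auto simp: bij_betw_def)
  have e01: "0 \<le> e i" "e i \<le> 1" if "i < m" for i using e_rng[OF that] v01 by auto
  note [measurable] = S(2)
  have B_sets: "B i \<in> sets borel" for i
  proof -
    have "B i = S \<inter> v -` {e i}" by (auto simp: B_def)
    also have "\<dots> \<in> sets borel" using measurable_sets_borel[OF v, of "{e i}"] S(2) by auto
    finally show ?thesis .
  qed
  have B_bdd: "bounded (B i)" for i by (rule bounded_subset[OF S(1)]) (auto simp: B_def)
  have disj: "disjoint_family_on B {..<m}"
    using e by (auto simp: disjoint_family_on_def B_def bij_betw_def inj_on_def)
  have "AE w in M. inf_prod (\<lambda>n. v (X n w)) = (\<Prod>i<m. e i ^ card (\<Phi> w \<inter> B i))"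
    using AE_space X
  proof eventually_elim
    fix w assume w: "w \<in> space M" and bij: "bij_betw (\<lambda>n. X n w) UNIV (\<Phi> w)"
    let ?F = "{n. X n w \<in> S}"
    have finS: "finite (\<Phi> w \<inter> S)" by (rule homogeneous_pppD(1)[OF ppp w S(1)])
    have bij': "bij_betw (\<lambda>n. X n w) ?F (\<Phi> w \<inter> S)"
      using bij by (auto simp: bij_betw_def inj_on_def)
    have "finite ?F" using bij_betw_finite[OF bij'] finS by blast
    then have "inf_prod (\<lambda>n. v (X n w)) = (\<Prod>n\<in>?F. v (X n w))"
      by (intro inf_prod_eq_prod v01) (auto simp: S)
    also have "\<dots> = (\<Prod>x\<in>\<Phi> w \<inter> S. v x)"
      by (rule prod.reindex_bij_betw[OF bij'])
    also have "\<dots> = (\<Prod>y\<in>range v. \<Prod>x\<in>{x \<in> \<Phi> w \<inter> S. v x = y}. v x)"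
      by (rule prod.group[symmetric]) (use finS fin in auto)
    also have "\<dots> = (\<Prod>y\<in>range v. y ^ card {x \<in> \<Phi> w \<inter> S. v x = y})"
      by (intro prod.cong refl) simp
    also have "\<dots> = (\<Prod>i<m. e i ^ card {x \<in> \<Phi> w \<inter> S. v x = e i})"
      by (rule prod.reindex_bij_betw[OF e, symmetric])
    also have "\<dots> = (\<Prod>i<m. e i ^ card (\<Phi> w \<inter> B i))"
      by (intro prod.cong refl arg_cong[where f="\<lambda>A. _ ^ card A"]) (auto simp: B_def)
    finally show "inf_prod (\<lambda>n. v (X n w)) = (\<Prod>i<m. e i ^ card (\<Phi> w \<inter> B i))" .
  qed
  then have "(\<integral>\<^sup>+w. ennreal (inf_prod (\<lambda>n. v (X n w))) \<partial>M) = (\<integral>\<^sup>+w. ennreal (\<Prod>i<m. e i ^ card (\<Phi> w \<inter> B i)) \<partial>M)"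
    by (intro nn_integral_cong_AE) auto
  also have "\<dots> = ennreal (exp (- (\<Sum>i<m. \<Lambda> * measure lborel (B i) * (1 - e i))))"
    by (rule ppp_counts_pgf[OF M ppp \<open>0 \<le> \<Lambda>\<close>]) (auto simp: disj B_sets B_bdd e01)
  also have "(\<Sum>i<m. \<Lambda> * measure lborel (B i) * (1 - e i)) = \<Lambda> * (\<Sum>i<m. (1 - e i) * measure lborel (B i))"
    by (simp add: sum_distrib_left mult_ac)
  also have "exp (- (\<Lambda> * (\<Sum>i<m. (1 - e i) * measure lborel (B i)))) = exp_minus (ennreal \<Lambda> * ennreal (\<Sum>i<m. (1 - e i) * measure lborel (B i)))"
  proof -
    have "0 \<le> (\<Sum>i<m. (1 - e i) * measure lborel (B i))" by (intro sum_nonneg) (auto simp: e01)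
    then show ?thesis
      using \<open>0 \<le> \<Lambda>\<close> exp_minus_ennreal[of "\<Lambda> * (\<Sum>i<m. (1 - e i) * measure lborel (B i))"] by (simp only: ennreal_mult mult_nonneg_nonneg)
  qed
  also have "ennreal (\<Sum>i<m. (1 - e i) * measure lborel (B i)) = (\<Sum>i<m. ennreal (1 - e i) * emeasure lborel (B i))"
  proof -
    have "emeasure lborel (B i) = ennreal (measure lborel (B i))" for i
      using emeasure_bounded_finite[OF B_bdd] by (intro emeasure_eq_ennreal_measure) (auto simp: less_top)
    then show ?thesis
      using e01 by (subst sum_ennreal[symmetric]) (auto simp: ennreal_mult intro!: sum.cong)
  qed
  also have "\<dots> = (\<integral>\<^sup>+x. (\<Sum>i<m. ennreal (1 - e i) * indicator (B i) x) \<partial>lborel)"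
    using B_sets by (subst nn_integral_sum) (auto simp: nn_integral_cmult_indicator)
  also have "\<dots> = (\<integral>\<^sup>+x. ennreal (1 - v x) \<partial>lborel)"
  proof (rule nn_integral_cong)
    fix x
    obtain j where j: "j < m" "v x = e j" using e by (force simp: bij_betw_def)
    have eqj: "e j = e i \<longleftrightarrow> i = j" if "i < m" for i
      using e j that by (auto simp: bij_betw_def inj_on_def)
    have "(\<Sum>i<m. ennreal (1 - e i) * indicator (B i) x) = (\<Sum>i<m. if i = j then ennreal (1 - e j) * indicator S x else 0)"
      by (intro sum.cong) (simp_all add: B_def indicator_def j(2) eqj)
    also have "\<dots> = ennreal (1 - e j) * indicator S x" using j by simp
    also have "\<dots> = ennreal (1 - v x)" using S(3)[of x] j by (auto simp: indicator_def)
    finally show "(\<Sum>i<m. ennreal (1 - e i) * indicator (B i) x) = ennreal (1 - v x)" .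
  qed
  finally show ?thesis .
qed

text \<open>Simple functions increasing to 1 - v, cut off to growing balls, give functions u k that
  decrease to v. This is the direction that \<open>inf_prod_tendsto\<close> demands; it also lets
  the integral of 1 - u k increase, so that monotone convergence covers an infinite limit.\<close>

lemma ppp_pgfl:
  fixes v :: "'a::euclidean_space \<Rightarrow> real" and X :: "nat \<Rightarrow> 'w \<Rightarrow> 'a"
  assumes M: "prob_space M" and ppp: "homogeneous_ppp M \<Lambda> \<Phi>" and "0 \<le> \<Lambda>"
    and Xm [measurable]: "\<And>n. X n \<in> borel_measurable M"
    and X: "AE w in M. bij_betw (\<lambda>n. X n w) UNIV (\<Phi> w)"
    and v [measurable]: "v \<in> borel_measurable borel" and v01: "\<And>x. 0 \<le> v x" "\<And>x. v x \<le> 1"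
  shows "(\<integral>\<^sup>+w. ennreal (inf_prod (\<lambda>n. v (X n w))) \<partial>M) =
    ennreal (exp_minus (ennreal \<Lambda> * (\<integral>\<^sup>+x. ennreal (1 - v x) \<partial>lborel)))"
proof -
  interpret prob_space M by fact
  obtain f where f: "\<And>i. simple_function borel (f i)" "incseq f" "\<And>i x. 0 \<le> f i x"
      "\<And>x. bdd_above (range (\<lambda>i. f i x))" "(\<lambda>x. 1 - v x) = (SUP i. f i)"
    using borel_measurable_implies_simple_function_sequence_real[of "\<lambda>x. 1 - v x" borel] v01 by auto
  have f_lim: "(\<lambda>i. f i x) \<longlonglongrightarrow> 1 - v x" for x
  proof -
    have "(\<lambda>i. f i x) \<longlonglongrightarrow> (SUP i. f i x)"
      using f(2) by (intro LIMSEQ_incseq_SUP f) (auto simp: incseq_def le_fun_def)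
    moreover have "(SUP i. f i x) = 1 - v x"
      using fun_cong[OF f(5), of x] by (simp add: image_image)
    ultimately show ?thesis by simp
  qed
  have f_le: "f i x \<le> 1 - v x" for i x
    using f(2) by (intro incseq_le[OF _ f_lim]) (auto simp: incseq_def le_fun_def)
  define u where "u k x = 1 - indicator (ball 0 (real k)) x * f k x" for k and x :: 'a
  have [measurable]: "f k \<in> borel_measurable borel" for k
    using f(1) by (rule borel_measurable_simple_function)
  have u_meas [measurable]: "u k \<in> borel_measurable borel" for k
    unfolding u_def by (intro borel_measurable_diff borel_measurable_times borel_measurable_indicator) auto
  have u01: "0 \<le> u k x" "u k x \<le> 1" "v x \<le> u k x" for k x
    using f_le[of k x] f(3)[of k x] v01(1)[of x] v01(2)[of x] unfolding u_def
    by (cases "x \<in> ball 0 (real k)"; simp)+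
  have u_inc: "incseq (\<lambda>k. indicator (ball 0 (real k)) x * f k x)" for x :: 'a
  proof (rule incseq_SucI)
    fix k
    have "f k x \<le> f (Suc k) x" using f(2) by (simp add: incseq_Suc_iff le_fun_def)
    then show "indicator (ball 0 (real k)) x * f k x \<le> indicator (ball 0 (real (Suc k))) x * f (Suc k) x"
      using f(3)[of "Suc k" x] by (auto simp: indicator_def)
  qed
  have u_lim': "(\<lambda>k. indicator (ball 0 (real k)) x * f k x) \<longlonglongrightarrow> 1 - v x" for x :: 'a
  proof -
    obtain n :: nat where "norm x < real n" using reals_Archimedean2 by blast
    then have "f k x = indicator (ball 0 (real k)) x * f k x" if "n \<le> k" for k
      using that by simp
    then have "\<forall>\<^sub>F k in sequentially. f k x = indicator (ball 0 (real k)) x * f k x"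
      by (rule eventually_sequentiallyI)
    then show ?thesis by (rule Lim_transform_eventually[OF f_lim])
  qed
  have u_lim: "(\<lambda>k. u k x) \<longlonglongrightarrow> v x" for x
    using tendsto_diff[OF tendsto_const[of 1] u_lim'[of x]] by (simp add: u_def)
  have "(\<lambda>k. \<integral>\<^sup>+w. ennreal (inf_prod (\<lambda>n. u k (X n w))) \<partial>M) \<longlonglongrightarrow> (\<integral>\<^sup>+w. ennreal (inf_prod (\<lambda>n. v (X n w))) \<partial>M)"
  proof (rule nn_integral_dominated_convergence[where w="\<lambda>_. 1"])
    show "AE w in M. ennreal (inf_prod (\<lambda>n. u k (X n w))) \<le> 1" for k
      by (intro AE_I2) (auto intro!: inf_prod_le_1 u01)
    show "AE w in M. (\<lambda>k. ennreal (inf_prod (\<lambda>n. u k (X n w)))) \<longlonglongrightarrow> ennreal (inf_prod (\<lambda>n. v (X n w)))"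
      by (intro AE_I2 tendsto_ennrealI inf_prod_tendsto) (auto simp: v01 u01 u_lim)
  qed (auto intro!: borel_measurable_inf_prod measurable_compose[OF borel_measurable_inf_prod measurable_ennreal] simp: u01 v01 emeasure_space_1)
  moreover have "(\<integral>\<^sup>+w. ennreal (inf_prod (\<lambda>n. u k (X n w))) \<partial>M) =
    ennreal (exp_minus (ennreal \<Lambda> * (\<integral>\<^sup>+x. ennreal (1 - u k x) \<partial>lborel)))" for k
  proof (rule ppp_pgfl_simple[OF M ppp \<open>0 \<le> \<Lambda>\<close> X u_meas u01(1,2)])
    have "range (u k) \<subseteq> (\<lambda>y. 1 - y) ` range (f k) \<union> {1}"
      by (auto simp: u_def indicator_def)
    moreover have "finite (range (f k))"
      using f(1)[of k] by (auto simp: simple_function_def)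
    ultimately show "finite (range (u k))"
      by (auto intro: finite_subset)
    show "u k x = 1" if "x \<notin> ball 0 (real k)" for x using that by (simp add: u_def)
  qed auto
  moreover have "(\<lambda>k. ennreal (exp_minus (ennreal \<Lambda> * (\<integral>\<^sup>+x. ennreal (1 - u k x) \<partial>lborel))))
     \<longlonglongrightarrow> ennreal (exp_minus (ennreal \<Lambda> * (\<integral>\<^sup>+x. ennreal (1 - v x) \<partial>lborel)))"
  proof (intro tendsto_ennrealI tendsto_exp_minus ennreal_tendsto_cmult)
    show "(\<lambda>k. \<integral>\<^sup>+x. ennreal (1 - u k x) \<partial>lborel) \<longlonglongrightarrow> (\<integral>\<^sup>+x. ennreal (1 - v x) \<partial>lborel)"
    proof (rule nn_integral_LIMSEQ)
      show "incseq (\<lambda>k x. ennreal (1 - u k x))"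
        using u_inc by (auto simp: incseq_def le_fun_def u_def intro!: ennreal_leI)
      show "(\<lambda>k. ennreal (1 - u k x)) \<longlonglongrightarrow> ennreal (1 - v x)" for x
        using u_lim'[of x] by (auto simp: u_def intro!: tendsto_ennrealI)
    qed measurable
  qed simp
  ultimately show ?thesis
    by (simp only: LIMSEQ_unique)
qed

text \<open>The expansion contains the types only through the events \<forall>n\<in>I. l n,
  precisely those whose conditional probability \<open>los_states\<close> prescribes.\<close>

lemma prod_if_expand:
  fixes a b :: "'i \<Rightarrow> real"
  assumes "finite A"
  shows "(\<Prod>m\<in>A. if l m then a m else b m) =
    (\<Sum>I\<in>Pow A. of_bool (\<forall>n\<in>I. l n) * ((\<Prod>m\<in>I. a m - b m) * (\<Prod>m\<in>A - I. b m)))"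
proof -
  have "(\<Prod>m\<in>A. if l m then a m else b m) = (\<Prod>m\<in>A. of_bool (l m) * (a m - b m) + b m)"
    by (rule prod.cong) auto
  also have "\<dots> = (\<Sum>I\<in>Pow A. (\<Prod>m\<in>I. of_bool (l m) * (a m - b m)) * (\<Prod>m\<in>A - I. b m))"
    by (rule prod_add) fact
  also have "\<dots> = (\<Sum>I\<in>Pow A. of_bool (\<forall>n\<in>I. l n) * ((\<Prod>m\<in>I. a m - b m) * (\<Prod>m\<in>A - I. b m)))"
  proof (rule sum.cong)
    fix I assume "I \<in> Pow A"
    then have "finite I" using assms by (auto intro: finite_subset)
    then have "(\<Prod>m\<in>I. of_bool (l m)) = (of_bool (\<forall>n\<in>I. l n) :: real)"
      by (auto simp: prod_zero)
    then show "(\<Prod>m\<in>I. of_bool (l m) * (a m - b m)) * (\<Prod>m\<in>A - I. b m) = of_bool (\<forall>n\<in>I. l n) * ((\<Prod>m\<in>I. a m - b m) * (\<Prod>m\<in>A - I. b m))"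
      by (simp add: prod.distrib mult.assoc)
  qed simp
  finally show ?thesis .
qed

lemma measurable_vimage_PiM:
  "X i \<in> vimage_algebra S (\<lambda>w n. X n w) (\<Pi>\<^sub>M n\<in>UNIV. N) \<rightarrow>\<^sub>M N"
  if "\<And>n w. w \<in> S \<Longrightarrow> X n w \<in> space N"
proof -
  have "(\<lambda>w n. X n w) \<in> vimage_algebra S (\<lambda>w n. X n w) (\<Pi>\<^sub>M n\<in>UNIV. N) \<rightarrow>\<^sub>M (\<Pi>\<^sub>M n\<in>UNIV. N)"
    by (rule measurable_vimage_algebra1) (use that in \<open>auto simp: space_PiM\<close>)
  from measurable_compose[OF this measurable_component_singleton[of i UNIV "\<lambda>_. N"]]
  show ?thesis by simp
qed

text \<open>After expansion, each summand is the indicator of such an event times a function of the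
  locations. Conditioning on the locations replaces the indicator by a product of values of
  \<open>PL\<close>, and the expansion read backwards gives the mixture of the two types.\<close>

lemma los_states_prod_expectation:
  fixes X :: "nat \<Rightarrow> 'w \<Rightarrow> 'a::euclidean_space" and v :: "bool \<Rightarrow> 'a \<Rightarrow> real"
  assumes M: "prob_space M" and los: "los_states M PL X L"
    and Xm [measurable]: "\<And>n. X n \<in> borel_measurable M"
    and [measurable]: "PL \<in> borel_measurable borel" "\<And>b. v b \<in> borel_measurable borel"
    and v01: "\<And>b x. 0 \<le> v b x" "\<And>b x. v b x \<le> 1"
  shows "(LINT w|M. (\<Prod>m<N. v (L m w) (X m w))) =
    (LINT w|M. (\<Prod>m<N. PL (norm (X m w)) * v True (X m w) + (1 - PL (norm (X m w))) * v False (X m w)))"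
proof -
  interpret prob_space M by fact
  let ?F = "vimage_algebra (space M) (\<lambda>w n. X n w) (\<Pi>\<^sub>M n\<in>UNIV. borel)"
  have L [measurable]: "L n \<in> M \<rightarrow>\<^sub>M count_space UNIV" for n
    using los by (simp add: los_states_def)
  have XF [measurable]: "X n \<in> borel_measurable ?F" for n
    by (rule measurable_vimage_PiM) simp
  have sub: "subalgebra M ?F"
    unfolding subalgebra_def
  proof (intro conjI)
    have "(\<lambda>w n. X n w) \<in> M \<rightarrow>\<^sub>M (\<Pi>\<^sub>M n\<in>UNIV. borel)"
      by (rule measurable_PiM_single') auto
    then show "sets ?F \<subseteq> sets M"
      by (intro sets_vimage_algebra2[THEN ord_eq_le_trans]) (auto simp: space_PiM dest: measurable_sets)
  qed simp
  interpret finite_measure_subalgebra M ?F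
    by standard (rule sub)
  \<comment> \<open>The coefficient of the event with index set \<open>I\<close>. It is measurable
    for the sigma-algebra of the locations, so it may be pulled out of the conditional
    expectation.\<close>
  define Z where "Z I w = (\<Prod>m\<in>I. v True (X m w) - v False (X m w)) * (\<Prod>m\<in>{..<N} - I. v False (X m w))" for I w
  have ZF [measurable]: "Z I \<in> borel_measurable ?F" for I
    unfolding Z_def by measurable
  have ZM [measurable]: "Z I \<in> borel_measurable M" for I
    unfolding Z_def by measurable
  have Z1: "\<bar>Z I w\<bar> \<le> 1" for I w
  proof -
    have "\<bar>v True x - v False x\<bar> \<le> 1" for x
      using v01(1)[of True x] v01(2)[of True x] v01(1)[of False x] v01(2)[of False x] by linarith
    then show ?thesis
      unfolding Z_def abs_mult abs_prod by (intro mult_le_one prod_le_1 prod_nonneg) (auto simp: v01)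
  qed
  define E where "E I = {w \<in> space M. \<forall>n\<in>I. L n w}" for I
  have E [measurable]: "E I \<in> sets M" if "finite I" for I
    using that unfolding E_def by measurable
  have int: "integrable M (\<lambda>w. indicator (E I) w * Z I w)" if "finite I" for I
    by (rule integrable_const_bound[where B=1])
       (use Z1 E[OF that] in \<open>auto simp: indicator_def intro!: borel_measurable_times borel_measurable_indicator ZM\<close>)
  have step: "(LINT w|M. indicator (E I) w * Z I w) = (LINT w|M. (\<Prod>n\<in>I. PL (norm (X n w))) * Z I w)"
    and int2: "integrable M (\<lambda>w. (\<Prod>n\<in>I. PL (norm (X n w))) * Z I w)" if "finite I" for I
  proof -
    have ZE: "integrable M (\<lambda>w. Z I w * indicator (E I) w)"
      using int[OF that] by (simp add: mult.commute)
    note ce = real_cond_exp_intg[OF ZE ZF borel_measurable_indicator[OF E[OF that]]]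
    have ae: "AE w in M. Z I w * real_cond_exp M ?F (indicator (E I)) w = (\<Prod>n\<in>I. PL (norm (X n w))) * Z I w"
    proof -
      have "AE w in M. real_cond_exp M ?F (indicator (E I)) w = (\<Prod>n\<in>I. PL (norm (X n w)))"
        using los that unfolding los_states_def E_def by blast
      then show ?thesis by eventually_elim (simp add: mult.commute)
    qed
    have m: "(\<lambda>w. (\<Prod>n\<in>I. PL (norm (X n w))) * Z I w) \<in> borel_measurable M" by measurable
    have m2: "(\<lambda>w. Z I w * real_cond_exp M ?F (indicator (E I)) w) \<in> borel_measurable M" 
      by (intro borel_measurable_times ZM borel_measurable_cond_exp2)
    have "(LINT w|M. indicator (E I) w * Z I w) = (LINT w|M. Z I w * indicator (E I) w)"
      by (simp add: mult.commute)
    also have "\<dots> = (LINT w|M. Z I w * real_cond_exp M ?F (indicator (E I)) w)"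
      using ce(2) by simp
    also have "\<dots> = (LINT w|M. (\<Prod>n\<in>I. PL (norm (X n w))) * Z I w)"
      by (rule integral_cong_AE[OF m2 m ae])
    finally show "(LINT w|M. indicator (E I) w * Z I w) = (LINT w|M. (\<Prod>n\<in>I. PL (norm (X n w))) * Z I w)" .
    show "integrable M (\<lambda>w. (\<Prod>n\<in>I. PL (norm (X n w))) * Z I w)"
      using ce(1) integrable_cong_AE[OF m2 m ae] by blast
  qed
  have "(LINT w|M. (\<Prod>m<N. v (L m w) (X m w))) = (LINT w|M. (\<Sum>I\<in>Pow {..<N}. indicator (E I) w * Z I w))"
  proof (rule Bochner_Integration.integral_cong[OF refl])
    fix w assume w: "w \<in> space M"
    have "(\<Prod>m<N. v (L m w) (X m w)) = (\<Prod>m<N. if L m w then v True (X m w) else v False (X m w))"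
      by (intro prod.cong) auto
    also have "\<dots> = (\<Sum>I\<in>Pow {..<N}. of_bool (\<forall>n\<in>I. L n w) * Z I w)"
      unfolding Z_def by (rule prod_if_expand) simp
    finally show "(\<Prod>m<N. v (L m w) (X m w)) = (\<Sum>I\<in>Pow {..<N}. indicator (E I) w * Z I w)"
      using w by (simp add: E_def indicator_def)
  qed
  also have "\<dots> = (\<Sum>I\<in>Pow {..<N}. LINT w|M. indicator (E I) w * Z I w)"
    by (rule Bochner_Integration.integral_sum) (auto intro!: int intro: finite_subset)
  also have "\<dots> = (\<Sum>I\<in>Pow {..<N}. LINT w|M. (\<Prod>n\<in>I. PL (norm (X n w))) * Z I w)"
    by (intro sum.cong step) (auto intro: finite_subset)
  also have "\<dots> = (LINT w|M. (\<Sum>I\<in>Pow {..<N}. (\<Prod>n\<in>I. PL (norm (X n w))) * Z I w))"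
    by (rule Bochner_Integration.integral_sum[symmetric]) (auto intro!: int2 intro: finite_subset)
  also have "\<dots> = (LINT w|M. (\<Prod>m<N. PL (norm (X m w)) * v True (X m w) + (1 - PL (norm (X m w))) * v False (X m w)))"
  proof (rule Bochner_Integration.integral_cong[OF refl])
    fix w
    \<comment> \<open>Writing p a + (1 - p) b as p (a - b) + b gives the same expansion, with
      probabilities in place of indicators.\<close>
    have "(\<Prod>m<N. PL (norm (X m w)) * v True (X m w) + (1 - PL (norm (X m w))) * v False (X m w)) =
      (\<Prod>m<N. PL (norm (X m w)) * (v True (X m w) - v False (X m w)) + v False (X m w))"
      by (intro prod.cong) (auto simp: algebra_simps)
    also have "\<dots> = (\<Sum>I\<in>Pow {..<N}. (\<Prod>m\<in>I. PL (norm (X m w)) * (v True (X m w) - v False (X m w))) * (\<Prod>m\<in>{..<N} - I. v False (X m w)))"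
      by (rule prod_add) simp
    also have "\<dots> = (\<Sum>I\<in>Pow {..<N}. (\<Prod>n\<in>I. PL (norm (X n w))) * Z I w)"
      by (simp add: Z_def prod.distrib mult.assoc)
    finally show "(\<Sum>I\<in>Pow {..<N}. (\<Prod>n\<in>I. PL (norm (X n w))) * Z I w) =
      (\<Prod>m<N. PL (norm (X m w)) * v True (X m w) + (1 - PL (norm (X m w))) * v False (X m w))" by simp
  qed
  finally show ?thesis .
qed

text \<open>Averaging over the types given the locations turns \<open>v\<close> into its mean u and
  leaves an unmarked process. The average is taken for finite products and carried to the infinite
  one by bounded convergence on both sides.\<close>

lemma marked_ppp_pgfl:
  fixes X :: "nat \<Rightarrow> 'w \<Rightarrow> 'a::euclidean_space" and v :: "bool \<Rightarrow> 'a \<Rightarrow> real"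
  assumes M: "prob_space M" and ppp: "homogeneous_ppp M \<Lambda> \<Phi>" and "0 \<le> \<Lambda>"
    and Xm [measurable]: "\<And>n. X n \<in> borel_measurable M"
    and X: "AE w in M. bij_betw (\<lambda>n. X n w) UNIV (\<Phi> w)"
    and los: "los_states M PL X L"
    and PL [measurable]: "PL \<in> borel_measurable borel" and PL01: "\<And>r. 0 \<le> r \<Longrightarrow> 0 \<le> PL r \<and> PL r \<le> 1"
    and v [measurable]: "\<And>b. v b \<in> borel_measurable borel"
    and v01: "\<And>b x. 0 \<le> v b x" "\<And>b x. v b x \<le> 1"
  shows "(\<integral>\<^sup>+w. ennreal (inf_prod (\<lambda>n. v (L n w) (X n w))) \<partial>M) =
    ennreal (exp_minus (ennreal \<Lambda> *
      (\<integral>\<^sup>+x. ennreal (PL (norm x) * (1 - v True x) + (1 - PL (norm x)) * (1 - v False x)) \<partial>lborel)))"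
proof -
  interpret prob_space M by fact
  define u where "u x = PL (norm x) * v True x + (1 - PL (norm x)) * v False x" for x
  have [measurable]: "u \<in> borel_measurable borel"
    unfolding u_def by measurable
  have u01: "0 \<le> u x" "u x \<le> 1" for x
  proof -
    have p: "0 \<le> PL (norm x)" "PL (norm x) \<le> 1" using PL01[of "norm x"] by auto
    show "0 \<le> u x" using p v01 by (simp add: u_def)
    have "u x \<le> PL (norm x) * 1 + (1 - PL (norm x)) * 1"
      unfolding u_def using p v01 by (intro add_mono mult_left_mono) auto
    then show "u x \<le> 1" by simp
  qed
  have L [measurable]: "L n \<in> M \<rightarrow>\<^sub>M count_space UNIV" for n
    using los by (simp add: los_states_def)
  have vL [measurable]: "(\<lambda>w. v (L n w) (X n w)) \<in> borel_measurable M" for n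
    by (rule measurable_compose_countable[where f="\<lambda>b w. v b (X n w)", OF _ L]) measurable
  have lim: "(\<lambda>N. LINT w|M. (\<Prod>m<N. f m w)) \<longlonglongrightarrow> (LINT w|M. inf_prod (\<lambda>m. f m w))"
    if [measurable]: "\<And>m. f m \<in> borel_measurable M" and f01: "\<And>m w. 0 \<le> f m w" "\<And>m w. f m w \<le> 1"
    for f :: "nat \<Rightarrow> 'w \<Rightarrow> real"
  proof (rule integral_dominated_convergence[where w="\<lambda>_. 1"])
    show "(\<lambda>w. inf_prod (\<lambda>m. f m w)) \<in> borel_measurable M"
      by (intro borel_measurable_inf_prod that)
    show "AE w in M. (\<lambda>N. \<Prod>m<N. f m w) \<longlonglongrightarrow> inf_prod (\<lambda>m. f m w)"
      by (intro AE_I2 inf_prod_LIMSEQ f01)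
    show "AE w in M. norm (\<Prod>m<N. f m w) \<le> 1" for N
      by (intro AE_I2) (auto simp: abs_prod f01 intro!: prod_le_1)
  qed auto
  have "(LINT w|M. inf_prod (\<lambda>n. v (L n w) (X n w))) = (LINT w|M. inf_prod (\<lambda>n. u (X n w)))"
  proof (rule LIMSEQ_unique[OF lim])
    show "(\<lambda>N. LINT w|M. (\<Prod>m<N. v (L m w) (X m w))) \<longlonglongrightarrow> (LINT w|M. inf_prod (\<lambda>n. u (X n w)))"
      unfolding los_states_prod_expectation[where v=v, OF M los Xm PL v v01] u_def[symmetric]
      by (rule lim) (auto simp: u01)
  qed (auto simp: v01)
  moreover have "(\<integral>\<^sup>+w. ennreal (inf_prod (\<lambda>n. f n w)) \<partial>M) = ennreal (LINT w|M. inf_prod (\<lambda>n. f n w))"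
    if [measurable]: "\<And>m. f m \<in> borel_measurable M" and f01: "\<And>m w. 0 \<le> f m w" "\<And>m w. f m w \<le> 1"
    for f :: "nat \<Rightarrow> 'w \<Rightarrow> real"
  proof (intro nn_integral_eq_integral integrable_const_bound[where B=1])
    show "(\<lambda>w. inf_prod (\<lambda>m. f m w)) \<in> borel_measurable M"
      by (intro borel_measurable_inf_prod that)
  qed (auto simp: inf_prod_nonneg f01 inf_prod_le_1)
  ultimately have "(\<integral>\<^sup>+w. ennreal (inf_prod (\<lambda>n. v (L n w) (X n w))) \<partial>M) = (\<integral>\<^sup>+w. ennreal (inf_prod (\<lambda>n. u (X n w))) \<partial>M)"
    by (simp add: v01 u01)
  also have "\<dots> = ennreal (exp_minus (ennreal \<Lambda> * (\<integral>\<^sup>+x. ennreal (1 - u x) \<partial>lborel)))"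
    by (rule ppp_pgfl[OF M ppp \<open>0 \<le> \<Lambda>\<close> Xm X]) (auto simp: u01)
  also have "(\<lambda>x. 1 - u x) = (\<lambda>x. PL (norm x) * (1 - v True x) + (1 - PL (norm x)) * (1 - v False x))"
    by (simp add: u_def algebra_simps)
  finally show ?thesis .
qed

text \<open>The disc area pi * a^2 determines the law of the radius, because the half-lines {..a}
  form a generating pi-system. At negative u the density is \<open>ennreal\<close> of a negative
  number, that is 0.\<close>

lemma distr_norm_plane:
  "distr lborel borel (norm :: real^2 \<Rightarrow> real) = density lborel (\<lambda>u. ennreal (2 * pi * u))"
proof (rule measure_eqI_generator_eq[where E="range (\<lambda>a. {..a})" and \<Omega>=UNIV and A="\<lambda>n. {..real n}"])
  have *: "emeasure (distr lborel borel (norm :: real^2 \<Rightarrow> real)) {..a} = (if a < 0 then 0 else ennreal (pi * a\<^sup>2))" for a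
  proof -
    have "emeasure (distr lborel borel (norm :: real^2 \<Rightarrow> real)) {..a} = emeasure lborel (cball (0::real^2) a)"
      by (subst emeasure_distr) (auto intro!: arg_cong[where f="emeasure lborel"] simp: cball_def dist_norm)
    then show ?thesis
      by (auto simp: emeasure_cball unit_ball_vol_2 cball_empty)
  qed
  show "emeasure (distr lborel borel (norm :: real^2 \<Rightarrow> real)) X = emeasure (density lborel (\<lambda>u. ennreal (2 * pi * u))) X"
    if rng: "X \<in> range (\<lambda>a. {..a})" for X
  proof -
    obtain a where X: "X = {..a}" using rng by auto
    have "emeasure (density lborel (\<lambda>u. ennreal (2 * pi * u))) {..a} = (\<integral>\<^sup>+u. ennreal (2 * pi * u) * indicator {0..a} u \<partial>lborel)"
      by (subst emeasure_density) (auto intro!: nn_integral_cong simp: indicator_def ennreal_neg mult_nonneg_nonpos)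
    also have "\<dots> = (if a < 0 then 0 else ennreal (pi * a\<^sup>2))"
    proof (cases "a < 0")
      case False
      have "(\<integral>\<^sup>+u. ennreal (2 * pi * u) * indicator {0..a} u \<partial>lborel) = ennreal (pi * a\<^sup>2 - pi * 0\<^sup>2)"
        by (rule nn_integral_FTC_Icc) (use False in \<open>auto intro!: derivative_eq_intros\<close>)
      then show ?thesis using False by simp
    qed simp
    finally show ?thesis by (simp add: X *)
  qed
  show "emeasure (distr lborel borel (norm :: real^2 \<Rightarrow> real)) {..real n} \<noteq> \<infinity>" for n
    by (simp add: *)
  show "Int_stable (range (\<lambda>a::real. {..a}))"
    by (auto simp: Int_stable_def)
  show "(\<Union>n. {..real n}) = UNIV"
    by (auto intro: real_arch_simple)
  show "sets (distr lborel borel (norm :: real^2 \<Rightarrow> real)) = sigma_sets UNIV (range (\<lambda>a. {..a}))"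
    "sets (density lborel (\<lambda>u. ennreal (2 * pi * u))) = sigma_sets UNIV (range (\<lambda>a. {..a}))"
    by (simp_all, simp_all add: borel_eq_atMost)
qed auto

lemma nn_integral_norm_plane:
  assumes [measurable]: "f \<in> borel_measurable borel"
  shows "(\<integral>\<^sup>+x. f (norm (x :: real^2)) \<partial>lborel) = (\<integral>\<^sup>+u. ennreal (2 * pi * u) * f u \<partial>lborel)"
proof -
  have "(\<integral>\<^sup>+x. f (norm (x :: real^2)) \<partial>lborel) = (\<integral>\<^sup>+u. f u \<partial>distr lborel borel (norm :: real^2 \<Rightarrow> real))"
    by (subst nn_integral_distr) auto
  then show ?thesis
    by (simp add: distr_norm_plane nn_integral_density)
qed

text \<open>Intensity measure of the process of links (type, length) seen from the origin.\<close>

definition link_measure :: "real \<Rightarrow> (bool \<Rightarrow> real \<Rightarrow> real) \<Rightarrow> (bool \<times> real) measure" where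
  "link_measure \<Lambda> P = density (count_space UNIV \<Otimes>\<^sub>M lborel)
     (\<lambda>p. ennreal (2 * pi * \<Lambda> * snd p) * ennreal (P (fst p) (snd p)))"

lemma measurable_pair_count_space_UNIV:
  assumes "\<And>b. f b \<in> N \<rightarrow>\<^sub>M M"
  shows "(\<lambda>p. f (fst p) (snd p)) \<in> count_space (UNIV :: bool set) \<Otimes>\<^sub>M N \<rightarrow>\<^sub>M M"
  by (rule measurable_compose_countable[where f="\<lambda>b p. f b (snd p)" and g=fst])
     (auto intro: measurable_compose[OF measurable_snd assms])

lemma sets_link_measure [measurable_cong]: "sets (link_measure \<Lambda> P) = sets (count_space UNIV \<Otimes>\<^sub>M borel)"
  unfolding link_measure_def sets_density by (intro sets_pair_measure_cong) auto

lemma space_link_measure [simp]: "space (link_measure \<Lambda> P) = UNIV"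
  by (simp add: link_measure_def space_pair_measure)

lemma measurable_link_measure:
  assumes "\<And>b. f b \<in> borel \<rightarrow>\<^sub>M M"
  shows "(\<lambda>p. f (fst p) (snd p)) \<in> link_measure \<Lambda> P \<rightarrow>\<^sub>M M"
  using measurable_pair_count_space_UNIV[OF assms] by (simp cong: measurable_cong_sets add: sets_link_measure)

lemma nn_integral_link_measure:
  assumes P [measurable]: "\<And>b. P b \<in> borel_measurable borel" and f [measurable]: "\<And>b. f b \<in> borel_measurable borel"
  shows "(\<integral>\<^sup>+p. f (fst p) (snd p) \<partial>link_measure \<Lambda> P) =
    (\<integral>\<^sup>+u. ennreal (2 * pi * \<Lambda> * u) * ennreal (P True u) * f True u \<partial>lborel) +
    (\<integral>\<^sup>+u. ennreal (2 * pi * \<Lambda> * u) * ennreal (P False u) * f False u \<partial>lborel)"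
proof -
  let ?g = "\<lambda>b u. ennreal (2 * pi * \<Lambda> * u) * ennreal (P b u)"
  have g: "(\<lambda>p. ?g (fst p) (snd p)) \<in> borel_measurable (count_space (UNIV :: bool set) \<Otimes>\<^sub>M lborel)"
    and f': "(\<lambda>p. f (fst p) (snd p)) \<in> borel_measurable (count_space (UNIV :: bool set) \<Otimes>\<^sub>M lborel)"
    and fg: "(\<lambda>p. ?g (fst p) (snd p) * f (fst p) (snd p)) \<in> borel_measurable (count_space (UNIV :: bool set) \<Otimes>\<^sub>M lborel)"
    by (rule measurable_pair_count_space_UNIV[of "\<lambda>b u. ?g b u"] measurable_pair_count_space_UNIV[of f]
         measurable_pair_count_space_UNIV[of "\<lambda>b u. ?g b u * f b u"]; simp)+
  have "(\<integral>\<^sup>+p. f (fst p) (snd p) \<partial>link_measure \<Lambda> P) = (\<integral>\<^sup>+p. ?g (fst p) (snd p) * f (fst p) (snd p) \<partial>(count_space UNIV \<Otimes>\<^sub>M lborel))"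
    unfolding link_measure_def by (rule nn_integral_density[OF g f'])
  also have "\<dots> = (\<integral>\<^sup>+b. \<integral>\<^sup>+u. ?g b u * f b u \<partial>lborel \<partial>count_space UNIV)"
    using lborel.nn_integral_fst[OF fg] by simp
  also have "\<dots> = (\<Sum>b\<in>UNIV. \<integral>\<^sup>+u. ?g b u * f b u \<partial>lborel)"
    by (rule nn_integral_count_space_finite) simp
  finally show ?thesis by (simp add: UNIV_bool add.commute)
qed

text \<open>The factors depend on a point only through type and length, so polar coordinates turn
  the plane integral into one over links. Negative lengths carry no mass.\<close>

lemma link_pgfl:
  fixes X :: "nat \<Rightarrow> 'w \<Rightarrow> real^2" and v :: "bool \<Rightarrow> real \<Rightarrow> real"
  assumes M: "prob_space M" and ppp: "homogeneous_ppp M \<Lambda> \<Phi>" and "0 \<le> \<Lambda>"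
    and Xm: "\<And>n. X n \<in> borel_measurable M"
    and X: "AE w in M. bij_betw (\<lambda>n. X n w) UNIV (\<Phi> w)"
    and los: "los_states M (P True) X L"
    and P [measurable]: "\<And>b. P b \<in> borel_measurable borel" and P01: "\<And>r. 0 \<le> r \<Longrightarrow> 0 \<le> P True r \<and> P True r \<le> 1"
    and PN: "\<And>r. P False r = 1 - P True r"
    and v [measurable]: "\<And>b. v b \<in> borel_measurable borel"
    and v01: "\<And>b u. 0 \<le> v b u" "\<And>b u. v b u \<le> 1"
  shows "(\<integral>\<^sup>+w. ennreal (inf_prod (\<lambda>n. v (L n w) (norm (X n w)))) \<partial>M) =
    ennreal (exp_minus (\<integral>\<^sup>+p. ennreal (1 - v (fst p) (snd p)) \<partial>link_measure \<Lambda> P))"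
proof -
  let ?f = "\<lambda>u. P True u * (1 - v True u) + (1 - P True u) * (1 - v False u)"
  have "(\<integral>\<^sup>+w. ennreal (inf_prod (\<lambda>n. v (L n w) (norm (X n w)))) \<partial>M) =
    ennreal (exp_minus (ennreal \<Lambda> * (\<integral>\<^sup>+x. ennreal (?f (norm (x::real^2))) \<partial>lborel)))"
    by (rule marked_ppp_pgfl[OF M ppp \<open>0 \<le> \<Lambda>\<close> Xm X los P P01, where v="\<lambda>b x. v b (norm x)"]) (auto simp: v01)
  also have "(\<integral>\<^sup>+x. ennreal (?f (norm (x::real^2))) \<partial>lborel) = (\<integral>\<^sup>+u. ennreal (2 * pi * u) * ennreal (?f u) \<partial>lborel)"
    by (rule nn_integral_norm_plane) measurable
  also have "ennreal \<Lambda> * \<dots> = (\<integral>\<^sup>+u. ennreal (2 * pi * \<Lambda> * u) * ennreal (P True u) * ennreal (1 - v True u) +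
     ennreal (2 * pi * \<Lambda> * u) * ennreal (P False u) * ennreal (1 - v False u) \<partial>lborel)"
  proof (subst nn_integral_cmult[symmetric])
    show "(\<lambda>u. ennreal (2 * pi * u) * ennreal (?f u)) \<in> borel_measurable lborel" by measurable
    show "(\<integral>\<^sup>+u. ennreal \<Lambda> * (ennreal (2 * pi * u) * ennreal (?f u)) \<partial>lborel) = (\<integral>\<^sup>+u. ennreal (2 * pi * \<Lambda> * u) * ennreal (P True u) * ennreal (1 - v True u) +
       ennreal (2 * pi * \<Lambda> * u) * ennreal (P False u) * ennreal (1 - v False u) \<partial>lborel)"
    proof (rule nn_integral_cong)
      fix u :: real
      show "ennreal \<Lambda> * (ennreal (2 * pi * u) * ennreal (?f u)) = ennreal (2 * pi * \<Lambda> * u) * ennreal (P True u) * ennreal (1 - v True u) +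
         ennreal (2 * pi * \<Lambda> * u) * ennreal (P False u) * ennreal (1 - v False u)"
      proof (cases "0 \<le> u")
        case True
        have p: "0 \<le> P True u" "P True u \<le> 1" using P01[OF True] by auto
        have 1: "ennreal \<Lambda> * (ennreal (2 * pi * u) * ennreal (?f u)) = ennreal (\<Lambda> * (2 * pi * u * ?f u))"
          using True p \<open>0 \<le> \<Lambda>\<close> v01 by (simp add: ennreal_mult)
        have 2: "ennreal (2 * pi * \<Lambda> * u) * ennreal (P b u) * ennreal (1 - v b u) = ennreal (2 * pi * \<Lambda> * u * P b u * (1 - v b u))" for b
          using True p \<open>0 \<le> \<Lambda>\<close> v01 PN by (cases b) (simp_all add: ennreal_mult)
        have 3: "0 \<le> 2 * pi * \<Lambda> * u * P b u * (1 - v b u)" for b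
          using True p \<open>0 \<le> \<Lambda>\<close> v01 PN by (cases b) simp_all
        show ?thesis
          unfolding 1 2 ennreal_plus[OF 3 3, symmetric] by (simp add: PN algebra_simps)
      next
        case False
        then have "2 * pi * u \<le> 0" "2 * pi * \<Lambda> * u \<le> 0"
          using \<open>0 \<le> \<Lambda>\<close> by (auto simp: mult_nonneg_nonpos)
        then show ?thesis by (simp add: ennreal_neg)
      qed
    qed
  qed
  also have "\<dots> = (\<integral>\<^sup>+p. ennreal (1 - v (fst p) (snd p)) \<partial>link_measure \<Lambda> P)"
    by (subst nn_integral_link_measure[where f="\<lambda>b u. ennreal (1 - v b u)"]) (auto intro!: nn_integral_add)
  finally show ?thesis .
qed

text \<open>\<open>K t\<close> is \<Lambda> times the summed areas of two discs of radius t powr (1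
  / \<alpha> b), within which a link of type b has equivalent distance at most t. Bounding the type
  probabilities by 1 makes the bound explicit and continuous in t.\<close>

lemma emeasure_link_measure_annulus:
  fixes \<alpha> :: "bool \<Rightarrow> real"
  assumes P [measurable]: "\<And>b. P b \<in> borel_measurable borel" and P01: "\<And>b r. 0 \<le> r \<Longrightarrow> 0 \<le> P b r \<and> P b r \<le> 1"
    and "0 \<le> \<Lambda>" and \<alpha>: "\<And>b. 0 < \<alpha> b" and xy: "0 \<le> x" "x \<le> y"
  defines "K \<equiv> \<lambda>t. pi * \<Lambda> * ((t powr (1 / \<alpha> True))\<^sup>2 + (t powr (1 / \<alpha> False))\<^sup>2)"
  shows "K x \<le> K y \<and> emeasure (link_measure \<Lambda> P) {p \<in> space (link_measure \<Lambda> P). x \<le> snd p powr \<alpha> (fst p) \<and> snd p powr \<alpha> (fst p) < y} \<le> ennreal (K y - K x)"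
proof -
  have mono: "(x powr (1 / \<alpha> b))\<^sup>2 \<le> (y powr (1 / \<alpha> b))\<^sup>2" for b
    using xy \<alpha>[of b] by (intro power_mono powr_mono2) auto
  have *: "(\<integral>\<^sup>+u. ennreal (2 * pi * \<Lambda> * u) * ennreal (P b u) * indicator {x..<y} (u powr \<alpha> b) \<partial>lborel)
      \<le> ennreal (pi * \<Lambda> * (y powr (1 / \<alpha> b))\<^sup>2 - pi * \<Lambda> * (x powr (1 / \<alpha> b))\<^sup>2)" for b
  proof -
    have "(\<integral>\<^sup>+u. ennreal (2 * pi * \<Lambda> * u) * ennreal (P b u) * indicator {x..<y} (u powr \<alpha> b) \<partial>lborel)
      \<le> (\<integral>\<^sup>+u. ennreal (2 * pi * \<Lambda> * u) * indicator {x powr (1 / \<alpha> b)..y powr (1 / \<alpha> b)} u \<partial>lborel)"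
    proof (rule nn_integral_mono)
      fix u :: real
      show "ennreal (2 * pi * \<Lambda> * u) * ennreal (P b u) * indicator {x..<y} (u powr \<alpha> b) \<le> ennreal (2 * pi * \<Lambda> * u) * indicator {x powr (1 / \<alpha> b)..y powr (1 / \<alpha> b)} u"
      proof (cases "0 \<le> u")
        case True
        have "u \<in> {x powr (1 / \<alpha> b)..y powr (1 / \<alpha> b)}" if "u powr \<alpha> b \<in> {x..<y}"
        proof -
          have "x powr (1 / \<alpha> b) \<le> (u powr \<alpha> b) powr (1 / \<alpha> b)" "(u powr \<alpha> b) powr (1 / \<alpha> b) \<le> y powr (1 / \<alpha> b)"
            using that xy \<alpha>[of b] by (auto intro!: powr_mono2)
          moreover have "(u powr \<alpha> b) powr (1 / \<alpha> b) = u"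
            using \<alpha>[of b] True by (simp add: powr_powr)
          ultimately show ?thesis by simp
        qed
        moreover have "ennreal (P b u) \<le> 1" using P01[OF True, of b] by simp
        then have "ennreal (2 * pi * \<Lambda> * u) * ennreal (P b u) \<le> ennreal (2 * pi * \<Lambda> * u)"
          using mult_left_mono[of "ennreal (P b u)" 1 "ennreal (2 * pi * \<Lambda> * u)"] by simp
        ultimately show ?thesis by (auto simp: indicator_def)
      next
        case False
        then have "2 * pi * \<Lambda> * u \<le> 0" using \<open>0 \<le> \<Lambda>\<close> by (auto simp: mult_nonneg_nonpos)
        then show ?thesis by (simp add: ennreal_neg)
      qed
    qed
    also have "\<dots> = ennreal (pi * \<Lambda> * (y powr (1 / \<alpha> b))\<^sup>2 - pi * \<Lambda> * (x powr (1 / \<alpha> b))\<^sup>2)"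
    proof (rule nn_integral_FTC_Icc)
      show "x powr (1 / \<alpha> b) \<le> y powr (1 / \<alpha> b)" using xy \<alpha>[of b] by (intro powr_mono2) auto
      fix u assume "u \<in> {x powr (1 / \<alpha> b)..y powr (1 / \<alpha> b)}"
      then have "0 \<le> u" using order_trans[OF powr_ge_zero] by auto
      then show "0 \<le> 2 * pi * \<Lambda> * u" using \<open>0 \<le> \<Lambda>\<close> by simp
    qed (auto intro!: derivative_eq_intros)
    finally show ?thesis .
  qed
  have "emeasure (link_measure \<Lambda> P) {p \<in> space (link_measure \<Lambda> P). x \<le> snd p powr \<alpha> (fst p) \<and> snd p powr \<alpha> (fst p) < y} =
    (\<integral>\<^sup>+p. indicator {p \<in> space (link_measure \<Lambda> P). x \<le> snd p powr \<alpha> (fst p) \<and> snd p powr \<alpha> (fst p) < y} p \<partial>link_measure \<Lambda> P)"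
  proof (rule nn_integral_indicator[symmetric])
    have "(\<lambda>p. snd p powr \<alpha> (fst p)) \<in> borel_measurable (link_measure \<Lambda> P)"
      by (rule measurable_link_measure[of "\<lambda>b u. u powr \<alpha> b"]) measurable
    then show "{p \<in> space (link_measure \<Lambda> P). x \<le> snd p powr \<alpha> (fst p) \<and> snd p powr \<alpha> (fst p) < y} \<in> sets (link_measure \<Lambda> P)"
      by measurable
  qed
  also have "\<dots> = (\<integral>\<^sup>+p. indicator {x..<y} (snd p powr \<alpha> (fst p)) \<partial>link_measure \<Lambda> P)"
    by (intro nn_integral_cong) (auto simp: indicator_def)
  also have "\<dots> = (\<integral>\<^sup>+u. ennreal (2 * pi * \<Lambda> * u) * ennreal (P True u) * indicator {x..<y} (u powr \<alpha> True) \<partial>lborel)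
     + (\<integral>\<^sup>+u. ennreal (2 * pi * \<Lambda> * u) * ennreal (P False u) * indicator {x..<y} (u powr \<alpha> False) \<partial>lborel)"
    by (rule nn_integral_link_measure[where f="\<lambda>b u. indicator {x..<y} (u powr \<alpha> b)"]) auto
  also have "\<dots> \<le> ennreal (pi * \<Lambda> * (y powr (1 / \<alpha> True))\<^sup>2 - pi * \<Lambda> * (x powr (1 / \<alpha> True))\<^sup>2)
     + ennreal (pi * \<Lambda> * (y powr (1 / \<alpha> False))\<^sup>2 - pi * \<Lambda> * (x powr (1 / \<alpha> False))\<^sup>2)"
    by (intro add_mono *)
  also have "\<dots> = ennreal (K y - K x)"
    using mono \<open>0 \<le> \<Lambda>\<close> unfolding K_def
    by (subst ennreal_plus[symmetric]) (auto intro!: mult_left_mono simp: algebra_simps)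
  finally show ?thesis
    using mono \<open>0 \<le> \<Lambda>\<close> by (auto simp: K_def intro!: mult_left_mono add_mono)
qed

section \<open>The nearest point\<close>

lemma exp_minus_antimono: "x \<le> y \<Longrightarrow> exp_minus y \<le> exp_minus x"
  by (cases x; cases y) (auto simp: top_unique)

text \<open>Separates a part that may be infinite but is free of t from a part that involves only D
  < t and is finite in the application.\<close>

lemma nn_integral_split_indicator_01:
  assumes [measurable]: "D \<in> borel_measurable \<nu>" "\<psi> \<in> borel_measurable \<nu>"
    and \<psi>: "\<And>p. 0 \<le> \<psi> p" "\<And>p. \<psi> p \<le> 1"
  shows "(\<integral>\<^sup>+p. ennreal (1 - indicator {t..} (D p) * \<psi> p) \<partial>\<nu>) =
    (\<integral>\<^sup>+p. ennreal (1 - \<psi> p) \<partial>\<nu>) + (\<integral>\<^sup>+p. ennreal (indicator {..<t::real} (D p) * \<psi> p) \<partial>\<nu>)"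
proof -
  have "ennreal (1 - indicator {t..} (D p) * \<psi> p) = ennreal (1 - \<psi> p) + ennreal (indicator {..<t} (D p) * \<psi> p)" for p
    using \<psi>[of p] by (auto simp: indicator_def simp flip: ennreal_plus)
  then show ?thesis
    by (simp add: nn_integral_add)
qed

text \<open>\<open>R t\<close> factors as b * exp (- F t) with b free of t, which reduces the claim
  to \<open>nn_integral_exp_stieltjes\<close>. If the integral of 1 - \<psi> diverges, then b = 0
  and both sides vanish.\<close>

lemma exp_minus_stieltjes:
  fixes \<nu> :: "'p measure" and D \<psi> :: "'p \<Rightarrow> real" and K :: "real \<Rightarrow> real"
  assumes [measurable]: "D \<in> borel_measurable \<nu>" "\<psi> \<in> borel_measurable \<nu>"
    and \<psi>: "\<And>p. 0 \<le> \<psi> p" "\<And>p. \<psi> p \<le> 1"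
    and K: "continuous_on {0..} K"
    and D0: "\<And>p. 0 \<le> D p"
    and DK: "\<And>x y. 0 \<le> x \<Longrightarrow> x \<le> y \<Longrightarrow> K x \<le> K y \<and> emeasure \<nu> {p \<in> space \<nu>. x \<le> D p \<and> D p < y} \<le> ennreal (K y - K x)"
    and ts: "0 \<le> t" "t \<le> t'"
  defines "R \<equiv> \<lambda>t. exp_minus (\<integral>\<^sup>+p. ennreal (1 - indicator {t..} (D p) * \<psi> p) \<partial>\<nu>)"
  shows "(\<integral>\<^sup>+p. ennreal (indicator {t..<t'} (D p) * (R (D p) * \<psi> p)) \<partial>\<nu>) = ennreal (R t - R t')"
proof -
  define F where "F t = (LINT p|\<nu>. indicator {..<t} (D p) * \<psi> p)" for t
  define b where "b = exp_minus (\<integral>\<^sup>+p. ennreal (1 - \<psi> p) \<partial>\<nu>)"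
  have b: "0 \<le> b" by (simp add: b_def)
  have F_nn: "0 \<le> F t" for t unfolding F_def by (intro integral_nonneg_AE) (auto simp: \<psi>)
  have FN: "(\<integral>\<^sup>+p. ennreal (indicator {..<t} (D p) * \<psi> p) \<partial>\<nu>) = ennreal (F t)" for t
  proof -
    have "(\<integral>\<^sup>+p. ennreal (indicator {..<t} (D p) * \<psi> p) \<partial>\<nu>) \<le> (\<integral>\<^sup>+p. indicator {p \<in> space \<nu>. 0 \<le> D p \<and> D p < t} p \<partial>\<nu>)"
      by (rule nn_integral_mono) (auto simp: indicator_def \<psi> D0)
    also have "\<dots> = emeasure \<nu> {p \<in> space \<nu>. 0 \<le> D p \<and> D p < t}"
      by (rule nn_integral_indicator) measurable
    also have "\<dots> < \<infinity>"
    proof (cases "0 \<le> t")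
      case True
      then show ?thesis using DK[of 0 t] le_less_trans[OF _ ennreal_less_top[of "K t - K 0"]] by auto
    next
      case False
      then have "{p \<in> space \<nu>. 0 \<le> D p \<and> D p < t} = {}" by auto
      then show ?thesis by (simp only: emeasure_empty) simp
    qed
    finally have fin: "(\<integral>\<^sup>+p. ennreal (indicator {..<t} (D p) * \<psi> p) \<partial>\<nu>) < \<infinity>" .
    show ?thesis
      unfolding F_def
      by (intro nn_integral_eq_integral integrableI_nonneg fin) (auto simp: \<psi>)
  qed
  have "mono F"
  proof (rule monoI)
    fix x y :: real assume "x \<le> y"
    then have "ennreal (F x) \<le> ennreal (F y)"
      unfolding FN[symmetric] by (intro nn_integral_mono) (auto simp: indicator_def \<psi>)
    then show "F x \<le> F y" by (simp add: F_nn)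
  qed
  then have [measurable]: "F \<in> borel_measurable borel" by (rule borel_measurable_mono)
  have R: "R t = b * exp (- F t)" for t
    unfolding R_def by (simp add: nn_integral_split_indicator_01 \<psi> exp_minus_add b_def FN F_nn)
  have "(\<integral>\<^sup>+p. ennreal (indicator {t..<t'} (D p) * (R (D p) * \<psi> p)) \<partial>\<nu>) =
    (\<integral>\<^sup>+p. ennreal b * ennreal (indicator {t..<t'} (D p) * (exp (- F (D p)) * \<psi> p)) \<partial>\<nu>)"
    by (intro nn_integral_cong) (simp add: R b mult_ac flip: ennreal_mult')
  also have "\<dots> = ennreal b * (\<integral>\<^sup>+p. ennreal (indicator {t..<t'} (D p) * (exp (- F (D p)) * \<psi> p)) \<partial>\<nu>)"
  proof (rule nn_integral_cmult)
    show "(\<lambda>p. ennreal (indicator {t..<t'} (D p) * (exp (- F (D p)) * \<psi> p))) \<in> borel_measurable \<nu>"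
      by measurable
  qed
  also have "\<dots> = ennreal b * ennreal (exp (- F t) - exp (- F t'))"
  proof -
    have "{p \<in> space \<nu>. D p < 0} = {}" using D0 by (auto simp: not_less)
    then have "emeasure \<nu> {p \<in> space \<nu>. D p < 0} = 0" by (simp only: emeasure_empty)
    from nn_integral_exp_stieltjes[OF assms(1,2) \<psi> K this DK ts]
    show ?thesis by (simp add: F_def)
  qed
  also have "\<dots> = ennreal (R t - R t')"
    by (simp add: R b right_diff_distrib flip: ennreal_mult')
  finally show ?thesis .
qed


text \<open>The link p on the right plays the nearest one: \<psi> (D p) (D p) is its own factor, and
  R (D p) (D p) is the mean weight of the process on the event that no point is closer. For frozen s
  the mass of the strip t \<le> T < t' is a difference of two values of the generating functional,
  to which \<open>exp_minus_stieltjes\<close> applies; \<open>nn_integral_diagonal_eq\<close> then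
  restores s = T.\<close>

lemma nn_integral_nearest_point:
  fixes \<nu> :: "'p measure" and D :: "'p \<Rightarrow> real" and \<psi> :: "real \<Rightarrow> real \<Rightarrow> real" and c :: "real \<Rightarrow> real"
    and Y :: "nat \<Rightarrow> 'w \<Rightarrow> real"
  assumes M: "prob_space M"
    and Y [measurable]: "\<And>m. Y m \<in> borel_measurable M" and Y0: "\<And>m w. 0 \<le> Y m w"
    and D [measurable]: "D \<in> borel_measurable \<nu>" and D0: "\<And>p. 0 \<le> D p"
    and K: "continuous_on {0..} K"
    and DK: "\<And>x y. 0 \<le> x \<Longrightarrow> x \<le> y \<Longrightarrow> K x \<le> K y \<and> emeasure \<nu> {p \<in> space \<nu>. x \<le> D p \<and> D p < y} \<le> ennreal (K y - K x)"
    and \<psi> [measurable]: "\<And>s. \<psi> s \<in> borel_measurable borel"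
    and \<psi>01: "\<And>s y. 0 \<le> s \<Longrightarrow> 0 \<le> y \<Longrightarrow> 0 \<le> \<psi> s y \<and> \<psi> s y \<le> 1"
    and \<psi>anti: "\<And>s s' y. 0 \<le> s \<Longrightarrow> s \<le> s' \<Longrightarrow> 0 \<le> y \<Longrightarrow> \<psi> s' y \<le> \<psi> s y"
    and \<psi>cont: "\<And>y. 0 \<le> y \<Longrightarrow> continuous_on {0..} (\<lambda>s. \<psi> s y)"
    and c01: "\<And>s. 0 \<le> s \<Longrightarrow> 0 \<le> c s \<and> c s \<le> 1" and ccont: "continuous_on {0..} c"
    and pgfl: "\<And>s t. 0 \<le> s \<Longrightarrow> 0 \<le> t \<Longrightarrow>
      (\<integral>\<^sup>+w. ennreal (inf_prod (\<lambda>m. indicator {t..} (Y m w) * \<psi> s (Y m w))) \<partial>M) =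
      ennreal (exp_minus (\<integral>\<^sup>+p. ennreal (1 - indicator {t..} (D p) * \<psi> s (D p)) \<partial>\<nu>))"
  defines "T \<equiv> \<lambda>w. INF m. Y m w"
    and "R \<equiv> \<lambda>s t. exp_minus (\<integral>\<^sup>+p. ennreal (1 - indicator {t..} (D p) * \<psi> s (D p)) \<partial>\<nu>)"
  shows "(\<integral>\<^sup>+w. ennreal (c (T w) * inf_prod (\<lambda>m. \<psi> (T w) (Y m w))) \<partial>M) =
    (\<integral>\<^sup>+p. ennreal (c (D p) * (R (D p) (D p) * \<psi> (D p) (D p))) \<partial>\<nu>)" (is ?eq)
    and "(\<lambda>p. ennreal (c (D p) * (R (D p) (D p) * \<psi> (D p) (D p)))) \<in> borel_measurable \<nu>" (is ?meas)
proof -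
  interpret prob_space M by fact
  have seq_cont: "(\<lambda>k. f (S k)) \<longlonglongrightarrow> f s"
    if "continuous_on {0..} f" "incseq S" "S \<longlonglongrightarrow> s" "0 \<le> S 0" for f :: "real \<Rightarrow> real" and S s
  proof -
    have S0: "0 \<le> S k" for k using that(2,4) by (meson incseqD le0 order_trans)
    then have "0 \<le> s" using that(3) by (intro LIMSEQ_le_const[OF that(3)]) auto
    then show ?thesis
      using continuous_on_tendsto_compose[OF that(1,3)] S0 by auto
  qed
  have seq_nn: "0 \<le> S k" "0 \<le> s" "S k \<le> s" if "incseq S" "S \<longlonglongrightarrow> s" "0 \<le> S 0" for S :: "nat \<Rightarrow> real" and k s
  proof -
    show S0: "0 \<le> S k" for k using that by (meson incseqD le0 order_trans)
    show "S k \<le> s" using that by (intro incseq_le)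
    then show "0 \<le> s" using S0[of k] by simp
  qed
  have [measurable]: "T \<in> borel_measurable M"
    unfolding T_def by (intro borel_measurable_cINF) (auto intro!: bdd_belowI[of _ 0] Y0)
  \<comment> \<open>The reason for half-open strips: t \<le> T is a product event even if the
    infimum is not attained, whereas t < T is not the event that t < Y m for all m.\<close>
  have T_ge: "t \<le> T w \<longleftrightarrow> (\<forall>m. t \<le> Y m w)" for t w
    unfolding T_def by (subst le_cINF_iff) (auto intro!: bdd_belowI[of _ 0] Y0)
  have T0: "0 \<le> T w" for w by (simp add: T_ge Y0)
  \<comment> \<open>\<open>\<psi> s\<close> is controlled for nonnegative s only, while
    \<open>g s\<close> and \<open>q s\<close> have to be measurable for every s, which is derived
    from values in [0,1]. Clipping provides these and changes nothing at the arguments that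
    matter.\<close>
  define \<psi>' where "\<psi>' s y = max 0 (min 1 (\<psi> s y))" for s y
  have \<psi>'01: "0 \<le> \<psi>' s y" "\<psi>' s y \<le> 1" for s y by (auto simp: \<psi>'_def)
  have \<psi>'_eq: "\<psi>' s y = \<psi> s y" if "0 \<le> s" "0 \<le> y" for s y
    using \<psi>01[OF that] by (auto simp: \<psi>'_def)
  have [measurable]: "\<psi>' s \<in> borel_measurable borel" for s
    unfolding \<psi>'_def by measurable
  define Q where "Q s t = exp_minus (\<integral>\<^sup>+p. ennreal (1 - indicator {t..} (D p) * \<psi>' s (D p)) \<partial>\<nu>)" for s t
  have pgfl': "(\<integral>\<^sup>+w. ennreal (inf_prod (\<lambda>m. indicator {t..} (Y m w) * \<psi>' s (Y m w))) \<partial>M) = ennreal (Q s t)"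
    if "0 \<le> s" "0 \<le> t" for s t
    using pgfl[OF that] by (simp add: Q_def \<psi>'_eq Y0 D0 that)
  define g where "g s w = c s * inf_prod (\<lambda>m. \<psi>' s (Y m w))" for s w
  define q where "q s p = c s * (Q s (D p) * \<psi>' s (D p))" for s p
  have [measurable]: "Q s \<in> borel_measurable borel" for s
  proof -
    \<comment> \<open>Monotonicity in t yields Borel measurability without a Fubini
      argument.\<close>
    have "mono (\<lambda>t. - Q s t)"
    proof (rule monoI)
      fix x y :: real assume "x \<le> y"
      then have "(\<integral>\<^sup>+p. ennreal (1 - indicator {x..} (D p) * \<psi>' s (D p)) \<partial>\<nu>) \<le> (\<integral>\<^sup>+p. ennreal (1 - indicator {y..} (D p) * \<psi>' s (D p)) \<partial>\<nu>)"
        by (intro nn_integral_mono ennreal_leI) (auto simp: indicator_def \<psi>'01)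
      then show "- Q s x \<le> - Q s y" by (simp add: Q_def exp_minus_antimono)
    qed
    from borel_measurable_uminus[OF borel_measurable_mono[OF this]] show ?thesis by simp
  qed
  have "(\<integral>\<^sup>+w. ennreal (g (T w) w) \<partial>M) = (\<integral>\<^sup>+p. ennreal (q (D p) p) \<partial>\<nu>) \<and> (\<lambda>p. ennreal (q (D p) p)) \<in> borel_measurable \<nu>"
  proof (rule nn_integral_diagonal_eq[where g=g and q=q and T=T and D=D])
    show "g s \<in> borel_measurable M" for s
      unfolding g_def by (intro borel_measurable_times borel_measurable_const borel_measurable_inf_prod) (auto simp: \<psi>'01)
    show "0 \<le> g s w" "g s w \<le> 1" if "0 \<le> s" for s w
      using c01[OF that] by (auto simp: g_def \<psi>'01 inf_prod_nonneg inf_prod_le_1 intro!: mult_nonneg_nonneg mult_le_one)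
    show "(\<lambda>k. g (S k) w) \<longlonglongrightarrow> g s w" if "incseq S" "S \<longlonglongrightarrow> s" "0 \<le> S 0" for S s w
      unfolding g_def
    proof (intro tendsto_mult seq_cont[OF ccont that] inf_prod_tendsto)
      fix n k
      show "0 \<le> \<psi>' s (Y n w)" by (rule \<psi>'01)
      \<comment> \<open>As S increases, the factors approach their limit from above, as
        \<open>inf_prod_tendsto\<close> requires.\<close>
      show "\<psi>' s (Y n w) \<le> \<psi>' (S k) (Y n w)"
        using seq_nn[OF that] \<psi>anti[of "S k" s "Y n w"] Y0 by (simp add: \<psi>'_eq)
      show "(\<lambda>k. \<psi>' (S k) (Y n w)) \<longlonglongrightarrow> \<psi>' s (Y n w)"
        using seq_cont[OF \<psi>cont[OF Y0] that] seq_nn[OF that] Y0 by (simp add: \<psi>'_eq)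
    qed
    show "emeasure M {w \<in> space M. T w < r} < \<infinity>" for r by (simp add: emeasure_finite less_top[symmetric])
    show "emeasure \<nu> {p \<in> space \<nu>. D p < r} < \<infinity>" for r
    proof -
      have "{p \<in> space \<nu>. D p < r} \<subseteq> {p \<in> space \<nu>. 0 \<le> D p \<and> D p < max 0 r}" using D0 by auto
      then have "emeasure \<nu> {p \<in> space \<nu>. D p < r} \<le> emeasure \<nu> {p \<in> space \<nu>. 0 \<le> D p \<and> D p < max 0 r}"
        by (rule emeasure_mono) measurable
      also have "\<dots> < \<infinity>"
        using DK[of 0 "max 0 r"] le_less_trans[OF _ ennreal_less_top[of "K (max 0 r) - K 0"]] by auto
      finally show ?thesis .
    qed
    show "q s \<in> borel_measurable \<nu>" for s
      unfolding q_def by measurable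
    show "0 \<le> q s p" "q s p \<le> 1" if "0 \<le> s" for s p
      using c01[OF that] by (auto simp: q_def Q_def \<psi>'01 intro!: mult_nonneg_nonneg mult_le_one)
    show "(\<lambda>k. q (S k) p) \<longlonglongrightarrow> q s p" if "incseq S" "S \<longlonglongrightarrow> s" "0 \<le> S 0" for S s p
      unfolding q_def
    proof (intro tendsto_mult seq_cont[OF ccont that])
      show lim: "(\<lambda>k. \<psi>' (S k) (D p)) \<longlonglongrightarrow> \<psi>' s (D p)" for p
        using seq_cont[OF \<psi>cont[OF D0] that] seq_nn[OF that] D0 by (simp add: \<psi>'_eq)
      show "(\<lambda>k. Q (S k) (D p)) \<longlonglongrightarrow> Q s (D p)"
        unfolding Q_def
      \<comment> \<open>These integrals may be infinite, so the limit is monotone: the integrand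
        grows along S because \<psi>' decreases in s.\<close>
      proof (intro tendsto_exp_minus nn_integral_LIMSEQ)
        show "incseq (\<lambda>k p'. ennreal (1 - indicator {D p..} (D p') * \<psi>' (S k) (D p')))"
        proof (intro incseq_SucI le_funI ennreal_leI diff_left_mono mult_left_mono)
          fix k p'
          show "\<psi>' (S (Suc k)) (D p') \<le> \<psi>' (S k) (D p')"
            using seq_nn[OF that] \<psi>anti[of "S k" "S (Suc k)" "D p'"] D0 incseqD[OF that(1), of k "Suc k"] by (simp add: \<psi>'_eq)
        qed simp
        show "(\<lambda>k. ennreal (1 - indicator {D p..} (D p') * \<psi>' (S k) (D p'))) \<longlonglongrightarrow> ennreal (1 - indicator {D p..} (D p') * \<psi>' s (D p'))" for p'
          by (intro tendsto_ennrealI tendsto_diff tendsto_mult tendsto_const lim)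
      qed measurable
    qed
    fix s t t' :: real assume s: "0 \<le> s" and t: "0 \<le> t" "t \<le> t'"
    \<comment> \<open>The weight on the event t \<le> T, written as a product so that the generating
      functional applies.\<close>
    define G where "G t w = inf_prod (\<lambda>m. indicator {t..} (Y m w) * \<psi>' s (Y m w))" for t w
    have G_eq: "G t w = indicator {t..} (T w) * inf_prod (\<lambda>m. \<psi>' s (Y m w))" for t w
      unfolding G_def using inf_prod_indicator_mult[of "\<lambda>m. \<psi>' s (Y m w)" "{t..}" "\<lambda>m. Y m w"]
      by (simp add: \<psi>'01 T_ge indicator_def)
    have [measurable]: "G t \<in> borel_measurable M" for t
      unfolding G_def by (intro borel_measurable_inf_prod) (auto simp: \<psi>'01)
    have G01: "0 \<le> G t w" "G t w \<le> 1" for t w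
      unfolding G_def by (auto intro!: inf_prod_nonneg inf_prod_le_1 simp: \<psi>'01)
    have "(\<integral>\<^sup>+w. ennreal (indicator {t..<t'} (T w) * g s w) \<partial>M) = (\<integral>\<^sup>+w. ennreal (c s) * (ennreal (G t w) - ennreal (G t' w)) \<partial>M)"
    proof (rule nn_integral_cong)
      fix w
      have "indicator {t..<t'} (T w) * g s w = c s * (G t w - G t' w)"
        using t by (auto simp: G_eq g_def indicator_def)
      then show "ennreal (indicator {t..<t'} (T w) * g s w) = ennreal (c s) * (ennreal (G t w) - ennreal (G t' w))"
        using c01[OF s] G01 by (simp add: ennreal_minus ennreal_mult')
    qed
    also have "\<dots> = ennreal (c s) * (\<integral>\<^sup>+w. (ennreal (G t w) - ennreal (G t' w)) \<partial>M)"
      by (rule nn_integral_cmult) measurable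
    also have "(\<integral>\<^sup>+w. (ennreal (G t w) - ennreal (G t' w)) \<partial>M) = (\<integral>\<^sup>+w. ennreal (G t w) \<partial>M) - (\<integral>\<^sup>+w. ennreal (G t' w) \<partial>M)"
    proof (rule nn_integral_diff)
      show "(\<integral>\<^sup>+w. ennreal (G t' w) \<partial>M) \<noteq> \<infinity>"
        using pgfl'[OF s, of t'] t by (simp add: G_def)
      show "AE w in M. ennreal (G t' w) \<le> ennreal (G t w)"
        using t by (intro AE_I2 ennreal_leI) (auto simp: G_eq indicator_def \<psi>'01 intro!: inf_prod_nonneg)
    qed measurable
    also have "\<dots> = ennreal (Q s t - Q s t')"
      using pgfl'[OF s] t by (simp add: G_def ennreal_minus Q_def)
    also have "\<dots> = (\<integral>\<^sup>+p. ennreal (indicator {t..<t'} (D p) * (Q s (D p) * \<psi>' s (D p))) \<partial>\<nu>)"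
      unfolding Q_def
      by (rule exp_minus_stieltjes[symmetric, where K=K]) (use \<psi>'01 K D0 DK t in auto)
    also have "ennreal (c s) * \<dots> = (\<integral>\<^sup>+p. ennreal (c s) * ennreal (indicator {t..<t'} (D p) * (Q s (D p) * \<psi>' s (D p))) \<partial>\<nu>)"
      by (rule nn_integral_cmult[symmetric]) measurable
    also have "\<dots> = (\<integral>\<^sup>+p. ennreal (indicator {t..<t'} (D p) * q s p) \<partial>\<nu>)"
      using c01[OF s] by (intro nn_integral_cong) (simp add: q_def mult_ac flip: ennreal_mult')
    finally show "(\<integral>\<^sup>+w. ennreal (indicator {t..<t'} (T w) * g s w) \<partial>M) = (\<integral>\<^sup>+p. ennreal (indicator {t..<t'} (D p) * q s p) \<partial>\<nu>)" .
  qed (auto simp: T0 D0)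
  then show ?eq ?meas
    by (simp_all add: g_def q_def Q_def R_def \<psi>'_eq T0 Y0 D0)
qed

section \<open>Rayleigh fading\<close>

text \<open>Unlike \<^const>\<open>prob_space.indep_var\<close>, this form allows the two variables to have different types.\<close>

lemma (in prob_space) nn_integral_indep_set:
  assumes X [measurable]: "X \<in> M \<rightarrow>\<^sub>M S" and Y [measurable]: "Y \<in> M \<rightarrow>\<^sub>M T"
    and ind: "indep_set (sets (vimage_algebra (space M) X S)) (sets (vimage_algebra (space M) Y T))"
    and f [measurable]: "f \<in> borel_measurable (S \<Otimes>\<^sub>M T)"
  shows "(\<integral>\<^sup>+w. f (X w, Y w) \<partial>M) = (\<integral>\<^sup>+w. \<integral>\<^sup>+w'. f (X w, Y w') \<partial>M \<partial>M)"
proof -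
  interpret X: prob_space "distr M S X" by (rule prob_space_distr) fact
  interpret Y: prob_space "distr M T Y" by (rule prob_space_distr) fact
  have joint: "distr M S X \<Otimes>\<^sub>M distr M T Y = distr M (S \<Otimes>\<^sub>M T) (\<lambda>w. (X w, Y w))"
  proof (rule pair_measure_eqI)
    fix A B assume "A \<in> sets (distr M S X)" "B \<in> sets (distr M T Y)"
    then have AB [measurable]: "A \<in> sets S" "B \<in> sets T" by auto
    have "prob ((X -` A \<inter> space M) \<inter> (Y -` B \<inter> space M)) = prob (X -` A \<inter> space M) * prob (Y -` B \<inter> space M)"
      by (rule indep_setD[OF ind]) (use AB in \<open>auto intro: in_vimage_algebra\<close>)
    moreover have "(\<lambda>w. (X w, Y w)) -` (A \<times> B) \<inter> space M = (X -` A \<inter> space M) \<inter> (Y -` B \<inter> space M)"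
      by auto
    ultimately show "emeasure (distr M S X) A * emeasure (distr M T Y) B = emeasure (distr M (S \<Otimes>\<^sub>M T) (\<lambda>w. (X w, Y w))) (A \<times> B)"
      by (simp add: emeasure_distr emeasure_eq_measure ennreal_mult)
  qed (auto simp: X.sigma_finite_measure_axioms Y.sigma_finite_measure_axioms cong: sets_pair_measure_cong)
  have "(\<integral>\<^sup>+w. f (X w, Y w) \<partial>M) = (\<integral>\<^sup>+z. f z \<partial>distr M (S \<Otimes>\<^sub>M T) (\<lambda>w. (X w, Y w)))"
    by (rule nn_integral_distr[symmetric]) measurable
  also have "\<dots> = (\<integral>\<^sup>+x. \<integral>\<^sup>+y. f (x, y) \<partial>distr M T Y \<partial>distr M S X)"
    unfolding joint[symmetric] by (rule Y.nn_integral_fst[symmetric]) (simp cong: measurable_cong_sets)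
  also have "\<dots> = (\<integral>\<^sup>+x. \<integral>\<^sup>+w'. f (x, Y w') \<partial>M \<partial>distr M S X)"
    by (intro nn_integral_cong nn_integral_distr) auto
  also have "\<dots> = (\<integral>\<^sup>+w. \<integral>\<^sup>+w'. f (X w, Y w') \<partial>M \<partial>M)"
    by (rule nn_integral_distr) measurable
  finally show ?thesis .
qed

lemma (in prob_space) nn_integral_indep_var:
  assumes ind: "indep_var S X T Y" and f: "f \<in> borel_measurable (S \<Otimes>\<^sub>M T)"
  shows "(\<integral>\<^sup>+w. f (X w, Y w) \<partial>M) = (\<integral>\<^sup>+w. \<integral>\<^sup>+w'. f (X w, Y w') \<partial>M \<partial>M)"
  using ind unfolding indep_var_eq
  by (intro nn_integral_indep_set[OF _ _ _ f]) (auto simp: sets_vimage_algebra)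

section \<open>Laplace transform of a nonnegative random variable\<close>

locale nonneg_rv = prob_space +
  fixes W :: "'a \<Rightarrow> real"
  assumes W [measurable]: "W \<in> borel_measurable M" and W0: "AE w in M. 0 \<le> W w"
begin

definition laplace :: "real \<Rightarrow> real" where
  "laplace z = (LINT w|M. exp (- (z * W w)))"

lemma laplace_AE_le_1: "0 \<le> z \<Longrightarrow> AE w in M. norm (exp (- (z * W w))) \<le> 1"
  using W0 by eventually_elim simp

lemma laplace_integrable: "0 \<le> z \<Longrightarrow> integrable M (\<lambda>w. exp (- (z * W w)))"
  by (rule integrable_const_bound[OF laplace_AE_le_1]) auto

lemma laplace_le_1: "0 \<le> z \<Longrightarrow> laplace z \<le> 1"
  unfolding laplace_def using laplace_AE_le_1
  by (intro integral_le_const laplace_integrable) auto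

text \<open>The exponential never vanishes, so a zero integral would make the whole space a null
  set. This positivity permits the division by \<phi> \<kappa>.\<close>

lemma laplace_pos:
  assumes "0 \<le> z"
  shows "0 < laplace z"
proof -
  have "laplace z \<noteq> 0"
    unfolding laplace_def
    using integral_nonneg_eq_0_iff_AE[OF laplace_integrable[OF assms]] by (auto simp: AE_False not_empty)
  moreover have "0 \<le> laplace z" unfolding laplace_def by (intro integral_nonneg_AE) auto
  ultimately show ?thesis by simp
qed

lemma laplace_antimono: "0 \<le> z \<Longrightarrow> z \<le> z' \<Longrightarrow> laplace z' \<le> laplace z"
  unfolding laplace_def using W0
  by (intro integral_mono_AE laplace_integrable) (auto elim!: eventually_mono intro: mult_right_mono)

lemma laplace_continuous: "continuous_on {0..} laplace"
proof (rule continuous_on_sequentiallyI)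
  fix u :: "nat \<Rightarrow> real" and z assume u: "\<forall>n. u n \<in> {0..}" "u \<longlonglongrightarrow> z"
  show "(\<lambda>n. laplace (u n)) \<longlonglongrightarrow> laplace z"
    unfolding laplace_def
  proof (rule integral_dominated_convergence[where w="\<lambda>_. 1"])
    show "AE w in M. (\<lambda>i. exp (- (u i * W w))) \<longlonglongrightarrow> exp (- (z * W w))"
      by (intro AE_I2 tendsto_intros u)
    show "AE w in M. norm (exp (- (u i * W w))) \<le> 1" for i
      using u by (intro laplace_AE_le_1) auto
  qed auto
qed

lemma borel_measurable_laplace [measurable]: "laplace \<in> borel_measurable borel"
  unfolding laplace_def by measurable

lemma laplace_0 [simp]: "laplace 0 = 1"
  by (simp add: laplace_def prob_space)

lemma nn_integral_laplace: "0 \<le> z \<Longrightarrow> (\<integral>\<^sup>+w. ennreal (exp (- (z * W w))) \<partial>M) = ennreal (laplace z)"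
  unfolding laplace_def by (intro nn_integral_eq_integral laplace_integrable) auto

end

definition fading_gain :: "real \<Rightarrow> real \<Rightarrow> real \<Rightarrow> nat \<Rightarrow> (real \<times> real) measure" where
  "fading_gain GA gA \<theta>A k = density lborel (exponential_density 1) \<Otimes>\<^sub>M measure_pmf (bf_gain_pmf GA gA \<theta>A k)"

text \<open>The weights are the three terms of (q + (1 - q))^2 with q = \<theta>A k / (2 pi), hence
  nonnegative with sum 1; \<open>pmf_of_list\<close> has its intended meaning only for such
  well-formed lists.\<close>

lemma set_bf_gain_pmf:
  assumes "0 < GA" "0 \<le> gA" "0 < \<theta>A" "\<theta>A * real k \<le> 2 * pi"
  shows "set_pmf (bf_gain_pmf GA gA \<theta>A k) \<subseteq> {0..}"
proof -
  define q where "q = \<theta>A * real k / (2 * pi)"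
  have q: "0 \<le> q" "q \<le> 1" "\<theta>A * real k / pi = 2 * q"
    using assms by (auto simp: q_def divide_simps)
  have wf: "pmf_of_list_wf [(GA\<^sup>2, q\<^sup>2), (GA * gA, 2 * q * (1 - q)), (gA\<^sup>2, (1 - q)\<^sup>2)]"
  proof (rule pmf_of_list_wfI)
    show "sum_list (map snd [(GA\<^sup>2, q\<^sup>2), (GA * gA, 2 * q * (1 - q)), (gA\<^sup>2, (1 - q)\<^sup>2)]) = 1"
      by (simp add: power2_eq_square algebra_simps)
  qed (use q in auto)
  show ?thesis
    unfolding bf_gain_pmf_def q(3) q_def[symmetric]
    by (rule order_trans[OF set_pmf_of_list[OF wf]]) (use assms in auto)
qed

lemma fading_gain_nonneg_rv:
  assumes "0 < GA" "0 \<le> gA" "0 < \<theta>A" "\<theta>A * real k \<le> 2 * pi"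
  shows "nonneg_rv (fading_gain GA gA \<theta>A k) (\<lambda>p. fst p * snd p)"
proof -
  let ?E = "density lborel (exponential_density 1)" and ?G = "measure_pmf (bf_gain_pmf GA gA \<theta>A k)"
  interpret E: prob_space ?E by (rule prob_space_exponential_density) simp
  interpret pair_prob_space ?E ?G ..
  have [measurable]: "fst \<in> borel_measurable (?E \<Otimes>\<^sub>M ?G)"
    by (rule measurable_compose[OF measurable_fst]) simp
  have [measurable]: "snd \<in> borel_measurable (?E \<Otimes>\<^sub>M ?G)"
    by (rule measurable_compose[OF measurable_snd]) simp
  show ?thesis
    unfolding fading_gain_def
  proof
    show "(\<lambda>p. fst p * snd p) \<in> borel_measurable (?E \<Otimes>\<^sub>M ?G)" by measurable
    have "AE x in ?E. 0 \<le> x"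
      by (subst AE_density) (auto simp: exponential_density_def erlang_density_def)
    then have "AE x in ?E. AE y in ?G. 0 \<le> fst (x, y) * snd (x, y)"
      by (rule eventually_mono) (use set_bf_gain_pmf[OF assms] in \<open>auto simp: AE_measure_pmf_iff intro!: mult_nonneg_nonneg\<close>)
    then show "AE p in ?E \<Otimes>\<^sub>M ?G. 0 \<le> fst p * snd p"
      by (intro AE_pair_measure) measurable
  qed
qed

text \<open>Valid for every Z: at Z = 0 the quotient is \<open>\<top>\<close> for positive x and 0
  otherwise, at Z = \<open>\<top>\<close> it is 0. The case Z = 0 does occur, with \<sigma> = 0 and
  no received interference.\<close>

lemma ennreal_less_divide_iff:
  assumes "0 < \<tau>"
  shows "ennreal \<tau> < ennreal x / Z \<longleftrightarrow> ennreal \<tau> * Z < ennreal x"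
proof (cases Z)
  case (real z)
  show ?thesis
  proof (cases "z = 0")
    case True
    then show ?thesis using real assms
      by (cases "0 < x") (auto simp: ennreal_neg divide_ennreal_def ennreal_mult_top)
  next
    case False
    then have z: "0 < z" using real by simp
    show ?thesis
    proof (cases "0 \<le> x")
      case True
      then have "ennreal x / Z = ennreal (x / z)" using real z by (simp add: divide_ennreal)
      moreover have "ennreal \<tau> * Z = ennreal (\<tau> * z)" using real assms by (simp add: ennreal_mult)
      ultimately show ?thesis
        using assms z by (simp add: ennreal_less_iff pos_less_divide_eq)
    next
      case False
      then show ?thesis by (simp add: ennreal_neg)
    qed
  qed
qed (use assms in \<open>auto simp: ennreal_mult_top\<close>)

locale fading = prob_space +
  fixes h G :: "nat \<Rightarrow> 'a \<Rightarrow> real" and GA gA \<theta>A :: real and k :: nat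
  assumes params: "0 < GA" "0 \<le> gA" "0 < \<theta>A" "\<theta>A * real k \<le> 2 * pi"
    and h_law: "\<And>n. distributed M lborel (h n) (exponential_density 1)"
    and G_law: "\<And>n. distr M borel (G n) = distr (measure_pmf (bf_gain_pmf GA gA \<theta>A k)) borel (\<lambda>g. g)"
    and indep: "indep_vars (\<lambda>_. borel) (case_sum h G) UNIV"
begin

sublocale W: nonneg_rv "fading_gain GA gA \<theta>A k" "\<lambda>p. fst p * snd p"
  by (rule fading_gain_nonneg_rv) (fact params)+

abbreviation "\<phi> \<equiv> W.laplace"

lemma gain_laplace_eq: "gain_laplace \<beta> GA gA \<theta>A \<alpha> s u k = \<phi> (s * \<beta> * u powr (- \<alpha>))"
  unfolding gain_laplace_def W.laplace_def by (simp add: fading_gain_def mult_ac)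

lemma h_meas [measurable]: "h n \<in> borel_measurable M"
  using distributed_measurable[OF h_law[of n]] by simp

lemma G_meas [measurable]: "G n \<in> borel_measurable M"
proof -
  have "case_sum h G (Inr n) \<in> borel_measurable M"
    using indep unfolding indep_vars_def by blast
  then show ?thesis by simp
qed

lemma AE_hG_nonneg: "AE w in M. \<forall>n. 0 \<le> h n w * G n w"
proof -
  have "AE w in M. 0 \<le> h n w" for n
  proof -
    have "AE x in distr M lborel (h n). 0 \<le> x"
      unfolding distributed_distr_eq_density[OF h_law]
      by (subst AE_density) (auto simp: exponential_density_def erlang_density_def)
    then show ?thesis by (subst (asm) AE_distr_iff) auto
  qed
  moreover have "AE w in M. 0 \<le> G n w" for n
  proof -
    have "AE x in distr M borel (G n). 0 \<le> x"
      unfolding G_law using set_bf_gain_pmf[OF params]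
      by (subst AE_distr_iff) (auto simp: AE_measure_pmf_iff)
    then show ?thesis by (subst (asm) AE_distr_iff) auto
  qed
  ultimately have "AE w in M. 0 \<le> h n w * G n w" for n
    by (rule AE_mp[OF AE_conjI]) (auto intro: mult_nonneg_nonneg)
  then show ?thesis
    by (simp add: AE_all_countable)
qed

text \<open>By independence the pair of fading and gain has the product law
  \<open>fading_gain\<close>; the two variables are exchanged for their laws one at a time.\<close>

lemma nn_integral_hG:
  assumes z: "0 \<le> z"
  shows "(\<integral>\<^sup>+w. ennreal (exp (- (z * (h n w * G n w)))) \<partial>M) = ennreal (\<phi> z)"
proof -
  let ?G = "measure_pmf (bf_gain_pmf GA gA \<theta>A k)"
  let ?f = "\<lambda>p. ennreal (exp (- (z * (fst p * snd p))))"
  have ind: "indep_var borel (h n) borel (G n)"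
    using indep_var_compose[OF indep_var_restrict[OF indep, of "{Inl n}" "{Inr n}"], of "\<lambda>f. f (Inl n)" borel "\<lambda>f. f (Inr n)" borel]
    by (simp add: comp_def)
  have "(\<integral>\<^sup>+w. ennreal (exp (- (z * (h n w * G n w)))) \<partial>M) = (\<integral>\<^sup>+w. \<integral>\<^sup>+w'. ennreal (exp (- (z * (h n w * G n w')))) \<partial>M \<partial>M)"
    using nn_integral_indep_var[OF ind, of ?f] by simp
  also have "\<dots> = (\<integral>\<^sup>+w. \<integral>\<^sup>+y. ennreal (exp (- (z * (h n w * y)))) \<partial>distr M borel (G n) \<partial>M)"
    by (simp add: nn_integral_distr)
  also have "\<dots> = (\<integral>\<^sup>+w. \<integral>\<^sup>+y. ennreal (exp (- (z * (h n w * y)))) \<partial>?G \<partial>M)"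
    by (simp add: G_law nn_integral_distr)
  also have "\<dots> = (\<integral>\<^sup>+x. \<integral>\<^sup>+y. ennreal (exp (- (z * (x * y)))) \<partial>?G \<partial>distr M lborel (h n))"
  proof -
    have "(\<lambda>p. ennreal (exp (- (z * (fst p * snd p))))) \<in> borel_measurable (lborel \<Otimes>\<^sub>M ?G)"
    proof -
      have [measurable]: "fst \<in> borel_measurable (lborel \<Otimes>\<^sub>M ?G)" "snd \<in> borel_measurable (lborel \<Otimes>\<^sub>M ?G)"
        by (rule measurable_compose[OF measurable_fst] measurable_compose[OF measurable_snd], simp)+
      show ?thesis by measurable
    qed
    from measure_pmf.borel_measurable_nn_integral_fst[OF this]
    have "(\<lambda>x. \<integral>\<^sup>+y. ennreal (exp (- (z * (x * y)))) \<partial>?G) \<in> borel_measurable borel" by simp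
    then show ?thesis by (subst nn_integral_distr) auto
  qed
  also have "\<dots> = (\<integral>\<^sup>+p. ?f p \<partial>fading_gain GA gA \<theta>A k)"
    unfolding distributed_distr_eq_density[OF h_law] fading_gain_def
    using measure_pmf.nn_integral_fst[of ?f "density lborel (exponential_density 1)" "bf_gain_pmf GA gA \<theta>A k"] W.W
    by (simp add: fading_gain_def)
  also have "\<dots> = ennreal (\<phi> z)"
    by (rule W.nn_integral_laplace[OF z])
  finally show ?thesis .
qed

text \<open>\<open>exp_minus\<close> turns partial sums into products of independent factors. The
  bound 1 dominates the limit whether or not the series converges, and a divergent series
  contributes 0.\<close>

lemma nn_integral_exp_minus_interference:
  assumes r: "\<And>m. 0 \<le> r m"
  shows "(\<integral>\<^sup>+w. ennreal (exp_minus (\<Sum>m. ennreal (h m w * G m w * r m))) \<partial>M) = ennreal (inf_prod (\<lambda>m. \<phi> (r m)))"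
proof -
  define V where "V m w = exp_minus (ennreal (h m w * G m w * r m))" for m w
  have [measurable]: "V m \<in> borel_measurable M" for m
    unfolding V_def by measurable
  have V01: "0 \<le> V m w" "V m w \<le> 1" for m w by (simp_all add: V_def)
  have V_int: "(\<integral>\<^sup>+w. ennreal (V m w) \<partial>M) = ennreal (\<phi> (r m))" for m
  proof -
    have "(\<integral>\<^sup>+w. ennreal (V m w) \<partial>M) = (\<integral>\<^sup>+w. ennreal (exp (- (r m * (h m w * G m w)))) \<partial>M)"
      using AE_hG_nonneg by (intro nn_integral_cong_AE) (auto elim!: eventually_mono simp: V_def r mult_ac)
    then show ?thesis using nn_integral_hG[OF r[of m], of m] by simp
  qed
  have ind: "indep_vars (\<lambda>_. borel) (\<lambda>m w. ennreal (V m w)) UNIV"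
  proof -
    \<comment> \<open>One block of coordinates per link: independence of all fadings and gains
      becomes independence of their products across links.\<close>
    have "indep_vars (\<lambda>m. PiM {Inl m, Inr m} (\<lambda>_. borel)) (\<lambda>m w. restrict (\<lambda>i. case_sum h G i w) {Inl m, Inr m}) UNIV"
      by (rule indep_vars_restrict[OF indep]) (auto simp: disjoint_family_on_def)
    from indep_vars_compose2[OF this, of "\<lambda>m f. ennreal (exp_minus (ennreal (f (Inl m) * f (Inr m) * r m)))" "\<lambda>_. borel"]
    show ?thesis by (simp add: V_def)
  qed
  have "(\<lambda>N. \<integral>\<^sup>+w. ennreal (\<Prod>m<N. V m w) \<partial>M) \<longlonglongrightarrow> (\<integral>\<^sup>+w. ennreal (exp_minus (\<Sum>m. ennreal (h m w * G m w * r m))) \<partial>M)"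
  proof (rule nn_integral_dominated_convergence[where w="\<lambda>_. 1"])
    show "AE w in M. ennreal (\<Prod>m<N. V m w) \<le> 1" for N
      by (auto intro!: prod_le_1 simp: V01)
    have "(\<Prod>m<N. V m w) = exp_minus (\<Sum>m<N. ennreal (h m w * G m w * r m))" for N w
      by (induction N) (simp_all add: V_def exp_minus_add)
    then show "AE w in M. (\<lambda>N. ennreal (\<Prod>m<N. V m w)) \<longlonglongrightarrow> ennreal (exp_minus (\<Sum>m. ennreal (h m w * G m w * r m)))"
      by (auto intro!: tendsto_ennrealI tendsto_exp_minus summable_LIMSEQ)
  qed (auto simp: emeasure_space_1)
  moreover have "(\<integral>\<^sup>+w. ennreal (\<Prod>m<N. V m w) \<partial>M) = ennreal (\<Prod>m<N. \<phi> (r m))" for N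
  proof -
    have "(\<integral>\<^sup>+w. ennreal (\<Prod>m<N. V m w) \<partial>M) = (\<integral>\<^sup>+w. (\<Prod>m<N. ennreal (V m w)) \<partial>M)"
      by (simp add: prod_ennreal V01)
    also have "\<dots> = (\<Prod>m<N. \<integral>\<^sup>+w. ennreal (V m w) \<partial>M)"
      by (intro indep_vars_nn_integral indep_vars_subset[OF ind]) auto
    also have "\<dots> = ennreal (\<Prod>m<N. \<phi> (r m))"
      by (simp add: V_int prod_ennreal less_imp_le[OF W.laplace_pos] r)
    finally show ?thesis .
  qed
  moreover have "(\<lambda>N. ennreal (\<Prod>m<N. \<phi> (r m))) \<longlonglongrightarrow> ennreal (inf_prod (\<lambda>m. \<phi> (r m)))"
    by (intro tendsto_ennrealI inf_prod_LIMSEQ) (auto simp: less_imp_le[OF W.laplace_pos] W.laplace_le_1 r)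
  ultimately show ?thesis
    by (simp only: LIMSEQ_unique)
qed

text \<open>Given the independent threshold \<open>U\<close>, the exponential tail is exp (- U); an
  infinite threshold is never exceeded, in accordance with \<open>exp_minus \<top>\<close> being
  0.\<close>

lemma prob_exponential_gt:
  fixes U :: "'a \<Rightarrow> ennreal"
  assumes ind: "indep_var borel U borel (\<lambda>w. ennreal (h n w))"
  shows "emeasure M {w \<in> space M. U w < ennreal (h n w)} = (\<integral>\<^sup>+w. ennreal (exp_minus (U w)) \<partial>M)"
proof -
  have [measurable]: "U \<in> borel_measurable M" using indep_var_rv1[OF ind] by simp
  have E: "(\<integral>\<^sup>+w. indicator {p. fst p < snd p} (f w, ennreal (g w)) \<partial>M) = emeasure M {w \<in> space M. f w < ennreal (g w)}"
    if [measurable]: "f \<in> borel_measurable M" "g \<in> borel_measurable M" for f :: "'a \<Rightarrow> ennreal" and g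
  proof -
    have "(\<integral>\<^sup>+w. indicator {p. fst p < snd p} (f w, ennreal (g w)) \<partial>M) = (\<integral>\<^sup>+w. indicator {w \<in> space M. f w < ennreal (g w)} w \<partial>M)"
      by (intro nn_integral_cong) (simp add: indicator_def)
    then show ?thesis by simp
  qed
  have "emeasure M {w \<in> space M. U w < ennreal (h n w)} = (\<integral>\<^sup>+w. indicator {p. fst p < snd p} (U w, ennreal (h n w)) \<partial>M)"
    by (rule E[symmetric]) measurable
  also have "\<dots> = (\<integral>\<^sup>+w. \<integral>\<^sup>+w'. indicator {p. fst p < snd p} (U w, ennreal (h n w')) \<partial>M \<partial>M)"
    by (rule nn_integral_indep_var[OF ind, where f="indicator {p. fst p < snd p}"]) measurable
  also have "\<dots> = (\<integral>\<^sup>+w. ennreal (exp_minus (U w)) \<partial>M)"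
  proof (rule nn_integral_cong)
    fix w
    have "(\<integral>\<^sup>+w'. indicator {p. fst p < snd p} (U w, ennreal (h n w')) \<partial>M) = emeasure M {w' \<in> space M. U w < ennreal (h n w')}"
      by (rule E) measurable
    also have "\<dots> = ennreal (exp_minus (U w))"
    proof (cases "U w")
      case (real r)
      then have "{w' \<in> space M. U w < ennreal (h n w')} = {w' \<in> space M. r < h n w'}"
        by (simp add: ennreal_less_iff)
      then show ?thesis
        using exponential_distributedD_gt[OF h_law[of n] real(1)] real by (simp add: emeasure_eq_measure)
    qed simp
    finally show "(\<integral>\<^sup>+w'. indicator {p. fst p < snd p} (U w, ennreal (h n w')) \<partial>M) = ennreal (exp_minus (U w))" .
  qed
  finally show ?thesis .
qed

text \<open>The SINR exceeds \<tau> iff \<open>h n\<close> exceeds c times noise plus interference,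
  so the exponential tail makes each of them a factor. The constant
  \<open>\<phi> (\<tau> / GA\<^sup>2)\<close> is \<phi> (c * l n), the factor missing from the
  product over the interferers.\<close>

lemma prob_covered_given_links:
  assumes "0 < \<tau>" and l: "\<And>m. 0 \<le> l m" and n: "0 < l n" and "0 \<le> N0"
  defines "c \<equiv> \<tau> / (GA\<^sup>2 * l n)"
  shows "ennreal (\<phi> (\<tau> / GA\<^sup>2)) * emeasure M {w \<in> space M. ennreal \<tau> < ennreal (h n w * GA\<^sup>2 * l n) /
      (ennreal N0 + (\<Sum>m. if m = n then 0 else ennreal (h m w * G m w * l m)))} =
    ennreal (exp (- (c * N0)) * inf_prod (\<lambda>m. \<phi> (c * l m)))"
proof -
  have GA: "0 < GA" by (rule params)
  have c: "0 < c" using \<open>0 < \<tau>\<close> n GA by (simp add: c_def)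
  \<comment> \<open>The serving index stays in the sum with coefficient 0; since \<phi> 0 = 1, this
    is neutral in the product.\<close>
  define a where "a m = (if m = n then 0 else c * l m)" for m
  have a: "0 \<le> a m" for m using c l by (simp add: a_def)
  define U where "U w = ennreal (c * N0) + (\<Sum>m. ennreal (h m w * G m w * a m))" for w
  have U_eq: "ennreal c * (ennreal N0 + (\<Sum>m. if m = n then 0 else ennreal (h m w * G m w * l m))) = U w" for w
  proof -
    have "ennreal c * (if m = n then 0 else ennreal (h m w * G m w * l m)) = ennreal (h m w * G m w * a m)" for m
      using c by (simp add: a_def mult_ac flip: ennreal_mult')
    then show ?thesis
      using c \<open>0 \<le> N0\<close> by (simp add: U_def distrib_left ennreal_mult' flip: ennreal_suminf_cmult)
  qed
  have event: "ennreal \<tau> < ennreal (h n w * GA\<^sup>2 * l n) / Z \<longleftrightarrow> ennreal c * Z < ennreal (h n w)" for w Z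
  proof -
    have "ennreal \<tau> < ennreal (h n w * GA\<^sup>2 * l n) / Z \<longleftrightarrow> ennreal (GA\<^sup>2 * l n) * (ennreal c * Z) < ennreal (GA\<^sup>2 * l n) * ennreal (h n w)"
    proof -
      have "ennreal (GA\<^sup>2 * l n) * ennreal c = ennreal \<tau>"
        using c n GA by (subst ennreal_mult[symmetric]) (auto simp: c_def)
      moreover have "ennreal (GA\<^sup>2 * l n) * ennreal (h n w) = ennreal (h n w * GA\<^sup>2 * l n)"
        using n by (subst ennreal_mult'[symmetric]) (auto simp: mult_ac)
      ultimately show ?thesis
        using ennreal_less_divide_iff[OF \<open>0 < \<tau>\<close>] by (simp add: mult.assoc[symmetric])
    qed
    also have "\<dots> \<longleftrightarrow> ennreal c * Z < ennreal (h n w)"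
      using n GA ennreal_mult_le_mult_iff[of "ennreal (GA\<^sup>2 * l n)" "ennreal (h n w)" "ennreal c * Z"]
      by (simp add: not_le[symmetric])
    finally show ?thesis .
  qed
  have "indep_var borel U borel (\<lambda>w. ennreal (h n w))"
  proof -
    have "indep_var (PiM (UNIV - {Inl n}) (\<lambda>_. borel)) (\<lambda>w. restrict (\<lambda>i. case_sum h G i w) (UNIV - {Inl n}))
      (PiM {Inl n} (\<lambda>_. borel)) (\<lambda>w. restrict (\<lambda>i. case_sum h G i w) {Inl n})"
      by (rule indep_var_restrict[OF indep]) auto
    \<comment> \<open>The case distinction keeps the functional from reading f (Inl n), a coordinate
      outside the index set; a n = 0 alone would not.\<close>
    moreover have "(\<lambda>f. ennreal (c * N0) + (\<Sum>m. if m = n then 0 else ennreal (f (Inl m) * f (Inr m) * a m))) \<in>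
        borel_measurable (PiM (UNIV - {Inl n}) (\<lambda>_. borel))"
    proof -
      have [measurable]: "(\<lambda>f. if m = n then 0 else ennreal (f (Inl m) * f (Inr m) * a m)) \<in> borel_measurable (PiM (UNIV - {Inl n}) (\<lambda>_. borel))" for m
        by (cases "m = n") auto
      show ?thesis by (intro borel_measurable_add borel_measurable_const borel_measurable_suminf_order) measurable
    qed
    moreover have "(\<lambda>f. ennreal (f (Inl n))) \<in> borel_measurable (PiM {Inl n :: nat + nat} (\<lambda>_. borel))" by measurable
    ultimately have "indep_var borel ((\<lambda>f. ennreal (c * N0) + (\<Sum>m. if m = n then 0 else ennreal (f (Inl m) * f (Inr m) * a m))) \<circ> (\<lambda>w. restrict (\<lambda>i. case_sum h G i w) (UNIV - {Inl n})))
      borel ((\<lambda>f. ennreal (f (Inl n))) \<circ> (\<lambda>w. restrict (\<lambda>i. case_sum h G i w) {Inl n}))"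
      by (rule indep_var_compose)
    moreover have "(\<lambda>f. ennreal (c * N0) + (\<Sum>m. if m = n then 0 else ennreal (f (Inl m) * f (Inr m) * a m))) \<circ> (\<lambda>w. restrict (\<lambda>i. case_sum h G i w) (UNIV - {Inl n})) = U"
      by (rule ext) (auto simp: U_def a_def intro!: suminf_cong arg_cong2[where f="(+)"])
    moreover have "(\<lambda>f. ennreal (f (Inl n))) \<circ> (\<lambda>w. restrict (\<lambda>i. case_sum h G i w) {Inl n}) = (\<lambda>w. ennreal (h n w))"
      by (rule ext) simp
    ultimately show ?thesis by (simp only:)
  qed
  then have "emeasure M {w \<in> space M. ennreal \<tau> < ennreal (h n w * GA\<^sup>2 * l n) /
      (ennreal N0 + (\<Sum>m. if m = n then 0 else ennreal (h m w * G m w * l m)))} = (\<integral>\<^sup>+w. ennreal (exp_minus (U w)) \<partial>M)"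
    unfolding event U_eq by (rule prob_exponential_gt)
  also have "\<dots> = (\<integral>\<^sup>+w. ennreal (exp (- (c * N0))) * ennreal (exp_minus (\<Sum>m. ennreal (h m w * G m w * a m))) \<partial>M)"
  proof -
    have "exp_minus (ennreal (c * N0)) = exp (- (c * N0))"
      using c \<open>0 \<le> N0\<close> by (intro exp_minus_ennreal) auto
    then show ?thesis by (simp only: U_def exp_minus_add ennreal_mult exp_minus_nonneg exp_ge_zero)
  qed
  also have "\<dots> = ennreal (exp (- (c * N0))) * (\<integral>\<^sup>+w. ennreal (exp_minus (\<Sum>m. ennreal (h m w * G m w * a m))) \<partial>M)"
    by (rule nn_integral_cmult) measurable
  also have "\<dots> = ennreal (exp (- (c * N0))) * ennreal (inf_prod (\<lambda>m. \<phi> (a m)))"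
    by (simp add: nn_integral_exp_minus_interference a)
  also have "ennreal (\<phi> (\<tau> / GA\<^sup>2)) * \<dots> = ennreal (exp (- (c * N0)) * (\<phi> (\<tau> / GA\<^sup>2) * inf_prod (\<lambda>m. \<phi> (a m))))"
    using \<open>0 < \<tau>\<close> W.laplace_pos[of "\<tau> / GA\<^sup>2"]
    by (simp add: ennreal_mult' ennreal_mult'' less_imp_le mult_ac)
  also have "\<phi> (\<tau> / GA\<^sup>2) * inf_prod (\<lambda>m. \<phi> (a m)) = inf_prod (\<lambda>m. \<phi> (c * l m))"
  proof -
    have "(\<lambda>m. \<phi> (a m)) = (\<lambda>m. \<phi> (c * l m))(n := 1)" by (auto simp: a_def)
    moreover have "\<phi> (c * l n) = \<phi> (\<tau> / GA\<^sup>2)" using n by (simp add: c_def)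
    moreover have "\<phi> (c * l n) * inf_prod ((\<lambda>m. \<phi> (c * l m))(n := 1)) = inf_prod (\<lambda>m. \<phi> (c * l m))"
      by (rule inf_prod_factor) (use c l W.laplace_pos W.laplace_le_1 in \<open>auto simp: less_imp_le\<close>)
    ultimately show ?thesis by simp
  qed
  finally show ?thesis .
qed

end

section \<open>Coverage probability\<close>

lemma path_gain_eq: "path_gain \<beta> \<alpha>L \<alpha>N los r = \<beta> / r powr (if los then \<alpha>L else \<alpha>N)"
  by (simp add: path_gain_def powr_minus divide_inverse)

lemma measurable_path_gain:
  fixes x :: "'b \<Rightarrow> 'a::euclidean_space"
  assumes [measurable]: "x \<in> borel_measurable N" "los \<in> N \<rightarrow>\<^sub>M count_space UNIV"
  shows "(\<lambda>q. path_gain \<beta> \<alpha>L \<alpha>N (los q) (norm (x q))) \<in> borel_measurable N"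
  unfolding path_gain_def by measurable

lemma measurable_serving:
  fixes x :: "nat \<Rightarrow> 'b \<Rightarrow> 'a::euclidean_space"
  assumes [measurable]: "\<And>n. x n \<in> borel_measurable N" "\<And>n. los n \<in> N \<rightarrow>\<^sub>M count_space UNIV"
  shows "(\<lambda>q. serving \<beta> \<alpha>L \<alpha>N (\<lambda>n. x n q) (\<lambda>n. los n q)) \<in> N \<rightarrow>\<^sub>M count_space UNIV"
proof -
  note [measurable] = measurable_path_gain
  show ?thesis unfolding serving_def by measurable
qed

lemma measurable_SINR:
  fixes x :: "nat \<Rightarrow> 'b \<Rightarrow> 'a::euclidean_space"
  assumes [measurable]: "\<And>n. x n \<in> borel_measurable N" "\<And>n. los n \<in> N \<rightarrow>\<^sub>M count_space UNIV"
    "\<And>n. h n \<in> borel_measurable N" "\<And>n. G n \<in> borel_measurable N"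
  shows "(\<lambda>q. SINR \<beta> \<alpha>L \<alpha>N GA \<sigma> (\<lambda>n. x n q) (\<lambda>n. los n q) (\<lambda>n. h n q) (\<lambda>n. G n q)) \<in> borel_measurable N"
proof -
  note [measurable] = measurable_path_gain measurable_serving
  have [measurable]: "(\<lambda>q. interference \<beta> \<alpha>L \<alpha>N (\<lambda>n. x n q) (\<lambda>n. los n q) (\<lambda>n. h n q) (\<lambda>n. G n q)) \<in> borel_measurable N"
    unfolding interference_def by measurable
  have [measurable]: "(\<lambda>q. h (serving \<beta> \<alpha>L \<alpha>N (\<lambda>n. x n q) (\<lambda>n. los n q)) q * GA\<^sup>2 *
      path_gain \<beta> \<alpha>L \<alpha>N (los (serving \<beta> \<alpha>L \<alpha>N (\<lambda>n. x n q) (\<lambda>n. los n q)) q) (norm (x (serving \<beta> \<alpha>L \<alpha>N (\<lambda>n. x n q) (\<lambda>n. los n q)) q))) \<in> borel_measurable N"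
    by (rule measurable_compose_countable[where f="\<lambda>n q. h n q * GA\<^sup>2 * path_gain \<beta> \<alpha>L \<alpha>N (los n q) (norm (x n q))" and g="\<lambda>q. serving \<beta> \<alpha>L \<alpha>N (\<lambda>n. x n q) (\<lambda>n. los n q)"]) measurable
  show ?thesis unfolding SINR_def Let_def by measurable
qed

text \<open>Since \<open>0 powr a = 0\<close>, a point at the origin would have path gain 0 and
  equivalent distance 0 at once, so that maximal gain would not mean minimal distance. A single
  location has Lebesgue measure 0, so its count is almost surely 0.\<close>

lemma ppp_AE_not_0:
  assumes M: "prob_space M" and ppp: "homogeneous_ppp M \<Lambda> \<Phi>"
  shows "AE w in M. 0 \<notin> \<Phi> w"
proof -
  interpret prob_space M by fact
  have "measure M {w \<in> space M. card (\<Phi> w \<inter> {0}) = 0} = 1"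
    using homogeneous_pppD(3)[OF ppp, of "{0}" 0] by simp
  moreover have "{w \<in> space M. card (\<Phi> w \<inter> {0}) = 0} \<in> events"
  proof -
    have "(\<lambda>w. card (\<Phi> w \<inter> {0})) -` {0} \<inter> space M \<in> events"
      by (rule measurable_sets[OF homogeneous_pppD(2)[OF ppp]]) auto
    also have "(\<lambda>w. card (\<Phi> w \<inter> {0})) -` {0} \<inter> space M = {w \<in> space M. card (\<Phi> w \<inter> {0}) = 0}"
      by auto
    finally show ?thesis .
  qed
  ultimately have "AE w in M. w \<in> {w \<in> space M. card (\<Phi> w \<inter> {0}) = 0}"
    by (simp add: prob_eq_1)
  then show ?thesis
    by eventually_elim auto
qed

text \<open>Local finiteness leaves finitely many points whose equivalent distance is at most that
  of point 0. Hence the minimum is attained and the \<open>LEAST\<close> in \<open>serving\<close>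
  picks a minimiser.\<close>

lemma serving_nearest:
  fixes x :: "nat \<Rightarrow> 'a::euclidean_space" and los :: "nat \<Rightarrow> bool"
  assumes "0 < \<beta>" "0 < \<alpha>L" "0 < \<alpha>N" and fin: "\<And>r. finite {n. norm (x n) \<le> r}" and nz: "\<And>n. x n \<noteq> 0"
  defines "y \<equiv> \<lambda>n. norm (x n) powr (if los n then \<alpha>L else \<alpha>N)"
  shows "(INF m. y m) = y (serving \<beta> \<alpha>L \<alpha>N x los)"
proof -
  have y: "0 < y n" for n using nz by (simp add: y_def)
  \<comment> \<open>Points of both types have to be caught, so the radius allows for either
    exponent.\<close>
  define r where "r = max (y 0 powr (1 / \<alpha>L)) (y 0 powr (1 / \<alpha>N))"
  have "{n. y n \<le> y 0} \<subseteq> {n. norm (x n) \<le> r}"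
  proof safe
    fix n assume "y n \<le> y 0"
    have *: "norm (x n) \<le> y 0 powr (1 / a)" if "norm (x n) powr a \<le> y 0" "0 < a" for a
    proof -
      have "norm (x n) = (norm (x n) powr a) powr (1 / a)" using that by (simp add: powr_powr)
      also have "\<dots> \<le> y 0 powr (1 / a)" using that by (intro powr_mono2) auto
      finally show ?thesis .
    qed
    show "norm (x n) \<le> r"
      using \<open>y n \<le> y 0\<close> *[of \<alpha>L] *[of \<alpha>N] assms(2,3) by (auto simp: y_def r_def le_max_iff_disj split: if_splits)
  qed
  then have fin0: "finite {n. y n \<le> y 0}" by (rule finite_subset) (rule fin)
  obtain n where n: "y n \<le> y 0" "\<And>m. y m \<le> y 0 \<Longrightarrow> y n \<le> y m"
  proof -
    have "Min (y ` {n. y n \<le> y 0}) \<in> y ` {n. y n \<le> y 0}"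
      using fin0 by (intro Min_in) auto
    then obtain n where "n \<in> {n. y n \<le> y 0}" "Min (y ` {n. y n \<le> y 0}) = y n" by auto
    then show ?thesis using that[of n] fin0 Min_le[of "y ` {n. y n \<le> y 0}"] by auto
  qed
  have min: "y n \<le> y m" for m using n(1) n(2)[of m] by (cases "y m \<le> y 0") auto
  have le: "path_gain \<beta> \<alpha>L \<alpha>N (los m) (norm (x m)) \<le> path_gain \<beta> \<alpha>L \<alpha>N (los i) (norm (x i)) \<longleftrightarrow> y i \<le> y m" for m i
  proof -
    have g: "path_gain \<beta> \<alpha>L \<alpha>N (los m) (norm (x m)) = \<beta> / y m" for m by (simp add: path_gain_eq y_def)
    show ?thesis unfolding g using y[of m] y[of i] \<open>0 < \<beta>\<close> by (simp add: field_simps)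
  qed
  have "y (serving \<beta> \<alpha>L \<alpha>N x los) \<le> y m" for m
    unfolding serving_def le using LeastI[of "\<lambda>n. \<forall>m. y n \<le> y m" n] min by blast
  then show ?thesis
    using y by (intro antisym cINF_lower cINF_greatest) (auto intro!: bdd_belowI[of _ 0] less_imp_le)
qed

text \<open>Below r the indicator removes f and the full intensity remains, which is the exponent of
  \<open>void_prob\<close>; above r the intensity is weighted by 1 - f, the Laplace
  exponent.\<close>

lemma exp_minus_link_split:
  assumes P [measurable]: "P \<in> borel_measurable borel" and P01: "\<And>v. 0 \<le> v \<Longrightarrow> 0 \<le> P v \<and> P v \<le> 1"
    and f [measurable]: "f \<in> borel_measurable borel" and f1: "\<And>v. 0 \<le> v \<Longrightarrow> f v \<le> 1"
    and "0 \<le> \<Lambda>" "0 \<le> r"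
  shows "exp_minus (\<integral>\<^sup>+v. ennreal (2 * pi * \<Lambda> * v) * ennreal (P v) * ennreal (1 - indicator {r..} v * f v) \<partial>lborel) =
    void_prob \<Lambda> P r * exp_minus (ennreal (2 * pi * \<Lambda>) * (\<integral>\<^sup>+v\<in>{r..}. ennreal ((1 - f v) * P v * v) \<partial>lborel))"
proof -
  let ?c = "2 * pi * \<Lambda>"
  have c: "0 \<le> ?c" using \<open>0 \<le> \<Lambda>\<close> by simp
  have "(\<integral>\<^sup>+v. ennreal (?c * v) * ennreal (P v) * ennreal (1 - indicator {r..} v * f v) \<partial>lborel) =
    (\<integral>\<^sup>+v. ennreal ?c * (ennreal (indicator {0..r} v * (P v * v)) + ennreal ((1 - f v) * P v * v) * indicator {r..} v) \<partial>lborel)"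
  proof (rule nn_integral_cong_AE)
    \<comment> \<open>At v = r both indicators on the right are 1, so the pointwise identity is
      claimed off this null set.\<close>
    have "AE v in lborel. v \<noteq> r" by (rule AE_lborel_singleton)
    then show "AE v in lborel. ennreal (?c * v) * ennreal (P v) * ennreal (1 - indicator {r..} v * f v) =
      ennreal ?c * (ennreal (indicator {0..r} v * (P v * v)) + ennreal ((1 - f v) * P v * v) * indicator {r..} v)"
    proof eventually_elim
      case (elim v)
      consider "v < 0" | "0 \<le> v" "v < r" | "r < v" using elim by linarith
      then show ?case
      proof cases
        case 1
        then have "?c * v \<le> 0" using c by (auto simp: mult_nonneg_nonpos)
        then show ?thesis using 1 \<open>0 \<le> r\<close> by (simp add: ennreal_neg)
      next
        case 2
        then have "ennreal (P v * v) = ennreal (P v) * ennreal v" "ennreal (?c * v) = ennreal ?c * ennreal v"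
          using c P01[of v] by (simp_all add: ennreal_mult)
        then show ?thesis using 2 by (simp add: mult_ac)
      next
        case 3
        then have "0 \<le> v" using \<open>0 \<le> r\<close> by simp
        then have "ennreal ((1 - f v) * P v * v) = ennreal (1 - f v) * ennreal (P v) * ennreal v" "ennreal (?c * v) = ennreal ?c * ennreal v"
          using c P01[of v] f1[of v] by (simp_all add: ennreal_mult)
        then show ?thesis using 3 by (simp add: mult_ac)
      qed
    qed
  qed
  also have "\<dots> = ennreal ?c * (\<integral>\<^sup>+v. ennreal (indicator {0..r} v * (P v * v)) + ennreal ((1 - f v) * P v * v) * indicator {r..} v \<partial>lborel)"
    by (rule nn_integral_cmult) measurable
  also have "\<dots> = ennreal ?c * (\<integral>\<^sup>+v. ennreal (indicator {0..r} v * (P v * v)) \<partial>lborel) + ennreal ?c * (\<integral>\<^sup>+v\<in>{r..}. ennreal ((1 - f v) * P v * v) \<partial>lborel)"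
    by (subst nn_integral_add) (auto simp: distrib_left)
  also have "(\<integral>\<^sup>+v. ennreal (indicator {0..r} v * (P v * v)) \<partial>lborel) = ennreal (LBINT v:{0..r}. P v * v)"
    unfolding set_lebesgue_integral_def real_scaleR_def
  proof (rule nn_integral_eq_integral)
    show "integrable lborel (\<lambda>v. indicator {0..r} v * (P v * v))"
    proof (rule Bochner_Integration.integrable_bound)
      show "integrable lborel (\<lambda>v. r * indicator {0..r} v)"
        by (intro integrable_mult_right integrable_real_indicator) (auto simp: \<open>0 \<le> r\<close>)
      have "\<bar>P v * v\<bar> \<le> \<bar>r\<bar>" if "0 \<le> v" "v \<le> r" for v
        using P01[OF that(1)] that mult_le_one[of "P v" 1] mult_mono[of "P v" 1 v r] by (simp add: abs_mult)
      then show "AE v in lborel. norm (indicator {0..r} v * (P v * v)) \<le> norm (r * indicator {0..r} v)"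
        by (intro AE_I2) (auto simp: indicator_def)
    qed measurable
    show "AE v in lborel. 0 \<le> indicator {0..r} v * (P v * v)"
      using P01 by (intro AE_I2) (auto simp: indicator_def)
  qed
  also have "ennreal ?c * ennreal (LBINT v:{0..r}. P v * v) = ennreal (?c * (LBINT v:{0..r}. P v * v))"
    using c by (simp add: ennreal_mult')
  finally have eq: "(\<integral>\<^sup>+v. ennreal (?c * v) * ennreal (P v) * ennreal (1 - indicator {r..} v * f v) \<partial>lborel) =
    ennreal (?c * (LBINT v:{0..r}. P v * v)) + ennreal ?c * (\<integral>\<^sup>+v\<in>{r..}. ennreal ((1 - f v) * P v * v) \<partial>lborel)" .
  have "0 \<le> (LBINT v:{0..r}. P v * v)"
    unfolding set_lebesgue_integral_def using P01 by (intro integral_nonneg_AE AE_I2) (auto simp: indicator_def)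
  then have "exp_minus (ennreal (?c * (LBINT v:{0..r}. P v * v))) = void_prob \<Lambda> P r"
    using c by (subst exp_minus_ennreal) (auto simp: void_prob_def)
  then show ?thesis unfolding eq exp_minus_add by simp
qed

text \<open>A link of the other type has the gain of the serving link at length u powr (\<alpha> b /
  \<alpha> (\<not> b)), hence this second threshold. Emptiness below the two thresholds gives the
  void probabilities, the points beyond them give the two Laplace factors.\<close>

lemma (in fading) exp_minus_link_laplace:
  fixes \<alpha> :: "bool \<Rightarrow> real" and P :: "bool \<Rightarrow> real \<Rightarrow> real" and b :: bool
  assumes P [measurable]: "\<And>b. P b \<in> borel_measurable borel" and P01: "\<And>b v. 0 \<le> v \<Longrightarrow> 0 \<le> P b v \<and> P b v \<le> 1"
    and "0 \<le> \<Lambda>" "0 < \<beta>" "0 < \<tau>" and \<alpha>: "\<And>b. 0 < \<alpha> b" and "0 < u"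
  defines "s \<equiv> u powr \<alpha> b"
  shows "exp_minus (\<integral>\<^sup>+p. ennreal (1 - indicator {s..} (snd p powr \<alpha> (fst p)) * \<phi> (\<tau> / GA\<^sup>2 * (s / snd p powr \<alpha> (fst p)))) \<partial>link_measure \<Lambda> P) =
    void_prob \<Lambda> (P b) u * void_prob \<Lambda> (P (\<not> b)) (u powr (\<alpha> b / \<alpha> (\<not> b))) *
    interference_laplace \<Lambda> \<beta> GA gA \<theta>A (\<alpha> b) (P b) (\<alpha> (\<not> b)) (P (\<not> b)) (s * \<tau> / (GA\<^sup>2 * \<beta>)) u k"
proof -
  define s' where "s' = s * \<tau> / (GA\<^sup>2 * \<beta>)"
  have GA: "0 < GA" by (rule params)
  have s: "0 < s" using \<open>0 < u\<close> by (simp add: s_def)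
  \<comment> \<open>\<beta> cancels: s' * \<beta> / v powr a is \<open>\<tau> / GA\<^sup>2\<close>
    times the ratio of the equivalent distances s and v powr a.\<close>
  have gl: "gain_laplace \<beta> GA gA \<theta>A a s' v k = \<phi> (\<tau> / GA\<^sup>2 * (s / v powr a))" for a v
    using \<open>0 < \<beta>\<close> GA by (simp add: gain_laplace_eq s'_def powr_minus field_simps)
  have [measurable]: "(\<lambda>v. gain_laplace \<beta> GA gA \<theta>A a s' v k) \<in> borel_measurable borel" for a
    unfolding gl by measurable
  have by_type: "exp_minus (\<integral>\<^sup>+v. ennreal (2 * pi * \<Lambda> * v) * ennreal (P b' v) *
        ennreal (1 - indicator {s..} (v powr \<alpha> b') * \<phi> (\<tau> / GA\<^sup>2 * (s / v powr \<alpha> b'))) \<partial>lborel) =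
      void_prob \<Lambda> (P b') (u powr (\<alpha> b / \<alpha> b')) *
      exp_minus (ennreal (2 * pi * \<Lambda>) * (\<integral>\<^sup>+v\<in>{u powr (\<alpha> b / \<alpha> b')..}. ennreal ((1 - gain_laplace \<beta> GA gA \<theta>A (\<alpha> b') s' v k) * P b' v * v) \<partial>lborel))" for b'
  proof -
    have eq: "(\<integral>\<^sup>+v. ennreal (2 * pi * \<Lambda> * v) * ennreal (P b' v) * ennreal (1 - indicator {s..} (v powr \<alpha> b') * \<phi> (\<tau> / GA\<^sup>2 * (s / v powr \<alpha> b'))) \<partial>lborel) =
      (\<integral>\<^sup>+v. ennreal (2 * pi * \<Lambda> * v) * ennreal (P b' v) * ennreal (1 - indicator {u powr (\<alpha> b / \<alpha> b')..} v * gain_laplace \<beta> GA gA \<theta>A (\<alpha> b') s' v k) \<partial>lborel)"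
    proof (rule nn_integral_cong)
      fix v :: real
      show "ennreal (2 * pi * \<Lambda> * v) * ennreal (P b' v) * ennreal (1 - indicator {s..} (v powr \<alpha> b') * \<phi> (\<tau> / GA\<^sup>2 * (s / v powr \<alpha> b'))) =
        ennreal (2 * pi * \<Lambda> * v) * ennreal (P b' v) * ennreal (1 - indicator {u powr (\<alpha> b / \<alpha> b')..} v * gain_laplace \<beta> GA gA \<theta>A (\<alpha> b') s' v k)"
      proof (cases "0 \<le> v")
        case True
        have "s = (u powr (\<alpha> b / \<alpha> b')) powr \<alpha> b'"
          using \<alpha>[of b'] by (simp add: s_def powr_powr)
        then have "s \<le> v powr \<alpha> b' \<longleftrightarrow> u powr (\<alpha> b / \<alpha> b') \<le> v"
          using \<alpha>[of b'] True powr_less_mono2[of "\<alpha> b'" v "u powr (\<alpha> b / \<alpha> b')"] powr_mono2[of "\<alpha> b'" "u powr (\<alpha> b / \<alpha> b')" v]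
          by (cases "u powr (\<alpha> b / \<alpha> b') \<le> v") (simp_all add: less_imp_le not_le)
        then show ?thesis by (simp add: gl indicator_def)
      next
        case False
        then have "2 * pi * \<Lambda> * v \<le> 0" using \<open>0 \<le> \<Lambda>\<close> by (auto simp: mult_nonneg_nonpos)
        then show ?thesis by (simp add: ennreal_neg)
      qed
    qed
    show ?thesis
      unfolding eq
      by (rule exp_minus_link_split)
         (use P01 \<open>0 \<le> \<Lambda>\<close> \<open>0 < \<tau>\<close> s in \<open>auto simp: gl intro!: W.laplace_le_1 divide_nonneg_nonneg mult_nonneg_nonneg\<close>)
  qed
  have self: "u powr (\<alpha> b / \<alpha> b) = u"  using \<alpha>[of b] \<open>0 < u\<close> by simp
  have both: "(\<integral>\<^sup>+p. ennreal (1 - indicator {s..} (snd p powr \<alpha> (fst p)) * \<phi> (\<tau> / GA\<^sup>2 * (s / snd p powr \<alpha> (fst p)))) \<partial>link_measure \<Lambda> P) =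
    (\<integral>\<^sup>+v. ennreal (2 * pi * \<Lambda> * v) * ennreal (P True v) * ennreal (1 - indicator {s..} (v powr \<alpha> True) * \<phi> (\<tau> / GA\<^sup>2 * (s / v powr \<alpha> True))) \<partial>lborel) +
    (\<integral>\<^sup>+v. ennreal (2 * pi * \<Lambda> * v) * ennreal (P False v) * ennreal (1 - indicator {s..} (v powr \<alpha> False) * \<phi> (\<tau> / GA\<^sup>2 * (s / v powr \<alpha> False))) \<partial>lborel)"
    by (rule nn_integral_link_measure[where f="\<lambda>b v. ennreal (1 - indicator {s..} (v powr \<alpha> b) * \<phi> (\<tau> / GA\<^sup>2 * (s / v powr \<alpha> b)))"]) measurable
  show ?thesis
    unfolding both exp_minus_add by_type interference_laplace_def s'_def[symmetric]
    using self by (cases b) (simp_all add: mult_ac)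
qed

theorem theorem2:
  fixes M :: "'w measure"
    and \<Phi> :: "'w \<Rightarrow> (real^2) set"
    and X :: "nat \<Rightarrow> 'w \<Rightarrow> real^2"
    and L :: "nat \<Rightarrow> 'w \<Rightarrow> bool"
    and h G :: "nat \<Rightarrow> 'w \<Rightarrow> real"
    and PL PN :: "real \<Rightarrow> real"
    and \<Lambda>0 \<beta> \<alpha>L \<alpha>N GA gA \<theta>A \<sigma> \<tau> :: real
    and k :: nat
  assumes "prob_space M"
    and "0 < \<Lambda>0" and "0 < \<beta>" and "0 < \<alpha>L" and "0 < \<alpha>N"
    and "0 < GA" and "0 \<le> gA"
    and "0 < k" and "0 < \<theta>A" and "\<theta>A * real k \<le> 2 * pi"
    and "PL \<in> borel_measurable borel"
    and "\<And>r. 0 \<le> r \<Longrightarrow> 0 \<le> PL r \<and> PL r \<le> 1"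
    and "\<And>r. PN r = 1 - PL r"
    and "homogeneous_ppp M \<Lambda>0 \<Phi>"
    and "\<And>n. X n \<in> borel_measurable M"
    and "AE w in M. bij_betw (\<lambda>n. X n w) UNIV (\<Phi> w)"
    and "los_states M PL X L"
    and "\<And>n. distributed M lborel (h n) (exponential_density 1)"
    and "\<And>n. distr M borel (G n) = distr (measure_pmf (bf_gain_pmf GA gA \<theta>A k)) borel (\<lambda>g. g)"
    and "prob_space.indep_vars M (\<lambda>_. borel) (case_sum h G) UNIV"
    and "prob_space.indep_set M
           (sets (vimage_algebra (space M) (\<lambda>w n. (X n w, L n w))
              (\<Pi>\<^sub>M n\<in>UNIV. borel \<Otimes>\<^sub>M count_space UNIV)))
           (sets (vimage_algebra (space M) (\<lambda>w n. (h n w, G n w))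
              (\<Pi>\<^sub>M n\<in>UNIV. borel \<Otimes>\<^sub>M borel)))"
    and "0 < \<tau>"
  shows "let fL = contact_density \<Lambda>0 PL; fN = contact_density \<Lambda>0 PN;
             CL = (\<lambda>r. cond_coverage \<Lambda>0 \<beta> GA gA \<theta>A \<sigma> \<alpha>L PL \<alpha>N PN \<tau> r k);
             CN = (\<lambda>r. cond_coverage \<Lambda>0 \<beta> GA gA \<theta>A \<sigma> \<alpha>N PN \<alpha>L PL \<tau> r k);
             IL = (\<lambda>r. fL r * void_prob \<Lambda>0 PN (r powr (\<alpha>L / \<alpha>N)) * CL r);
             IN = (\<lambda>r. void_prob \<Lambda>0 PL (r powr (\<alpha>N / \<alpha>L)) * fN r * CN r)
         in set_integrable lborel {0..} IL \<and> set_integrable lborel {0..} IN \<and>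
            measure M {w \<in> space M. ennreal \<tau> <
                SINR \<beta> \<alpha>L \<alpha>N GA \<sigma> (\<lambda>n. X n w) (\<lambda>n. L n w) (\<lambda>n. h n w) (\<lambda>n. G n w)}
            = (LBINT r:{0..}. IL r) + (LBINT r:{0..}. IN r)"
proof -
  interpret prob_space M by (rule assms(1))
  interpret fading M h G GA gA \<theta>A k
    by unfold_locales (use assms(6,7,9,10,18-20) in auto)
  note \<Lambda> = assms(2) and \<beta> = assms(3) and PLm = assms(11) and PL01 = assms(12) and PN = assms(13)
    and ppp = assms(14) and Xm [measurable] = assms(15) and bij = assms(16) and los = assms(17)
    and ind = assms(21) and \<tau> = assms(22)
  have GA: "0 < GA" by (rule params)
  have Lm [measurable]: "L n \<in> M \<rightarrow>\<^sub>M count_space UNIV" for n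
    using los by (simp add: los_states_def)

  \<comment> \<open>Links as pairs of type and equivalent distance\<close>
  define \<alpha> where "\<alpha> b = (if b then \<alpha>L else \<alpha>N)" for b
  have \<alpha>: "0 < \<alpha> b" for b using assms(4,5) by (simp add: \<alpha>_def)
  define P where "P b = (if b then PL else PN)" for b
  have PNm: "PN \<in> borel_measurable borel"
  proof -
    have "PN = (\<lambda>r. 1 - PL r)" by (rule ext) (rule PN)
    then show ?thesis using PLm by simp
  qed
  have Pm [measurable]: "P b \<in> borel_measurable borel" for b
    using PLm PNm by (simp add: P_def)
  have P01: "0 \<le> P b v \<and> P b v \<le> 1" if "0 \<le> v" for b v
    using PL01[OF that] by (simp add: P_def PN)
  define \<kappa> where "\<kappa> = \<tau> / GA\<^sup>2"
  have \<kappa>: "0 < \<kappa>" using \<tau> GA by (simp add: \<kappa>_def)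
  define \<gamma> where "\<gamma> = \<phi> \<kappa>"
  have \<gamma>: "0 < \<gamma>" using \<kappa> by (simp add: \<gamma>_def W.laplace_pos)
  define Y where "Y m w = norm (X m w) powr \<alpha> (L m w)" for m w
  define D where "D p = snd p powr \<alpha> (fst p)" for p :: "bool \<times> real"
  \<comment> \<open>The factor of a link at equivalent distance y when the serving link is at s;
    only the ratio of the two path gains enters.\<close>
  define \<psi> where "\<psi> s y = \<phi> (\<kappa> * (s / y))" for s y
  define c where "c s = exp (- (\<kappa> * s / \<beta> * \<sigma>\<^sup>2))" for s
  define T where "T w = (INF m. Y m w)" for w
  define R where "R s t = exp_minus (\<integral>\<^sup>+p. ennreal (1 - indicator {t..} (D p) * \<psi> s (D p)) \<partial>link_measure \<Lambda>0 P)" for s t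
  define K where "K t = pi * \<Lambda>0 * ((t powr (1 / \<alpha> True))\<^sup>2 + (t powr (1 / \<alpha> False))\<^sup>2)" for t
  have \<psi>m [measurable]: "\<psi> s \<in> borel_measurable borel" for s
    unfolding \<psi>_def by measurable
  have Ym [measurable]: "Y m \<in> borel_measurable M" for m
    unfolding Y_def \<alpha>_def by measurable
  have Dm: "D \<in> borel_measurable (link_measure \<Lambda>0 P)"
    unfolding D_def by (rule measurable_link_measure[of "\<lambda>b u. u powr \<alpha> b"]) measurable
  have \<psi>01: "0 \<le> \<psi> s y \<and> \<psi> s y \<le> 1" if "0 \<le> s" "0 \<le> y" for s y
    using \<kappa> that by (auto simp: \<psi>_def intro!: W.laplace_le_1 less_imp_le[OF W.laplace_pos] mult_nonneg_nonneg divide_nonneg_nonneg)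
  have Y0: "0 \<le> Y m w" for m w by (simp add: Y_def)
  have D0: "0 \<le> D p" for p by (simp add: D_def)
  have K: "continuous_on {0..} K"
    unfolding K_def using \<alpha> by (intro continuous_intros continuous_on_powr') auto
  have DK: "K x \<le> K y \<and> emeasure (link_measure \<Lambda>0 P) {p \<in> space (link_measure \<Lambda>0 P). x \<le> D p \<and> D p < y} \<le> ennreal (K y - K x)"
    if "0 \<le> x" "x \<le> y" for x y
    unfolding K_def D_def by (rule emeasure_link_measure_annulus[OF Pm P01 _ \<alpha> that]) (use \<Lambda> in auto)
  have \<psi>anti: "\<psi> s' y \<le> \<psi> s y" if "0 \<le> s" "s \<le> s'" "0 \<le> y" for s s' y
    unfolding \<psi>_def using \<kappa> that by (intro W.laplace_antimono mult_left_mono divide_right_mono) auto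
  have \<psi>cont: "continuous_on {0..} (\<lambda>s. \<psi> s y)" if "0 \<le> y" for y
    unfolding \<psi>_def
  proof (rule continuous_on_compose2[OF W.laplace_continuous])
    show "continuous_on {0..} (\<lambda>s. \<kappa> * (s / y))"
      unfolding divide_inverse by (intro continuous_intros)
    show "(\<lambda>s. \<kappa> * (s / y)) ` {0..} \<subseteq> {0..}"
      using \<kappa> that by auto
  qed
  have ccont: "continuous_on {0..} c"
    unfolding c_def using \<beta> by (intro continuous_intros) auto
  have c01: "0 \<le> c s \<and> c s \<le> 1" if "0 \<le> s" for s
    using \<kappa> \<beta> that by (simp add: c_def)
  have pgfl: "(\<integral>\<^sup>+w. ennreal (inf_prod (\<lambda>m. indicator {t..} (Y m w) * \<psi> s (Y m w))) \<partial>M) =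
      ennreal (exp_minus (\<integral>\<^sup>+p. ennreal (1 - indicator {t..} (D p) * \<psi> s (D p)) \<partial>link_measure \<Lambda>0 P))"
    if "0 \<le> s" "0 \<le> t" for s t
    unfolding Y_def D_def
  proof (rule link_pgfl[where v="\<lambda>b u. indicator {t..} (u powr \<alpha> b) * \<psi> s (u powr \<alpha> b)", OF assms(1) ppp _ Xm bij])
    show "los_states M (P True) X L" using los by (simp add: P_def)
    show "P False r = 1 - P True r" for r by (simp add: P_def PN)
    show "0 \<le> indicator {t..} (u powr \<alpha> b) * \<psi> s (u powr \<alpha> b)" "indicator {t..} (u powr \<alpha> b) * \<psi> s (u powr \<alpha> b) \<le> 1" for b u
      using \<psi>01[OF that(1), of "u powr \<alpha> b"] by (auto simp: indicator_def)
  qed (use \<Lambda> P01 in auto)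
  note near = nn_integral_nearest_point[where \<psi>=\<psi>, OF assms(1) Ym Y0 Dm D0 K DK \<psi>m \<psi>01 \<psi>anti \<psi>cont c01 ccont pgfl,
      folded T_def R_def]

  \<comment> \<open>The coverage event, conditioned on the links\<close>
  define Ev where "Ev = {w \<in> space M. ennreal \<tau> < SINR \<beta> \<alpha>L \<alpha>N GA \<sigma> (\<lambda>n. X n w) (\<lambda>n. L n w) (\<lambda>n. h n w) (\<lambda>n. G n w)}"
  have Ev [measurable]: "Ev \<in> sets M"
    unfolding Ev_def using measurable_SINR[where x=X and los=L and h=h and G=G and N=M] by measurable
  \<comment> \<open>The factor \<gamma> = \<phi> \<kappa> adds the serving point to the product over
    the interferers; it is divided out in \<open>em\<close>.\<close>
  have cover: "ennreal \<gamma> * emeasure M Ev = (\<integral>\<^sup>+w. ennreal (c (T w) * inf_prod (\<lambda>m. \<psi> (T w) (Y m w))) \<partial>M)"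
  proof -
    let ?S = "\<Pi>\<^sub>M n\<in>(UNIV :: nat set). (borel :: (real^2) measure) \<Otimes>\<^sub>M count_space (UNIV :: bool set)"
    let ?H = "\<Pi>\<^sub>M n\<in>(UNIV :: nat set). (borel :: real measure) \<Otimes>\<^sub>M (borel :: real measure)"
    define f where "f p = ennreal \<gamma> * indicator {p. ennreal \<tau> < SINR \<beta> \<alpha>L \<alpha>N GA \<sigma> (\<lambda>n. fst (fst p n)) (\<lambda>n. snd (fst p n)) (\<lambda>n. fst (snd p n)) (\<lambda>n. snd (snd p n))} p"
      for p :: "(nat \<Rightarrow> (real^2) \<times> bool) \<times> (nat \<Rightarrow> real \<times> real)"
    have fm: "f \<in> borel_measurable (?S \<Otimes>\<^sub>M ?H)"
    proof -
      have [measurable]: "(\<lambda>p. SINR \<beta> \<alpha>L \<alpha>N GA \<sigma> (\<lambda>n. fst (fst p n)) (\<lambda>n. snd (fst p n)) (\<lambda>n. fst (snd p n)) (\<lambda>n. snd (snd p n))) \<in> borel_measurable (?S \<Otimes>\<^sub>M ?H)"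
        by (rule measurable_SINR) measurable
      show ?thesis unfolding f_def by measurable
    qed
    have "ennreal \<gamma> * emeasure M Ev = (\<integral>\<^sup>+w. f ((\<lambda>n. (X n w, L n w)), (\<lambda>n. (h n w, G n w))) \<partial>M)"
    proof -
      have "(\<integral>\<^sup>+w. f ((\<lambda>n. (X n w, L n w)), (\<lambda>n. (h n w, G n w))) \<partial>M) = (\<integral>\<^sup>+w. ennreal \<gamma> * indicator Ev w \<partial>M)"
        by (rule nn_integral_cong) (auto simp: f_def Ev_def indicator_def)
      then show ?thesis by (simp add: nn_integral_cmult_indicator)
    qed
    also have "\<dots> = (\<integral>\<^sup>+w. \<integral>\<^sup>+w'. f ((\<lambda>n. (X n w, L n w)), (\<lambda>n. (h n w', G n w'))) \<partial>M \<partial>M)"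
      by (rule nn_integral_indep_set[where f=f and S="?S" and T="?H", OF _ _ ind fm]; rule measurable_PiM_single')
         (auto simp: space_pair_measure)
    also have "\<dots> = (\<integral>\<^sup>+w. ennreal (c (T w) * inf_prod (\<lambda>m. \<psi> (T w) (Y m w))) \<partial>M)"
    proof (rule nn_integral_cong_AE)
      show "AE w in M. (\<integral>\<^sup>+w'. f ((\<lambda>n. (X n w, L n w)), (\<lambda>n. (h n w', G n w'))) \<partial>M) = ennreal (c (T w) * inf_prod (\<lambda>m. \<psi> (T w) (Y m w)))"
        \<comment> \<open>Off a null event the points are enumerated without repetition and avoid
          the origin, so a serving point exists and all equivalent distances are positive.\<close>
        using AE_space bij ppp_AE_not_0[OF assms(1) ppp]
      proof eventually_elim
        fix w assume w: "w \<in> space M" and bijw: "bij_betw (\<lambda>n. X n w) UNIV (\<Phi> w)" and "0 \<notin> \<Phi> w"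
        then have nz: "X n w \<noteq> 0" for n by (metis bij_betwE UNIV_I)
        have Ypos: "0 < Y n w" for n using nz by (simp add: Y_def)
        have fin: "finite {n. norm (X n w) \<le> r}" for r
        proof -
          have "(\<lambda>n. X n w) ` {n. norm (X n w) \<le> r} \<subseteq> \<Phi> w \<inter> cball 0 r"
            using bij_betwE[OF bijw] by auto
          then have "finite ((\<lambda>n. X n w) ` {n. norm (X n w) \<le> r})"
            by (rule finite_subset) (rule homogeneous_pppD(1)[OF ppp w bounded_cball])
          then show ?thesis
            by (rule finite_imageD) (use bijw in \<open>auto simp: bij_betw_def inj_on_def\<close>)
        qed
        define n0 where "n0 = serving \<beta> \<alpha>L \<alpha>N (\<lambda>n. X n w) (\<lambda>n. L n w)"
        define l where "l m = path_gain \<beta> \<alpha>L \<alpha>N (L m w) (norm (X m w))" for m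
        have l: "l m = \<beta> / Y m w" for m by (simp add: l_def path_gain_eq Y_def \<alpha>_def)
        have T: "T w = Y n0 w"
          unfolding T_def n0_def Y_def \<alpha>_def
          by (rule serving_nearest) (use \<beta> assms(4,5) fin nz in auto)
        have "(\<integral>\<^sup>+w'. f ((\<lambda>n. (X n w, L n w)), (\<lambda>n. (h n w', G n w'))) \<partial>M) =
          (\<integral>\<^sup>+w'. ennreal \<gamma> * indicator {w' \<in> space M. ennreal \<tau> < SINR \<beta> \<alpha>L \<alpha>N GA \<sigma> (\<lambda>n. X n w) (\<lambda>n. L n w) (\<lambda>n. h n w') (\<lambda>n. G n w')} w' \<partial>M)"
          by (rule nn_integral_cong) (simp add: f_def indicator_def)
        also have "\<dots> = ennreal \<gamma> * emeasure M {w' \<in> space M. ennreal \<tau> < SINR \<beta> \<alpha>L \<alpha>N GA \<sigma> (\<lambda>n. X n w) (\<lambda>n. L n w) (\<lambda>n. h n w') (\<lambda>n. G n w')}"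
        proof (rule nn_integral_cmult_indicator)
          have [measurable]: "(\<lambda>w'. SINR \<beta> \<alpha>L \<alpha>N GA \<sigma> (\<lambda>n. X n w) (\<lambda>n. L n w) (\<lambda>n. h n w') (\<lambda>n. G n w')) \<in> borel_measurable M"
            by (rule measurable_SINR) measurable
          show "{w' \<in> space M. ennreal \<tau> < SINR \<beta> \<alpha>L \<alpha>N GA \<sigma> (\<lambda>n. X n w) (\<lambda>n. L n w) (\<lambda>n. h n w') (\<lambda>n. G n w')} \<in> sets M"
            by measurable
        qed
        also have "\<dots> = ennreal (exp (- (\<tau> / (GA\<^sup>2 * l n0) * \<sigma>\<^sup>2)) * inf_prod (\<lambda>m. \<phi> (\<tau> / (GA\<^sup>2 * l n0) * l m)))"
          unfolding SINR_def Let_def interference_def n0_def[symmetric] l_def[symmetric] \<gamma>_def \<kappa>_def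
          by (rule prob_covered_given_links) (use \<tau> \<beta> Ypos in \<open>auto simp: l less_imp_le\<close>)
        also have "\<dots> = ennreal (c (T w) * inf_prod (\<lambda>m. \<psi> (T w) (Y m w)))"
          using \<beta> by (simp add: T l c_def \<psi>_def \<kappa>_def)
        finally show "(\<integral>\<^sup>+w'. f ((\<lambda>n. (X n w, L n w)), (\<lambda>n. (h n w', G n w'))) \<partial>M) = ennreal (c (T w) * inf_prod (\<lambda>m. \<psi> (T w) (Y m w)))" .
      qed
    qed
    finally show ?thesis .
  qed

  \<comment> \<open>Passage to integrals over the link length\<close>
  define F where "F b u = c (u powr \<alpha> b) * (R (u powr \<alpha> b) (u powr \<alpha> b) * \<psi> (u powr \<alpha> b) (u powr \<alpha> b))" for b u
  define J where "J b u = ennreal (2 * pi * \<Lambda>0 * u) * ennreal (P b u) * ennreal (F b u)" for b u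
  define I where "I b u = contact_density \<Lambda>0 (P b) u * void_prob \<Lambda>0 (P (\<not> b)) (u powr (\<alpha> b / \<alpha> (\<not> b))) *
    cond_coverage \<Lambda>0 \<beta> GA gA \<theta>A \<sigma> (\<alpha> b) (P b) (\<alpha> (\<not> b)) (P (\<not> b)) \<tau> u k" for b u
  \<comment> \<open>The diagonal in \<open>F\<close> has no evident measurability; it is supplied by
    \<open>near(2)\<close>, restricted to one type along u \<mapsto> (b, u).\<close>
  have Fm [measurable]: "(\<lambda>u. ennreal (F b u)) \<in> borel_measurable borel" for b
  proof -
    have "(\<lambda>u. (b, u)) \<in> borel \<rightarrow>\<^sub>M link_measure \<Lambda>0 P"
      by (subst measurable_cong_sets[OF refl sets_link_measure]) measurable
    from measurable_compose[OF this near(2)] show ?thesis by (simp add: F_def D_def)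
  qed
  have Jm [measurable]: "J b \<in> borel_measurable borel" for b
    unfolding J_def by measurable
  have I0: "0 \<le> I b u" if "0 \<le> u" for b u
    using that \<Lambda> P01[OF that, of b]
    by (auto simp: I_def contact_density_def void_prob_def cond_coverage_def interference_laplace_def intro!: mult_nonneg_nonneg)
  \<comment> \<open>Here \<gamma> cancels: \<open>F\<close> contains \<psi> s s = \<phi> \<kappa>,
    the factor of the serving link itself. The length u = 0 is separate because
    \<open>exp_minus_link_laplace\<close> asks for a positive length.\<close>
  have IJ: "ennreal (indicator {0..} u * I b u) = J b u * ennreal (1 / \<gamma>)" for b u
  proof -
    consider "u < 0" | "u = 0" | "0 < u" by linarith
    then show ?thesis
    proof cases
      case 1
      then have "2 * pi * \<Lambda>0 * u \<le> 0" using \<Lambda> by (auto simp: mult_nonneg_nonpos)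
      then show ?thesis using 1 by (simp add: J_def ennreal_neg)
    next
      case 2
      then show ?thesis by (simp add: J_def I_def contact_density_def)
    next
      case 3
      define s where "s = u powr \<alpha> b"
      have s: "0 < s" using 3 by (simp add: s_def)
      have "R s s = void_prob \<Lambda>0 (P b) u * void_prob \<Lambda>0 (P (\<not> b)) (u powr (\<alpha> b / \<alpha> (\<not> b))) *
          interference_laplace \<Lambda>0 \<beta> GA gA \<theta>A (\<alpha> b) (P b) (\<alpha> (\<not> b)) (P (\<not> b)) (s * \<tau> / (GA\<^sup>2 * \<beta>)) u k"
        unfolding R_def \<psi>_def D_def \<kappa>_def s_def
        by (rule exp_minus_link_laplace[OF Pm P01 _ \<beta> \<tau> \<alpha> 3]) (use \<Lambda> in auto)
      moreover have "\<psi> s s = \<gamma>" using s by (simp add: \<psi>_def \<gamma>_def)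
      moreover have "c s = exp (- (s * \<tau> * \<sigma>\<^sup>2 / (GA\<^sup>2 * \<beta>)))" by (simp add: c_def \<kappa>_def field_simps)
      ultimately have "I b u = 2 * pi * \<Lambda>0 * u * P b u * F b u * (1 / \<gamma>)"
        using \<gamma> by (simp add: I_def F_def contact_density_def cond_coverage_def s_def[symmetric])
      moreover have "0 \<le> F b u" using \<psi>01[of s s] s by (simp add: F_def c_def R_def s_def[symmetric])
      moreover have "J b u * ennreal (1 / \<gamma>) = ennreal (2 * pi * \<Lambda>0 * u * P b u * F b u * (1 / \<gamma>))"
        unfolding J_def using 3 \<Lambda> \<gamma> P01[of u b] \<open>0 \<le> F b u\<close> by (subst ennreal_mult[symmetric]; simp)+
      ultimately show ?thesis using 3 by simp
    qed
  qed
  have em: "emeasure M Ev = (\<integral>\<^sup>+u. ennreal (indicator {0..} u * I True u) \<partial>lborel) + (\<integral>\<^sup>+u. ennreal (indicator {0..} u * I False u) \<partial>lborel)"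
  proof -
    have "ennreal \<gamma> * emeasure M Ev = (\<integral>\<^sup>+p. ennreal (F (fst p) (snd p)) \<partial>link_measure \<Lambda>0 P)"
      using cover near(1) by (simp add: F_def D_def)
    also have "\<dots> = (\<integral>\<^sup>+u. J True u \<partial>lborel) + (\<integral>\<^sup>+u. J False u \<partial>lborel)"
      unfolding J_def by (rule nn_integral_link_measure[where f="\<lambda>b u. ennreal (F b u)"]) measurable
    finally have "ennreal \<gamma> * emeasure M Ev * ennreal (1 / \<gamma>) = ((\<integral>\<^sup>+u. J True u \<partial>lborel) + (\<integral>\<^sup>+u. J False u \<partial>lborel)) * ennreal (1 / \<gamma>)"
      by simp
    moreover have "ennreal \<gamma> * emeasure M Ev * ennreal (1 / \<gamma>) = emeasure M Ev"
    proof -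
      have "ennreal \<gamma> * ennreal (1 / \<gamma>) = 1" using \<gamma> by (simp flip: ennreal_mult)
      then show ?thesis by (metis mult.commute mult.left_commute mult.right_neutral)
    qed
    ultimately show ?thesis
      by (simp add: IJ nn_integral_multc distrib_right)
  qed
  \<comment> \<open>Measurability of \<open>I\<close> is inherited from \<open>J\<close>: being
    nonnegative on {0..}, the integrand is recovered by \<open>enn2real\<close>.\<close>
  have Im: "(\<lambda>u. indicator {0..} u * I b u) \<in> borel_measurable lborel" for b
  proof -
    have "(\<lambda>u. indicator {0..} u * I b u) = (\<lambda>u. enn2real (J b u * ennreal (1 / \<gamma>)))"
      unfolding IJ[symmetric] using I0[of _ b] by (auto simp: indicator_def)
    then show ?thesis by simp
  qed
  \<comment> \<open>Integrability takes no estimate: both integrals are bounded by a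
    probability.\<close>
  have fin: "(\<integral>\<^sup>+u. ennreal (indicator {0..} u * I b u) \<partial>lborel) < \<infinity>" for b
  proof -
    have "(\<integral>\<^sup>+u. ennreal (indicator {0..} u * I b u) \<partial>lborel) \<le> emeasure M Ev"
      unfolding em by (cases b) auto
    also have "\<dots> < \<infinity>" by (simp add: emeasure_eq_measure)
    finally show ?thesis .
  qed
  have int: "integrable lborel (\<lambda>u. indicator {0..} u * I b u)" for b
    by (rule integrableI_nonneg[OF Im _ fin]) (auto simp: I0 indicator_def)
  have nn: "0 \<le> (LINT u|lborel. indicator {0..} u * I b u)" for b
    by (rule integral_nonneg_AE) (auto simp: I0 indicator_def)
  have "emeasure M Ev = ennreal (LINT u|lborel. indicator {0..} u * I True u) + ennreal (LINT u|lborel. indicator {0..} u * I False u)"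
    unfolding em by (intro arg_cong2[where f="(+)"] nn_integral_eq_integral int) (auto simp: I0 indicator_def)
  then have "measure M Ev = (LINT u|lborel. indicator {0..} u * I True u) + (LINT u|lborel. indicator {0..} u * I False u)"
    unfolding emeasure_eq_measure by (simp only: ennreal_plus[OF nn nn, symmetric] ennreal_inj measure_nonneg add_nonneg_nonneg nn)
  moreover have "I False u = void_prob \<Lambda>0 PL (u powr (\<alpha>N / \<alpha>L)) * contact_density \<Lambda>0 PN u *
      cond_coverage \<Lambda>0 \<beta> GA gA \<theta>A \<sigma> \<alpha>N PN \<alpha>L PL \<tau> u k" for u
    by (simp add: I_def \<alpha>_def P_def)
  moreover have "I True u = contact_density \<Lambda>0 PL u * void_prob \<Lambda>0 PN (u powr (\<alpha>L / \<alpha>N)) *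
      cond_coverage \<Lambda>0 \<beta> GA gA \<theta>A \<sigma> \<alpha>L PL \<alpha>N PN \<tau> u k" for u
    by (simp add: I_def \<alpha>_def P_def)
  ultimately show ?thesis
    using int[of True] int[of False]
    by (simp add: Let_def set_integrable_def set_lebesgue_integral_def Ev_def)
qed

end
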